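(* Let $n\in\mathbb{N}$ be even. Then the trivial equilibrium $x_F=(F,\ldots,F)$ of the $n$-dimensional Lorenz-96 model exhibits a supercritical pitchfork bifurcation at the parameter value $F_{\mathrm{P},1}:=-\tfrac12$.
   Context: The $n$-dimensional Lorenz-96 model with parameter $F\in\mathbb{R}$ is the system of ordinary differential equations on $\mathbb{R}^n$ given by $\dot{x}_j = x_{j-1}(x_{j+1}-x_{j-2}) - x_j + F$, $j=1,\ldots,n$, where all indices are taken modulo $n$ (i.e. $x_{j-n}=x_{j+n}=x_j$). The point $x_F=(F,\ldots,F)\in\mathbb{R}^n$ is an equilibrium for every $F\in\mathbb{R}$. Pitchfork bifurcation: a one-parameter family of equilibria $x_0(F)$ of $\dot x=f(x,F)$ exhibits a pitchfork bifurcation at $F=F_0$ if the Jacobian at $x_0(F_0)$ has a simple eigenvalue $0$ and no other eigenvalues on the imaginary axis, and, for $F$ near $F_0$, the restriction of the system to the one-dimensional parameter-dependent center manifold is locally topologically equivalent near $x_0$ to the normal form $\dot\xi=\beta\xi\pm\xi^3$, where $\beta=\beta(F)$ is a local reparametrisation with $\beta(F_0)=0$ and $x_0(F)$ corresponds to $\xi=0$. The bifurcation is supercritical if the sign of the cubic term is negative, i.e. the normal form is $\dot\xi=\beta\xi-\xi^3$. *)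

theory Defs
  imports "HOL-Analysis.Analysis" "HOL-Computational_Algebra.Polynomial"
begin

text \<open>
  Coordinates are indexed by a finite commutative ring \<open>'n\<close> generated additively by 1, i.e. by
  \<open>\<int>/n\<int>\<close> with \<open>n = CARD('n)\<close>, so that index arithmetic in \<open>'n\<close> is arithmetic modulo \<open>n\<close>.
  For every even \<open>n \<ge> 2\<close> such a type exists, namely \<open>'m bit0\<close> with \<open>CARD('m) = n div 2\<close>.
\<close>

lemma surj_of_nat_bit0: "surj (of_nat :: nat \<Rightarrow> ('m::finite) bit0)"
  unfolding surj_def
proof
  fix j :: "'m bit0"
  obtain z :: int where "j = of_int z" "0 \<le> z"
    by (cases j rule: bit0_cases) auto
  then have "j = of_nat (nat z)"
    by simp
  then show "\<exists>k. j = of_nat k" ..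
qed

definition lorenz96 ::
  "real ^ 'n::{finite,comm_ring_1} \<Rightarrow> real \<Rightarrow> real ^ 'n::{finite,comm_ring_1}" where
  "lorenz96 x F = (\<chi> j. x $ (j - 1) * (x $ (j + 1) - x $ (j - 2)) - x $ j + F)"

definition charpoly :: "'a::comm_ring_1 ^ 'n::finite ^ 'n::finite \<Rightarrow> 'a poly" where
  "charpoly A = det (mat [:0, 1:] - map_matrix (\<lambda>a. [:a:]) A)"

text \<open>Simplicity is algebraic: 0 is a simple root of the characteristic polynomial.\<close>

definition simple_zero_eigenvalue_only_critical :: "real ^ 'n::finite ^ 'n::finite \<Rightarrow> bool" where
  "simple_zero_eigenvalue_only_critical A \<longleftrightarrow>
     (let p = charpoly (map_matrix complex_of_real A)
      in order 0 p = 1 \<and> (\<forall>z. poly p z = 0 \<and> Re z = 0 \<longrightarrow> z = 0))"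

definition solves :: "('a::real_normed_vector \<Rightarrow> 'a) \<Rightarrow> real set \<Rightarrow> (real \<Rightarrow> 'a) \<Rightarrow> bool" where
  "solves f J \<gamma> \<longleftrightarrow> (\<forall>t\<in>J. (\<gamma> has_vector_derivative f (\<gamma> t)) (at t within J))"

text \<open>
  Every solution curve of \<open>f\<close> lying in \<open>A\<close> is carried by \<open>h\<close> to a solution curve of \<open>g\<close>, up to
  an increasing change \<open>\<tau>\<close> of time.
\<close>

definition maps_orbits ::
  "('a::real_normed_vector \<Rightarrow> 'a) \<Rightarrow> 'a set \<Rightarrow>
   ('b::real_normed_vector \<Rightarrow> 'b) \<Rightarrow> ('a \<Rightarrow> 'b) \<Rightarrow> bool" where
  "maps_orbits f A g h \<longleftrightarrow>
     (\<forall>J \<gamma>. is_interval J \<and> solves f J \<gamma> \<and> \<gamma> ` J \<subseteq> A \<longrightarrow>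
        (\<exists>\<tau> \<eta>. strict_mono_on J \<tau> \<and> continuous_on J \<tau> \<and> solves g (\<tau> ` J) \<eta> \<and>
           (\<forall>t\<in>J. \<eta> (\<tau> t) = h (\<gamma> t))))"

text \<open>
  The two \<open>maps_orbits\<close> conditions together say that orbits in \<open>A\<close> are mapped \<^emph>\<open>onto\<close> orbits in \<open>B\<close>,
  preserving the direction of time. Here \<open>A\<close> may be an invariant submanifold, in which case
  this is equivalence of the system restricted to it.
\<close>

definition orbit_equivalence ::
  "('a::real_normed_vector \<Rightarrow> 'a) \<Rightarrow> 'a set \<Rightarrow>
   ('b::real_normed_vector \<Rightarrow> 'b) \<Rightarrow> 'b set \<Rightarrow> ('a \<Rightarrow> 'b) \<Rightarrow> ('b \<Rightarrow> 'a) \<Rightarrow> bool" where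
  "orbit_equivalence f A g B h k \<longleftrightarrow>
     homeomorphism A B h k \<and> maps_orbits f A g h \<and> maps_orbits g B f k"

text \<open>
  The real span of the generalised eigenspaces for eigenvalues on the imaginary axis: for a
  conjugate pair \<open>\<plusminus>\<i>\<omega>\<close> the real generalised eigenspace consists of the vectors killed by a
  power of \<open>L\<^sup>2 + \<omega>\<^sup>2\<close>; for \<open>\<omega> = 0\<close> this is the generalised kernel of \<open>L\<close>.
\<close>

definition center_subspace :: "('a::real_vector \<Rightarrow> 'a) \<Rightarrow> 'a set" where
  "center_subspace L =
     span (\<Union>\<omega>::real. {v. \<exists>k::nat. ((\<lambda>w. L (L w) + \<omega>\<^sup>2 *\<^sub>R w) ^^ k) v = 0})"

text \<open>
  A local center manifold of \<open>G\<close> at the equilibrium \<open>z\<^sub>0\<close>: the graph, over a ball in the center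
  subspace \<open>T\<close>, of a \<open>C\<^sup>1\<close> map \<open>\<phi>\<close> into a complement \<open>N\<close> of \<open>T\<close>, with \<open>\<phi> 0 = 0\<close> and \<open>D\<phi>(0) = 0\<close>
  (tangency to \<open>T\<close>), which is locally invariant. Taking \<open>\<phi>\<close> to be defined on a full ball rather
  than on a ball of \<open>T\<close> is harmless: compose with the projection onto \<open>T\<close> along \<open>N\<close>.
\<close>

definition center_manifold :: "('a::euclidean_space \<Rightarrow> 'a) \<Rightarrow> 'a \<Rightarrow> 'a set \<Rightarrow> bool" where
  "center_manifold G z\<^sub>0 M \<longleftrightarrow>
     G z\<^sub>0 = 0 \<and> G differentiable (at z\<^sub>0) \<and>
     (let T = center_subspace (frechet_derivative G (at z\<^sub>0)) in
       (\<exists>N r \<phi> (\<phi>' :: 'a \<Rightarrow> 'a \<Rightarrow>\<^sub>L 'a).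
          subspace N \<and> T \<inter> N = {0} \<and> (\<forall>z. \<exists>v\<in>T. \<exists>w\<in>N. z = v + w) \<and>
          r > 0 \<and>
          (\<forall>v\<in>ball 0 r. (\<phi> has_derivative blinfun_apply (\<phi>' v)) (at v)) \<and>
          continuous_on (ball 0 r) \<phi>' \<and>
          \<phi> 0 = 0 \<and> \<phi>' 0 = 0 \<and>
          (\<forall>v\<in>T \<inter> ball 0 r. \<phi> v \<in> N) \<and>
          M = (\<lambda>v. z\<^sub>0 + v + \<phi> v) ` (T \<inter> ball 0 r)) \<and>
       (\<exists>W. open W \<and> z\<^sub>0 \<in> W \<and>
          (\<forall>J \<gamma>. is_interval J \<and> solves G J \<gamma> \<and> \<gamma> ` J \<subseteq> W \<and> \<gamma> ` J \<inter> M \<noteq> {} \<longrightarrow> \<gamma> ` J \<subseteq> M)))"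

text \<open>The system \<open>x' = f(x,F), F' = 0\<close>, whose center manifolds are the parameter-dependent
  center manifolds of the family \<open>f\<close>.\<close>

definition extended_field :: "('a::real_normed_vector \<Rightarrow> real \<Rightarrow> 'a) \<Rightarrow> 'a \<times> real \<Rightarrow> 'a \<times> real" where
  "extended_field f = (\<lambda>(x, F). (f x F, 0))"

definition slice :: "('a \<times> real) set \<Rightarrow> real \<Rightarrow> 'a set" where
  "slice M F = {x. (x, F) \<in> M}"

definition pitchfork_normal_form :: "real \<Rightarrow> real \<Rightarrow> real \<Rightarrow> real" where
  "pitchfork_normal_form s \<beta> \<xi> = \<beta> * \<xi> + s * \<xi> ^ 3"

text \<open>
  For \<open>F\<close> in the neighbourhood \<open>I\<close> of \<open>F\<^sub>0\<close>, the homeomorphism \<open>h F\<close> is defined on the relatively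
  open subset \<open>A F\<close> of the center manifold at \<open>F\<close> and has range \<open>B F\<close>. The sets \<open>U\<close> and \<open>V\<close> make these
  neighbourhoods uniform in \<open>F\<close>; without them \<open>A F\<close> or \<open>B F\<close> could shrink as \<open>F\<close> tends to \<open>F\<^sub>0\<close> and miss
  the bifurcating equilibria. As usual for equivalence of parameter-dependent
  systems, \<open>h F\<close> need not depend continuously on \<open>F\<close>.
\<close>

definition pitchfork_bifurcation_sign ::
  "real \<Rightarrow> (real ^ 'n::finite \<Rightarrow> real \<Rightarrow> real ^ 'n::finite) \<Rightarrow> (real \<Rightarrow> real ^ 'n::finite) \<Rightarrow> real \<Rightarrow> bool" where
  "pitchfork_bifurcation_sign s f x\<^sub>0 F\<^sub>0 \<longleftrightarrow>
     (\<lambda>x. f x F\<^sub>0) differentiable (at (x\<^sub>0 F\<^sub>0)) \<and>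
     simple_zero_eigenvalue_only_critical (jacobian (\<lambda>x. f x F\<^sub>0) (at (x\<^sub>0 F\<^sub>0))) \<and>
     (\<exists>M I P \<beta> \<beta>' U V A B h k.
        center_manifold (extended_field f) (x\<^sub>0 F\<^sub>0, F\<^sub>0) M \<and>
        open I \<and> F\<^sub>0 \<in> I \<and> open P \<and> homeomorphism I P \<beta> \<beta>' \<and> \<beta> F\<^sub>0 = 0 \<and>
        open U \<and> x\<^sub>0 F\<^sub>0 \<in> U \<and> open V \<and> 0 \<in> V \<and>
        (\<forall>F\<in>I.
           f (x\<^sub>0 F) F = 0 \<and>
           openin (top_of_set (slice M F)) (A F) \<and> slice M F \<inter> U \<subseteq> A F \<and>
           open (B F) \<and> V \<subseteq> B F \<and>
           x\<^sub>0 F \<in> A F \<and> h F (x\<^sub>0 F) = 0 \<and>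
           orbit_equivalence (\<lambda>x. f x F) (A F) (pitchfork_normal_form s (\<beta> F)) (B F) (h F) (k F)))"

definition pitchfork_bifurcation ::
  "(real ^ 'n::finite \<Rightarrow> real \<Rightarrow> real ^ 'n::finite) \<Rightarrow> (real \<Rightarrow> real ^ 'n::finite) \<Rightarrow> real \<Rightarrow> bool" where
  "pitchfork_bifurcation f x\<^sub>0 F\<^sub>0 \<longleftrightarrow>
     pitchfork_bifurcation_sign 1 f x\<^sub>0 F\<^sub>0 \<or> pitchfork_bifurcation_sign (- 1) f x\<^sub>0 F\<^sub>0"

definition supercritical_pitchfork_bifurcation ::
  "(real ^ 'n::finite \<Rightarrow> real \<Rightarrow> real ^ 'n::finite) \<Rightarrow> (real \<Rightarrow> real ^ 'n::finite) \<Rightarrow> real \<Rightarrow> bool" where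
  "supercritical_pitchfork_bifurcation f x\<^sub>0 F\<^sub>0 \<longleftrightarrow> pitchfork_bifurcation_sign (- 1) f x\<^sub>0 F\<^sub>0"

end

theory Submission
  imports Defs
begin

text \<open>
  The space of states with \<open>x\<^sub>j\<^sub>+\<^sub>2 = x\<^sub>j\<close> is invariant. For a state \<open>x\<^sub>j = m + c (-1)\<^sup>j\<close> in it, put
  \<open>d = 2 c\<close>, \<open>\<sigma> = 2 m + 1\<close> and \<open>\<mu> = 2 F + 1\<close>; the system becomes \<open>d' = - d \<sigma>\<close>, \<open>\<sigma>' = d\<^sup>2 - \<sigma> + \<mu>\<close>.
  It suffices to find a center manifold \<open>\<sigma> = H (d, \<mu>)\<close> of this planar system, that is, a \<open>C\<^sup>1\<close> solution
  of \<open>H = \<mu> + d\<^sup>2 + d H \<partial>H/\<partial>d\<close> near the origin. Such an \<open>H\<close> is obtained by the Lyapunov-Perron method: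
  after reversing time and cutting off the nonlinearity, \<open>H (d, \<mu>)\<close> is the second initial
  coordinate of the only orbit that starts over \<open>d\<close> and does not grow like \<open>exp t\<close>.

  The equation for \<open>H\<close> says \<open>H (1 - d \<partial>H/\<partial>d) = \<mu> + d\<^sup>2\<close>. Hence the flow on the manifold is
  \<open>d' = - d H = (- \<mu> d - d\<^sup>3) / (1 - d \<partial>H/\<partial>d)\<close>, which is the normal form with \<open>\<beta> = - \<mu>\<close> up to a positive
  factor; a change of time removes that factor.

  For the spectrum, the quadratic form of the linearisation at \<open>F = - 1/2\<close> is
  \<open>- (\<Sum>j. (v\<^sub>j\<^sub>+\<^sub>1 + v\<^sub>j)\<^sup>2) / 4 - (\<Sum>j. (v\<^sub>j\<^sub>-\<^sub>2 - v\<^sub>j)\<^sup>2) / 4\<close>, so it vanishes exactly on the alternating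
  vectors, which span both the kernel and the left kernel.
\<close>

section \<open>Linear hyperbolic systems with bounded growth\<close>

text \<open>Differentiability of \<open>H\<close> is the delicate point. Distances between orbits
  grow at most like \<open>exp (t/4)\<close>, and a quadratic remainder along them at most like
  \<open>exp (t/2)\<close>. Both rates lie strictly between the eigenvalues 0 and 1 of the reversed
  linear part, so one linear estimate, used at both rates, yields a quadratic remainder for
  \<open>H\<close> that is uniform in the base point; this uniformity gives differentiability and a
  Lipschitz derivative at once. The cut-off must therefore keep a global quadratic remainder, which
  a convex function with clamped derivative does. The parameter \<mu> stays outside the cut-off as a
  constant forcing term. Once \<open>H\<close> is built, only its differential equation near the
  origin is used. Along solutions of the original system the defect \<sigma> -
  \<open>H (d, \<mu>)\<close> obeys a homogeneous linear equation, so it stays zero if it vanishes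
  once. No flow has to be constructed for this, and no statement on how long cut-off orbits stay
  small.\<close>

lemma mono_within_Icc:
  fixes f :: "real \<Rightarrow> real"
  assumes "a \<le> b"
    and "\<And>t. t \<in> {a..b} \<Longrightarrow> (f has_vector_derivative f' t) (at t within {a..b})"
    and "\<And>t. t \<in> {a..b} \<Longrightarrow> 0 \<le> f' t"
  shows "f a \<le> f b"
proof -
  obtain t where "t \<in> {a..b}" "f b - f a = f' t * (b - a)"
    using mvt_very_simple[of a b f "\<lambda>t h. h * f' t"] assms(1,2)
    by (auto simp: has_vector_derivative_def mult.commute)
  then show ?thesis using assms(1,3) by (smt (verit) mult_nonneg_nonneg)
qed

lemma growth_estimate_forward:
  fixes x :: "real \<Rightarrow> real"
  assumes "0 < \<eta>" "0 \<le> t"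
    and der: "\<And>t. 0 \<le> t \<Longrightarrow> (x has_vector_derivative g t) (at t within {0..})"
    and g: "\<And>t. 0 \<le> t \<Longrightarrow> \<bar>g t\<bar> \<le> C * exp (\<eta> * t)"
  shows "\<bar>x t\<bar> \<le> \<bar>x 0\<bar> + C / \<eta> * (exp (\<eta> * t) - 1)"
proof -
  \<comment> \<open>The two signs give the two halves of a bound on the absolute value of
    \<open>x t - x 0\<close>.\<close>
  have *: "s * x 0 \<le> s * x t + C / \<eta> * (exp (\<eta> * t) - 1)" if "s = 1 \<or> s = -1" for s
  proof -
    define f where "f = (\<lambda>t. s * x t + C / \<eta> * (exp (\<eta> * t) - 1))"
    have "f 0 \<le> f t"
    proof (rule mono_within_Icc[where f = f and f' = "\<lambda>t. s * g t + C * exp (\<eta> * t)"])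
      fix u assume u: "u \<in> {0..t}"
      have "(x has_vector_derivative g u) (at u within {0..t})"
        by (rule has_vector_derivative_within_subset[OF der]) (use u in auto)
      then show "(f has_vector_derivative s * g u + C * exp (\<eta> * u)) (at u within {0..t})"
        unfolding f_def has_real_derivative_iff_has_vector_derivative[symmetric]
        by (auto intro!: derivative_eq_intros simp: \<open>0 < \<eta>\<close> less_imp_neq[symmetric])
      show "0 \<le> s * g u + C * exp (\<eta> * u)"
        using g[of u] u that by (auto simp: abs_le_iff)
    qed (use assms in auto)
    then show ?thesis by (simp add: f_def)
  qed
  from *[of 1] *[of "-1"] show ?thesis by linarith
qed

text \<open>The growth bound selects the only solution of \<open>y' = y - g\<close> that does not grow like \<open>exp t\<close>,
  so no initial value enters the estimate.\<close>

lemma growth_estimate_backward: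
  fixes y :: "real \<Rightarrow> real"
  assumes "\<eta> < 1" "0 \<le> t"
    and der: "\<And>t. 0 \<le> t \<Longrightarrow> (y has_vector_derivative y t - g t) (at t within {0..})"
    and g: "\<And>t. 0 \<le> t \<Longrightarrow> \<bar>g t\<bar> \<le> C * exp (\<eta> * t)"
    and y: "\<And>t. 0 \<le> t \<Longrightarrow> \<bar>y t\<bar> \<le> B * exp (\<eta> * t)"
  shows "\<bar>y t\<bar> \<le> C / (1 - \<eta>) * exp (\<eta> * t)"
proof -
  define E where "E = (\<lambda>t. exp (- (1 - \<eta>) * t))"
  have E: "exp (- t) * exp (\<eta> * t) = E t" for t
    by (simp add: E_def exp_add[symmetric] algebra_simps)
  \<comment> \<open>Integration of \<open>exp (-t) * y t\<close> from \<open>t\<close> to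
    \<open>T\<close>. The growth bound on \<open>y\<close> enters only through the boundary term
    \<open>B * E T\<close>, which tends to 0 because \<eta> < 1.\<close>
  have *: "s * exp (-t) * y t \<le> C / (1 - \<eta>) * E t + B * E T" if s: "s = 1 \<or> s = -1" and "t \<le> T" for s T
  proof -
    define c where "c = C / (1 - \<eta>)"
    have c: "C = c * (1 - \<eta>)" using \<open>\<eta> < 1\<close> by (simp add: c_def)
    define f where "f = (\<lambda>t. s * (exp (-t) * y t) + c * (- E t))"
    have "f t \<le> f T"
    proof (rule mono_within_Icc[where f = f and f' = "\<lambda>t. - s * (exp (-t) * g t) + C * E t"])
      fix u assume u: "u \<in> {t..T}"
      have "(y has_vector_derivative y u - g u) (at u within {t..T})"
        by (rule has_vector_derivative_within_subset[OF der]) (use u \<open>0 \<le> t\<close> in auto)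
      moreover have "(E has_real_derivative - ((1 - \<eta>) * E u)) (at u within {t..T})"
        unfolding E_def by (auto intro!: derivative_eq_intros simp: algebra_simps)
      ultimately show "(f has_vector_derivative - s * (exp (-u) * g u) + C * E u) (at u within {t..T})"
        unfolding f_def has_real_derivative_iff_has_vector_derivative[symmetric] c
        by (auto intro!: derivative_eq_intros simp: algebra_simps)
      have "\<bar>exp (-u) * g u\<bar> \<le> exp (-u) * (C * exp (\<eta> * u))"
        using g[of u] u \<open>0 \<le> t\<close> by (simp add: abs_mult)
      also have "\<dots> = C * E u" using E[of u] by simp
      finally show "0 \<le> - s * (exp (-u) * g u) + C * E u"
        using s by auto
    qed (use that in auto)
    moreover have "\<bar>exp (-T) * y T\<bar> \<le> exp (-T) * (B * exp (\<eta> * T))"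
      using y[of T] that \<open>0 \<le> t\<close> by (simp add: abs_mult)
    moreover have "exp (-T) * (B * exp (\<eta> * T)) = B * E T" using E[of T] by simp
    moreover have "0 \<le> C" using g[of 0] by simp
    moreover have "0 \<le> C / (1 - \<eta>) * E T" using \<open>0 \<le> C\<close> \<open>\<eta> < 1\<close> by (simp add: E_def)
    ultimately show ?thesis using s by (auto simp: f_def c_def abs_le_iff)
  qed
  have lim: "((\<lambda>T. C / (1 - \<eta>) * E t + B * E T) \<longlongrightarrow> C / (1 - \<eta>) * E t + B * 0) at_top"
    unfolding E_def using \<open>\<eta> < 1\<close>
    by (intro tendsto_intros filterlim_compose[OF exp_at_bot] filterlim_tendsto_neg_mult_at_bot[OF tendsto_const])
       (auto simp: filterlim_ident)
  have **: "s * exp (-t) * y t \<le> C / (1 - \<eta>) * E t" if "s = 1 \<or> s = -1" for s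
    using tendsto_lowerbound[OF lim, of "s * exp (-t) * y t"] *[OF that]
    by (auto intro: eventually_mono[OF eventually_ge_at_top[of t]])
  have "\<bar>exp (-t) * y t\<bar> \<le> C / (1 - \<eta>) * E t"
    using **[of 1] **[of "-1"] by auto
  then have "exp t * \<bar>exp (-t) * y t\<bar> \<le> exp t * (C / (1 - \<eta>) * E t)"
    by (intro mult_left_mono) auto
  moreover have "exp t * \<bar>exp (-t) * y t\<bar> = \<bar>y t\<bar>"
    by (simp add: abs_mult exp_minus)
  moreover have "exp t * E t = exp (\<eta> * t)"
    by (simp add: E_def exp_add[symmetric] algebra_simps)
  ultimately show ?thesis
    by (metis mult.assoc mult.commute)
qed

text \<open>The linear part of the planar system in reversed time, with eigenvalue 0 in the first
  coordinate and 1 in the second, forced by \<open>g\<close>. The sign of \<open>snd (g t)\<close>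
  is that of the reversed term \<open>d\<^sup>2 + \<mu>\<close>.\<close>

definition hyperbolic_system :: "(real \<Rightarrow> real \<times> real) \<Rightarrow> (real \<Rightarrow> real \<times> real) \<Rightarrow> bool" where
  "hyperbolic_system g x \<longleftrightarrow> (\<forall>t\<ge>0. (x has_vector_derivative (fst (g t), snd (x t) - snd (g t))) (at t within {0..}))"

definition dominated :: "real \<Rightarrow> real \<Rightarrow> (real \<Rightarrow> real \<times> real) \<Rightarrow> bool" where
  "dominated \<eta> C x \<longleftrightarrow> (\<forall>t\<ge>0. norm (x t) \<le> C * exp (\<eta> * t))"

lemma hyperbolic_system_diff: "hyperbolic_system g x \<Longrightarrow> hyperbolic_system h y \<Longrightarrow> hyperbolic_system (\<lambda>t. g t - h t) (\<lambda>t. x t - y t)"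
  unfolding hyperbolic_system_def by (auto intro!: derivative_eq_intros simp: algebra_simps)

lemma hyperbolic_system_add: "hyperbolic_system g x \<Longrightarrow> hyperbolic_system h y \<Longrightarrow> hyperbolic_system (\<lambda>t. g t + h t) (\<lambda>t. x t + y t)"
  unfolding hyperbolic_system_def by (auto intro!: derivative_eq_intros simp: algebra_simps)

lemma hyperbolic_system_scaleR: "hyperbolic_system g x \<Longrightarrow> hyperbolic_system (\<lambda>t. c *\<^sub>R g t) (\<lambda>t. c *\<^sub>R x t)"
  unfolding hyperbolic_system_def
  by (auto intro!: derivative_eq_intros simp: algebra_simps prod_eq_iff)

lemma hyperbolic_system_continuous_on: "hyperbolic_system g x \<Longrightarrow> continuous_on {0..} x"
  unfolding hyperbolic_system_def continuous_on_eq_continuous_within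
  by (auto intro: has_vector_derivative_continuous)

lemma dominated_diff:
  "dominated \<eta> A x \<Longrightarrow> dominated \<eta> B y \<Longrightarrow> dominated \<eta> (A + B) (\<lambda>t. x t - y t)"
  unfolding dominated_def by (smt (verit) distrib_right norm_triangle_ineq4)

lemma dominated_add:
  "dominated \<eta> A x \<Longrightarrow> dominated \<eta> B y \<Longrightarrow> dominated \<eta> (A + B) (\<lambda>t. x t + y t)"
  unfolding dominated_def by (smt (verit) distrib_right norm_triangle_ineq)

lemma dominated_mono:
  assumes "dominated \<eta> A x" "A \<le> B" "\<eta> \<le> \<theta>" shows "dominated \<theta> B x"
  unfolding dominated_def
proof (intro allI impI)
  fix t :: real assume t: "0 \<le> t"
  have "0 \<le> A"
    using assms(1)[unfolded dominated_def, rule_format, of 0] norm_ge_zero[of "x 0"]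
    by (simp del: norm_ge_zero)
  have "norm (x t) \<le> A * exp (\<eta> * t)" using assms(1) t by (auto simp: dominated_def)
  also have "\<dots> \<le> B * exp (\<theta> * t)"
    using t assms \<open>0 \<le> A\<close> by (intro mult_mono) (auto intro!: mult_right_mono)
  finally show "norm (x t) \<le> B * exp (\<theta> * t)" .
qed

lemma dominated_nonneg: "dominated \<eta> C x \<Longrightarrow> 0 \<le> C"
  unfolding dominated_def by (metis exp_zero mult.right_neutral mult_zero_right norm_ge_zero order.trans order_refl)

text \<open>The terms \<open>1 / \<eta>\<close> and \<open>1 / (1 - \<eta>)\<close> come from
  integrating forward in the neutral coordinate and back from infinity in the expanding one. The a
  priori constant \<open>B\<close> does not survive into the bound, which is what makes contraction
  and uniqueness possible.\<close>

lemma hyperbolic_system_estimate: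
  assumes "0 < \<eta>" "\<eta> < 1" and "hyperbolic_system g x" "dominated \<eta> C g" "dominated \<eta> B x"
  shows "dominated \<eta> (\<bar>fst (x 0)\<bar> + C * (1 / \<eta> + 1 / (1 - \<eta>))) x"
  unfolding dominated_def
proof (intro allI impI)
  fix t :: real assume t: "0 \<le> t"
  have C: "0 \<le> C" using dominated_nonneg assms by blast
  have d: "(x has_vector_derivative (fst (g t), snd (x t) - snd (g t))) (at t within {0..})" if "0 \<le> t" for t
    using assms(3) that by (auto simp: hyperbolic_system_def)
  have "\<bar>fst (x t)\<bar> \<le> \<bar>fst (x 0)\<bar> + C / \<eta> * (exp (\<eta> * t) - 1)"
  proof (rule growth_estimate_forward[OF \<open>0 < \<eta>\<close> t])
    show "((\<lambda>t. fst (x t)) has_vector_derivative fst (g t)) (at t within {0..})" if "0 \<le> t" for t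
      using bounded_linear.has_vector_derivative[OF bounded_linear_fst d[OF that]] by simp
    show "\<bar>fst (g t)\<bar> \<le> C * exp (\<eta> * t)" if "0 \<le> t" for t
      using assms(4) norm_fst_le[of "fst (g t)" "snd (g t)"] that unfolding dominated_def
      by (metis order.trans prod.collapse real_norm_def)
  qed
  moreover have "\<bar>fst (x 0)\<bar> \<le> \<bar>fst (x 0)\<bar> * exp (\<eta> * t)"
    using t assms(1) by (simp add: mult_le_cancel_left1)
  moreover have "\<bar>snd (x t)\<bar> \<le> C / (1 - \<eta>) * exp (\<eta> * t)"
  proof (rule growth_estimate_backward[OF \<open>\<eta> < 1\<close> t])
    show "((\<lambda>t. snd (x t)) has_vector_derivative snd (x t) - snd (g t)) (at t within {0..})" if "0 \<le> t" for t
      using bounded_linear.has_vector_derivative[OF bounded_linear_snd d[OF that]] by simp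
    show "\<bar>snd (g t)\<bar> \<le> C * exp (\<eta> * t)" if "0 \<le> t" for t
      using assms(4) norm_snd_le[of "snd (g t)" "fst (g t)"] that unfolding dominated_def
      by (metis order.trans prod.collapse real_norm_def)
    show "\<bar>snd (x t)\<bar> \<le> B * exp (\<eta> * t)" if "0 \<le> t" for t
      using assms(5) norm_snd_le[of "snd (x t)" "fst (x t)"] that unfolding dominated_def
      by (metis order.trans prod.collapse real_norm_def)
  qed
  moreover have "norm (x t) \<le> \<bar>fst (x t)\<bar> + \<bar>snd (x t)\<bar>"
    using norm_Pair_le[of "fst (x t)" "snd (x t)"] by simp
  moreover have "C / \<eta> * (exp (\<eta> * t) - 1) \<le> C / \<eta> * exp (\<eta> * t)"
    using C assms(1) by (intro mult_left_mono) auto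
  ultimately show "norm (x t) \<le> (\<bar>fst (x 0)\<bar> + C * (1 / \<eta> + 1 / (1 - \<eta>))) * exp (\<eta> * t)"
    by (simp add: algebra_simps)
qed

text \<open>Variation of constants: the first coordinate is integrated from the prescribed value
  \<open>a\<close>, the second is \<open>exp t\<close> times the integral of \<open>h\<close> over
  the half-line from \<open>t\<close>, the one choice that does not grow like
  \<open>exp t\<close>.\<close>

lemma hyperbolic_system_exists:
  assumes "0 < \<eta>" "\<eta> < 1" and cont: "continuous_on {0..} g" and g: "dominated \<eta> C g"
  obtains x where "hyperbolic_system g x" "fst (x 0) = a" "\<exists>B. dominated \<eta> B x"
proof -
  have C: "0 \<le> C" using dominated_nonneg g by blast
  define h where "h = (\<lambda>t. exp (- t) * snd (g t))"
  have conth: "continuous_on {0..} h"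
    unfolding h_def by (intro continuous_intros cont)
  have contg1: "continuous_on {0..} (\<lambda>t. fst (g t))"
    by (intro continuous_intros cont)
  have gsnd: "\<bar>snd (g t)\<bar> \<le> C * exp (\<eta> * t)" if "0 \<le> t" for t
    using g norm_snd_le[of "snd (g t)" "fst (g t)"] that unfolding dominated_def
    by (metis order.trans prod.collapse real_norm_def)
  have gfst: "\<bar>fst (g t)\<bar> \<le> C * exp (\<eta> * t)" if "0 \<le> t" for t
    using g norm_fst_le[of "fst (g t)" "snd (g t)"] that unfolding dominated_def
    by (metis order.trans prod.collapse real_norm_def)
  have hb: "norm (h t) \<le> C * exp (- (1 - \<eta>) * t)" if "0 \<le> t" for t
  proof -
    have "norm (h t) \<le> exp (- t) * (C * exp (\<eta> * t))"
      using gsnd[OF that] by (simp add: h_def abs_mult)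
    also have "\<dots> = C * exp (- (1 - \<eta>) * t)" by (simp add: exp_add[symmetric] algebra_simps)
    finally show ?thesis .
  qed
  have dom: "((\<lambda>t. C * exp (- (1 - \<eta>) * t)) has_integral C * (exp (- (1 - \<eta>) * c) / (1 - \<eta>))) {c..}" for c
    using has_integral_exp_minus_to_infinity[of "1 - \<eta>" c] \<open>\<eta> < 1\<close> by (intro has_integral_mult_right) auto
  have hint: "h integrable_on {c..}" if "0 \<le> c" for c
  proof (rule measurable_bounded_by_integrable_imp_integrable)
    show "h \<in> borel_measurable (lebesgue_on {c..})"
      by (rule continuous_imp_measurable_on_sets_lebesgue)
         (use that in \<open>auto intro: continuous_on_subset[OF conth]\<close>)
    show "(\<lambda>t. C * exp (- (1 - \<eta>) * t)) integrable_on {c..}" using dom by blast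
  qed (use hb that in auto)
  have tail: "norm (integral {c..} h) \<le> C * (exp (- (1 - \<eta>) * c) / (1 - \<eta>))" if "0 \<le> c" for c
    using integral_norm_bound_integral[OF hint[OF that] has_integral_integrable[OF dom]] hb that
      integral_unique[OF dom] by auto
  have split: "integral {c..} h = integral {0..} h - integral {0..c} h" if "0 \<le> c" for c
  proof -
    have "integral ({0..c} \<union> {c..}) h = integral {0..c} h + integral {c..} h"
      by (rule integral_Un)
         (use that hint in \<open>auto intro!: integrable_continuous_interval continuous_on_subset[OF conth]
            negligible_subset[of "{c}"]\<close>)
    moreover have "{0..c} \<union> {c..} = {0..}" using that by auto
    ultimately show ?thesis by simp
  qed
  have prim: "((\<lambda>t. integral {0..t} f) has_vector_derivative f t) (at t within {0..})"
    if "continuous_on {0..} f" "0 \<le> t" for f :: "real \<Rightarrow> real" and t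
  proof -
    have "((\<lambda>t. integral {0..t} f) has_vector_derivative f t) (at t within {0..t+1})"
      by (rule integral_has_vector_derivative) (use that in \<open>auto intro: continuous_on_subset\<close>)
    moreover have "at t within {0..t+1} = at t within {0..}"
      by (rule at_within_nhd[of _ "{..<t+1}"]) auto
    ultimately show ?thesis by simp
  qed
  \<comment> \<open>The tail integral is written as a difference so that only an integral with
    variable upper limit has to be differentiated.\<close>
  define x where "x = (\<lambda>t. (a + integral {0..t} (\<lambda>r. fst (g r)), exp t * (integral {0..} h - integral {0..t} h)))"
  have "hyperbolic_system g x"
    unfolding hyperbolic_system_def
  proof (intro allI impI)
    fix t :: real assume t: "0 \<le> t"
    have 1: "((\<lambda>t. fst (x t)) has_vector_derivative fst (g t)) (at t within {0..})"
      unfolding x_def using prim[OF contg1 t] by (auto intro!: derivative_eq_intros)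
    have "((\<lambda>t. snd (x t)) has_real_derivative snd (x t) - snd (g t)) (at t within {0..})"
      using prim[OF conth t] unfolding x_def has_real_derivative_iff_has_vector_derivative[symmetric]
      by (auto intro!: derivative_eq_intros simp: h_def algebra_simps exp_minus)
    then have 2: "((\<lambda>t. snd (x t)) has_vector_derivative snd (x t) - snd (g t)) (at t within {0..})"
      by (simp add: has_real_derivative_iff_has_vector_derivative)
    show "(x has_vector_derivative (fst (g t), snd (x t) - snd (g t))) (at t within {0..})"
      using has_vector_derivative_Pair[OF 1 2] by simp
  qed
  moreover have "dominated \<eta> (\<bar>a\<bar> + C / \<eta> + C / (1 - \<eta>)) x"
    unfolding dominated_def
  proof (intro allI impI)
    fix t :: real assume t: "0 \<le> t"
    have "\<bar>fst (x t)\<bar> \<le> \<bar>fst (x 0)\<bar> + C / \<eta> * (exp (\<eta> * t) - 1)"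
    proof (rule growth_estimate_forward[OF \<open>0 < \<eta>\<close> t])
      show "((\<lambda>t. fst (x t)) has_vector_derivative fst (g t)) (at t within {0..})" if "0 \<le> t" for t
        unfolding x_def using prim[OF contg1 that] by (auto intro!: derivative_eq_intros)
    qed (use gfst in auto)
    moreover have "\<bar>a\<bar> \<le> \<bar>a\<bar> * exp (\<eta> * t)"
      using t assms(1) by (simp add: mult_le_cancel_left1)
    moreover have "\<bar>snd (x t)\<bar> \<le> C / (1 - \<eta>) * exp (\<eta> * t)"
    proof -
      have "\<bar>snd (x t)\<bar> = exp t * norm (integral {t..} h)"
        using split[OF t] by (simp add: x_def abs_mult)
      also have "\<dots> \<le> exp t * (C * (exp (- (1 - \<eta>) * t) / (1 - \<eta>)))"
        using tail[OF t] by (intro mult_left_mono) auto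
      also have "\<dots> = C / (1 - \<eta>) * (exp t * exp (- (1 - \<eta>) * t))" by simp
      also have "exp t * exp (- (1 - \<eta>) * t) = exp (\<eta> * t)"
        by (simp add: exp_add[symmetric] algebra_simps)
      finally show ?thesis .
    qed
    moreover have "norm (x t) \<le> \<bar>fst (x t)\<bar> + \<bar>snd (x t)\<bar>"
      using norm_Pair_le[of "fst (x t)" "snd (x t)"] by simp
    moreover have "C / \<eta> * (exp (\<eta> * t) - 1) \<le> C / \<eta> * exp (\<eta> * t)"
      using C assms(1) by (intro mult_left_mono) auto
    moreover have "fst (x 0) = a" by (simp add: x_def)
    ultimately show "norm (x t) \<le> (\<bar>a\<bar> + C / \<eta> + C / (1 - \<eta>)) * exp (\<eta> * t)"
      by (simp add: algebra_simps)
  qed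
  ultimately show ?thesis using that[of x] by (auto simp: x_def)
qed

lemma abs_fst_le: "\<bar>fst p\<bar> \<le> norm p" and abs_snd_le: "\<bar>snd p\<bar> \<le> norm p" for p :: "real \<times> real"
  by (metis norm_fst_le norm_snd_le prod.collapse real_norm_def)+

section \<open>The Lyapunov-Perron method\<close>

text \<open>The constant 1/16 is matched to the rates: \<open>1 / \<eta> + 1 / (1 - \<eta>)\<close>
  is 16/3 at \<eta> = 1/4 and 4 at \<eta> = 1/2, so the product is below 1/2 in both cases.
  Dependence on time admits the linearisation along an orbit, so that orbits and their derivatives
  fall under one theory.\<close>

definition small_field :: "(real \<Rightarrow> real \<times> real \<Rightarrow> real \<times> real) \<Rightarrow> bool" where
  "small_field N \<longleftrightarrow> continuous_on ({0..} \<times> UNIV) (\<lambda>(t, x). N t x) \<and>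
     (\<forall>t x y. norm (N t x - N t y) \<le> norm (x - y) / 16) \<and> (\<forall>t. N t 0 = 0)"

lemma small_fieldD: "small_field N \<Longrightarrow> norm (N t x - N t y) \<le> norm (x - y) / 16"
  unfolding small_field_def by blast

text \<open>Solutions for the Lyapunov-Perron method: the growth bound replaces the initial value of the
  second coordinate, which is expanding because time runs backwards.\<close>

definition lp_solution ::
  "(real \<Rightarrow> real \<times> real \<Rightarrow> real \<times> real) \<Rightarrow> real \<times> real \<Rightarrow> (real \<Rightarrow> real \<times> real) \<Rightarrow> bool" where
  "lp_solution N v x \<longleftrightarrow> fst (x 0) = fst v \<and> hyperbolic_system (\<lambda>t. N t (x t) + (0, snd v)) x \<and>
     (\<exists>B. dominated (1/4) B x)"

text \<open>Absorption of a term into the left-hand side: the least admissible constant is itself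
  admissible, and improving it shows that it is at most \<open>a\<close> plus half of
  itself.\<close>

lemma dominated_improve:
  assumes "dominated \<eta> B x" and imp: "\<And>C. dominated \<eta> C x \<Longrightarrow> dominated \<eta> (a + C / 2) x"
  shows "dominated \<eta> (2 * a) x"
proof -
  define S where "S = {C. dominated \<eta> C x}"
  have ne: "S \<noteq> {}" and bb: "bdd_below S"
    using assms(1) dominated_nonneg by (auto simp: S_def bdd_below_def)
  have "dominated \<eta> (Inf S) x"
    unfolding dominated_def
  proof (intro allI impI)
    fix t :: real assume "0 \<le> t"
    then have "norm (x t) / exp (\<eta> * t) \<le> Inf S"
      by (intro cInf_greatest[OF ne]) (auto simp: S_def dominated_def field_simps)
    then show "norm (x t) \<le> Inf S * exp (\<eta> * t)" by (simp add: field_simps)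
  qed
  then have "a + Inf S / 2 \<in> S" using imp by (simp add: S_def)
  then have "Inf S \<le> a + Inf S / 2" using bb by (rule cInf_lower)
  then show ?thesis
    using dominated_mono[OF \<open>dominated \<eta> (Inf S) x\<close>, of "2 * a" \<eta>] by auto
qed

text \<open>Here the forcing may depend on the solution; its share \<open>norm (x t) / 16\<close>
  costs at most half of the current constant and is absorbed. The factor 6 rounds up both 16/3 and
  4.\<close>

lemma hyperbolic_system_perturbed_estimate:
  assumes eta: "\<eta> = 1/4 \<or> \<eta> = 1/2" and x: "hyperbolic_system g x" "dominated \<eta> B x"
    and g: "\<And>t. 0 \<le> t \<Longrightarrow> norm (g t) \<le> norm (x t) / 16 + A * exp (\<eta> * t)"
    and A: "0 \<le> A"
  shows "dominated \<eta> (2 * (\<bar>fst (x 0)\<bar> + 6 * A)) x"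
proof (rule dominated_improve[OF x(2)])
  fix C assume C: "dominated \<eta> C x"
  have "dominated \<eta> (C / 16 + A) g"
    unfolding dominated_def
  proof (intro allI impI)
    fix t :: real assume t: "0 \<le> t"
    have "norm (x t) \<le> C * exp (\<eta> * t)" using C t by (auto simp: dominated_def)
    with g[OF t] show "norm (g t) \<le> (C / 16 + A) * exp (\<eta> * t)" by (simp add: algebra_simps)
  qed
  then have "dominated \<eta> (\<bar>fst (x 0)\<bar> + (C / 16 + A) * (1 / \<eta> + 1 / (1 - \<eta>))) x"
    using eta C by (intro hyperbolic_system_estimate[OF _ _ x(1)]) auto
  moreover have "(C / 16 + A) * (1 / \<eta> + 1 / (1 - \<eta>)) \<le> 6 * A + C / 2"
  proof -
    define k where "k = 1 / \<eta> + 1 / (1 - \<eta>)"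
    have "k = 16/3 \<or> k = 4"
      using eta unfolding k_def by (elim disjE; hypsubst; simp)
    then show ?thesis
      using A dominated_nonneg[OF C] unfolding k_def[symmetric]
      by (elim disjE; hypsubst; simp)
  qed
  ultimately show "dominated \<eta> (\<bar>fst (x 0)\<bar> + 6 * A + C / 2) x"
    by (auto elim: dominated_mono)
qed

text \<open>The constant is 2 * (1 + 6): the data enter once through the initial first coordinate
  and once, with weight 6, through the constant forcing. Equal data give uniqueness.\<close>

lemma lp_solution_lipschitz:
  assumes N: "small_field N" and x: "lp_solution N v x" and y: "lp_solution N w y"
  shows "dominated (1/4) (14 * norm (v - w)) (\<lambda>t. x t - y t)"
proof -
  obtain B B' where B: "dominated (1/4) B x" "dominated (1/4) B' y"
    using x y by (auto simp: lp_solution_def)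
  have "hyperbolic_system (\<lambda>t. N t (x t) + (0, snd v) - (N t (y t) + (0, snd w))) (\<lambda>t. x t - y t)"
    using x y by (intro hyperbolic_system_diff) (auto simp: lp_solution_def)
  then have *: "dominated (1/4) (2 * (\<bar>fst (x 0 - y 0)\<bar> + 6 * norm (v - w))) (\<lambda>t. x t - y t)"
  proof (rule hyperbolic_system_perturbed_estimate[rotated])
    show "dominated (1/4) (B + B') (\<lambda>t. x t - y t)" using B by (rule dominated_diff)
    fix t :: real assume t: "0 \<le> t"
    have "norm (N t (x t) + (0, snd v) - (N t (y t) + (0, snd w)))
      = norm ((N t (x t) - N t (y t)) + (0, snd (v - w)))"
      by (rule arg_cong[where f = norm]) (simp add: prod_eq_iff)
    also have "\<dots> \<le> norm (x t - y t) / 16 + norm (v - w)"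
    proof (rule norm_triangle_le, rule add_mono)
      show "norm (N t (x t) - N t (y t)) \<le> norm (x t - y t) / 16"
        by (rule small_fieldD[OF N])
      show "norm ((0::real), snd (v - w)) \<le> norm (v - w)"
        using abs_snd_le[of "v - w"] by simp
    qed
    also have "norm (v - w) \<le> norm (v - w) * exp (1/4 * t)"
      using t by (simp add: mult_le_cancel_left1)
    finally show "norm (N t (x t) + (0, snd v) - (N t (y t) + (0, snd w)))
       \<le> norm (x t - y t) / 16 + norm (v - w) * exp (1/4 * t)" by simp
  qed auto
  have "fst (x 0 - y 0) = fst (v - w)" using x y by (simp add: lp_solution_def)
  then have "\<bar>fst (x 0 - y 0)\<bar> \<le> norm (v - w)"
    using abs_fst_le[of "v - w"] by simp
  then show ?thesis using * by (auto elim: dominated_mono)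
qed

lemma lp_solution_unique:
  assumes "small_field N" "lp_solution N v x" "lp_solution N v y" "0 \<le> t"
  shows "x t = y t"
  using lp_solution_lipschitz[OF assms(1-3)] assms(4) by (auto simp: dominated_def)

text \<open>Banach fixed point in the space of functions with finite weighted norm. The element
  \<open>z\<close> of that space stands for the curve \<open>exp (t/4) *\<^sub>R z t\<close>, so
  that the supremum norm of \<open>z\<close> is the weighted norm of the curve.\<close>

lemma lp_solution_exists:
  assumes N: "small_field N"
  obtains x where "lp_solution N v x"
proof -
  define g where "g = (\<lambda>z t. N t (exp (t/4) *\<^sub>R apply_bcontfun z t) + (0, snd v))"
  have contN: "continuous_on {0..} (\<lambda>t. N t (y t))" if "continuous_on {0..} y" for y
  proof -
    have "continuous_on {0..} (\<lambda>t. case (t, y t) of (t, x) \<Rightarrow> N t x)"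
      by (rule continuous_on_compose2[of "{0..} \<times> UNIV"])
         (use N that in \<open>auto simp: small_field_def intro!: continuous_intros\<close>)
    then show ?thesis by simp
  qed
  have contg: "continuous_on {0..} (g z)" for z
    unfolding g_def by (intro continuous_intros contN) auto
  have domg: "dominated (1/4) (norm z / 16 + norm v) (g z)" for z
    unfolding dominated_def
  proof (intro allI impI)
    fix t :: real assume t: "0 \<le> t"
    have "norm (N t (exp (t/4) *\<^sub>R z t)) \<le> norm (exp (t/4) *\<^sub>R z t) / 16"
      using N unfolding small_field_def by (metis diff_zero)
    also have "\<dots> \<le> norm z / 16 * exp (t/4)"
      using norm_bounded[of z t] by simp
    finally have "norm (N t (exp (t/4) *\<^sub>R z t)) \<le> norm z / 16 * exp (t/4)" .
    moreover have "norm ((0::real), snd v) \<le> norm v"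
      using abs_snd_le[of v] by simp
    moreover have "norm v \<le> norm v * exp (t/4)"
      using t by (simp add: mult_le_cancel_left1)
    ultimately show "norm (g z t) \<le> (norm z / 16 + norm v) * exp (1/4 * t)"
      unfolding g_def by (intro norm_triangle_le) (simp add: algebra_simps)
  qed
  have "\<forall>z. \<exists>x. hyperbolic_system (g z) x \<and> fst (x 0) = fst v \<and> (\<exists>B. dominated (1/4) B x)"
  proof
    fix z
    show "\<exists>x. hyperbolic_system (g z) x \<and> fst (x 0) = fst v \<and> (\<exists>B. dominated (1/4) B x)"
      by (rule hyperbolic_system_exists[OF _ _ contg[of z] domg[of z], of "fst v"]) auto
  qed
  then obtain S where S: "\<And>z. hyperbolic_system (g z) (S z)" "\<And>z. fst (S z 0) = fst v"
      "\<And>z. \<exists>B. dominated (1/4) B (S z)"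
    by metis
  \<comment> \<open>Bounded continuous functions live on the whole line; replacing \<open>t\<close>
    by \<open>max 0 t\<close> freezes them at their value at 0 for negative times.\<close>
  define T where "T = (\<lambda>z. Bcontfun (\<lambda>t. exp (- max 0 t / 4) *\<^sub>R S z (max 0 t)))"
  have T: "apply_bcontfun (T z) = (\<lambda>t. exp (- max 0 t / 4) *\<^sub>R S z (max 0 t))" for z
    unfolding T_def
  proof (rule Bcontfun_inverse)
    obtain B where B: "dominated (1/4) B (S z)" using S(3) by blast
    show "(\<lambda>t. exp (- max 0 t / 4) *\<^sub>R S z (max 0 t)) \<in> bcontfun"
    proof (rule bcontfun_normI)
      show "continuous_on UNIV (\<lambda>t. exp (- max 0 t / 4) *\<^sub>R S z (max 0 t))"
        by (intro continuous_intros continuous_on_compose2[OF hyperbolic_system_continuous_on[OF S(1)]]) auto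
      fix t :: real
      have "norm (S z (max 0 t)) \<le> B * exp (1/4 * max 0 t)"
        using B by (auto simp: dominated_def)
      then show "norm (exp (- max 0 t / 4) *\<^sub>R S z (max 0 t)) \<le> B"
        by (simp add: exp_minus field_simps)
    qed
  qed
  \<comment> \<open>The estimate gives the factor 16/3 / 16 = 1/3, rounded up to 1/2.\<close>
  have "dist (T z) (T z') \<le> 1/2 * dist z z'" for z z'
  proof (rule dist_bound)
    fix t :: real
    define s where "s = max 0 t"
    have s: "0 \<le> s" by (simp add: s_def)
    have "dominated (1/4) (dist z z' / 16) (\<lambda>t. g z t - g z' t)"
      unfolding dominated_def
    proof (intro allI impI)
      fix t :: real
      have "norm (g z t - g z' t) \<le> norm (exp (t/4) *\<^sub>R z t - exp (t/4) *\<^sub>R z' t) / 16"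
        using small_fieldD[OF N] by (simp add: g_def)
      also have "\<dots> = exp (t/4) * dist (z t) (z' t) / 16"
        by (simp add: dist_norm flip: scaleR_diff_right)
      also have "\<dots> \<le> exp (t/4) * dist z z' / 16"
        using dist_bounded[of z t z'] by simp
      finally show "norm (g z t - g z' t) \<le> dist z z' / 16 * exp (1/4 * t)" by (simp add: mult.commute)
    qed
    moreover obtain B B' where "dominated (1/4) B (S z)" "dominated (1/4) B' (S z')"
      using S(3) by blast
    ultimately have "dominated (1/4) (\<bar>fst (S z 0 - S z' 0)\<bar> + dist z z' / 16 * (1 / (1/4) + 1 / (1 - 1/4)))
        (\<lambda>t. S z t - S z' t)"
      using hyperbolic_system_diff[OF S(1) S(1)]
      by (intro hyperbolic_system_estimate[where B = "B + B'"] dominated_diff) auto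
    then have "dominated (1/4) (dist z z' / 2) (\<lambda>t. S z t - S z' t)"
      by (rule dominated_mono) (simp_all add: S(2))
    then have "norm (S z s - S z' s) \<le> dist z z' / 2 * exp (s/4)"
      using s by (simp add: dominated_def)
    then have "exp (- s / 4) * norm (S z s - S z' s) \<le> exp (- s / 4) * (dist z z' / 2 * exp (s/4))"
      by (intro mult_left_mono) auto
    also have "\<dots> = 1/2 * dist z z'" by (simp add: exp_minus)
    also have "exp (- s / 4) * norm (S z s - S z' s) = dist (T z t) (T z' t)"
      by (simp add: T s_def dist_norm flip: scaleR_diff_right)
    finally show "dist (T z t) (T z' t) \<le> 1/2 * dist z z'" .
  qed
  then obtain z where z: "T z = z"
    using banach_fix_type[of "1/2" T] by auto
  define x where "x = (\<lambda>t. exp (t/4) *\<^sub>R z t)"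
  have x: "x t = S z t" if "0 \<le> t" for t
  proof -
    have "S z t /\<^sub>R exp (t/4) = apply_bcontfun z t"
      using that arg_cong[OF z, of "\<lambda>z. apply_bcontfun z t"] by (simp add: T exp_minus)
    then show ?thesis by (simp add: x_def flip: \<open>_ = apply_bcontfun z t\<close>)
  qed
  have "hyperbolic_system (\<lambda>t. N t (x t) + (0, snd v)) x"
    unfolding hyperbolic_system_def
  proof (intro allI impI)
    fix t :: real assume t: "0 \<le> t"
    have "(S z has_vector_derivative (fst (g z t), snd (S z t) - snd (g z t))) (at t within {0..})"
      using S(1)[of z] t by (auto simp: hyperbolic_system_def)
    then have "(x has_vector_derivative (fst (g z t), snd (S z t) - snd (g z t))) (at t within {0..})"
      by (rule has_vector_derivative_transform[rotated 2]) (use t x in auto)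
    then show "(x has_vector_derivative (fst (N t (x t) + (0, snd v)), snd (x t) - snd (N t (x t) + (0, snd v))))
        (at t within {0..})"
      using x[OF t] by (simp add: g_def x_def)
  qed
  moreover have "\<exists>B. dominated (1/4) B x"
    using S(3)[of z] x by (simp add: dominated_def)
  moreover have "fst (x 0) = fst v" using x[of 0] S(2) by simp
  ultimately show ?thesis using that by (auto simp: lp_solution_def)
qed

section \<open>The cut-off field\<close>

text \<open>Half the derivative of \<open>huber\<close>. The level 1/64 makes \<open>huber\<close>
  Lipschitz with constant 1/32, hence each coordinate of \<open>cutoff_field\<close> with constant
  1/32, which adds up to the 1/16 required of a small field.\<close>

definition clamp :: "real \<Rightarrow> real" where
  "clamp x = max (- (1/64)) (min (1/64) x)"

text \<open>A globally Lipschitz substitute for \<open>x\<^sup>2\<close>, equal to it near 0, with the quadratic remainder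
  estimate that makes the orbits differentiable in their parameters.\<close>

definition huber :: "real \<Rightarrow> real" where
  "huber x = 2 * clamp x * x - (clamp x)\<^sup>2"

lemma huber_eq: "\<bar>x\<bar> \<le> 1/64 \<Longrightarrow> huber x = x\<^sup>2"
proof -
  assume "\<bar>x\<bar> \<le> 1/64"
  then have "clamp x = x" by (auto simp: clamp_def)
  then show ?thesis by (simp add: huber_def power2_eq_square)
qed

lemma clamp_bound: "\<bar>clamp x\<bar> \<le> 1/64"
  by (auto simp: clamp_def)

lemma clamp_cases:
  "x \<le> -1/64 \<and> clamp x = -1/64 \<or> -1/64 \<le> x \<and> x \<le> 1/64 \<and> clamp x = x \<or>
   1/64 \<le> x \<and> clamp x = 1/64"
  by (cases "x \<le> -1/64"; cases "x \<le> 1/64") (auto simp: clamp_def)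

text \<open>Since \<open>huber y = y\<^sup>2 - (y - clamp y)\<^sup>2\<close>, the first-order
  remainder is \<open>(y - clamp x)\<^sup>2 - (y - clamp y)\<^sup>2\<close>. It is nonnegative
  because \<open>clamp y\<close> is the point of the interval nearest to \<open>y\<close>. For the
  upper bound, either the two clamped values agree or \<open>clamp x\<close> is no farther from
  \<open>y\<close> than \<open>x\<close> is.\<close>

lemma huber_convex: "2 * clamp x * (y - x) \<le> huber y - huber x"
  and huber_remainder_le: "huber y - huber x - 2 * clamp x * (y - x) \<le> (y - x)\<^sup>2"
proof -
  have eq: "huber y - huber x - 2 * clamp x * (y - x) = (y - clamp x)\<^sup>2 - (y - clamp y)\<^sup>2"
    by (simp add: huber_def power2_eq_square algebra_simps)
  have "\<bar>y - clamp y\<bar> \<le> \<bar>y - clamp x\<bar>"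
    using clamp_cases[of x] clamp_cases[of y] by argo
  then have "(y - clamp y)\<^sup>2 \<le> (y - clamp x)\<^sup>2" by (simp only: abs_le_square_iff)
  with eq show "2 * clamp x * (y - x) \<le> huber y - huber x" by simp
  have "clamp x = clamp y \<or> \<bar>y - clamp x\<bar> \<le> \<bar>y - x\<bar>"
    using clamp_cases[of x] clamp_cases[of y] by argo
  then have "(y - clamp x)\<^sup>2 - (y - clamp y)\<^sup>2 \<le> (y - x)\<^sup>2"
  proof
    assume "\<bar>y - clamp x\<bar> \<le> \<bar>y - x\<bar>"
    then have "(y - clamp x)\<^sup>2 \<le> (y - x)\<^sup>2" by (simp only: abs_le_square_iff)
    then show ?thesis using zero_le_power2[of "y - clamp y"] by linarith
  qed simp
  with eq show "huber y - huber x - 2 * clamp x * (y - x) \<le> (y - x)\<^sup>2" by simp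
qed

lemma abs_clamp_mult_le: "\<bar>clamp a * b\<bar> \<le> \<bar>b\<bar> / 64"
  using mult_right_mono[OF clamp_bound abs_ge_zero, of a b] by (simp add: abs_mult)

lemma huber_remainder:
  "\<bar>huber y - huber x - 2 * clamp x * (y - x)\<bar> \<le> (y - x)\<^sup>2"
  using huber_convex[of x y] huber_remainder_le[of y x] by simp

lemma huber_lipschitz: "\<bar>huber x - huber y\<bar> \<le> \<bar>x - y\<bar> / 32"
proof -
  have *: "\<bar>a - b\<bar> \<le> d / 32" if "2 * p \<le> b - a" "2 * q \<le> a - b" "\<bar>p\<bar> \<le> d / 64" "\<bar>q\<bar> \<le> d / 64"
    for a b p q d :: real
    using that by linarith
  show ?thesis
    by (rule *[where p = "clamp x * (y - x)" and q = "clamp y * (x - y)"])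
       (use huber_convex abs_clamp_mult_le[of x "y - x"] abs_clamp_mult_le[of y "x - y"]
         in \<open>simp_all add: mult.assoc[symmetric] abs_minus_commute\<close>)
qed

text \<open>Polarisation turns the product of the two coordinates into a difference of squares.\<close>

definition cutoff_field :: "real \<times> real \<Rightarrow> real \<times> real" where
  "cutoff_field p = ((huber (fst p + snd p) - huber (fst p - snd p)) / 4, huber (fst p))"

definition cutoff_field_deriv :: "real \<times> real \<Rightarrow> real \<times> real \<Rightarrow> real \<times> real" where
  "cutoff_field_deriv p h =
     ((clamp (fst p + snd p) * (fst h + snd h) - clamp (fst p - snd p) * (fst h - snd h)) / 2,
      2 * clamp (fst p) * fst h)"

lemma norm_pair_le: "norm p \<le> \<bar>fst p\<bar> + \<bar>snd p\<bar>" for p :: "real \<times> real"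
  using norm_Pair_le[of "fst p" "snd p"] by simp

lemma cutoff_field_lipschitz: "norm (cutoff_field x - cutoff_field y) \<le> norm (x - y) / 16"
proof -
  have "norm (cutoff_field x - cutoff_field y) \<le>
    \<bar>(huber (fst x + snd x) - huber (fst y + snd y)) / 4 - (huber (fst x - snd x) - huber (fst y - snd y)) / 4\<bar>
    + \<bar>huber (fst x) - huber (fst y)\<bar>"
    by (rule order.trans[OF norm_pair_le]) (simp add: cutoff_field_def field_simps)
  moreover have "\<bar>fst x - fst y\<bar> \<le> norm (x - y)" "\<bar>snd x - snd y\<bar> \<le> norm (x - y)"
    using abs_fst_le[of "x - y"] abs_snd_le[of "x - y"] by auto
  ultimately show ?thesis
    using huber_lipschitz[of "fst x + snd x" "fst y + snd y"]
      huber_lipschitz[of "fst x - snd x" "fst y - snd y"] huber_lipschitz[of "fst x" "fst y"]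
    by argo
qed

text \<open>The remainders of the two polarised squares are bounded by
  \<open>(a + b)\<^sup>2\<close> and \<open>(a - b)\<^sup>2\<close>, whose sum is twice the squared
  norm. The first coordinate thus costs 1/2 and the second at most 1; the sum is rounded up to
  2.\<close>

lemma cutoff_field_remainder:
  "norm (cutoff_field y - cutoff_field x - cutoff_field_deriv x (y - x)) \<le> 2 * (norm (y - x))\<^sup>2"
proof -
  define r where "r = (\<lambda>x y. huber y - huber x - 2 * clamp x * (y - x))"
  have r: "\<bar>r x y\<bar> \<le> (y - x)\<^sup>2" for x y unfolding r_def by (rule huber_remainder)
  define a where "a = fst y - fst x"
  define b where "b = snd y - snd x"
  let ?e = "cutoff_field y - cutoff_field x - cutoff_field_deriv x (y - x)"
  have 1: "fst ?e = r (fst x + snd x) (fst y + snd y) / 4 - r (fst x - snd x) (fst y - snd y) / 4"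
    by (simp add: cutoff_field_def cutoff_field_deriv_def r_def field_simps)
  have 2: "snd ?e = r (fst x) (fst y)"
    by (simp add: cutoff_field_def cutoff_field_deriv_def r_def)
  have 3: "\<bar>r (fst x + snd x) (fst y + snd y)\<bar> \<le> (a + b)\<^sup>2"
    using r[of "fst x + snd x" "fst y + snd y"] by (simp add: a_def b_def algebra_simps)
  have 4: "\<bar>r (fst x - snd x) (fst y - snd y)\<bar> \<le> (a - b)\<^sup>2"
    using r[of "fst x - snd x" "fst y - snd y"] by (simp add: a_def b_def algebra_simps)
  have 5: "\<bar>r (fst x) (fst y)\<bar> \<le> a\<^sup>2"
    using r[of "fst x" "fst y"] by (simp add: a_def)
  have 6: "(a + b)\<^sup>2 + (a - b)\<^sup>2 = 2 * (a\<^sup>2 + b\<^sup>2)"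
    by (simp add: power2_eq_square algebra_simps)
  have 7: "(norm (y - x))\<^sup>2 = a\<^sup>2 + b\<^sup>2"
    by (simp add: norm_prod_def a_def b_def)
  have *: "n \<le> 2 * N"
    if "n \<le> \<bar>e1\<bar> + \<bar>e2\<bar>" "e1 = r1 / 4 - r2 / 4" "e2 = r3" "\<bar>r1\<bar> \<le> s1" "\<bar>r2\<bar> \<le> s2" "\<bar>r3\<bar> \<le> a2"
      "s1 + s2 = 2 * (a2 + b2)" "N = a2 + b2" "0 \<le> b2" for n e1 e2 r1 r2 r3 s1 s2 a2 b2 N :: real
  proof -
    have "\<bar>e1\<bar> \<le> (s1 + s2) / 4" using that(2,4,5) by (intro abs_leI) (auto simp: abs_le_iff)
    moreover have "\<bar>e2\<bar> \<le> a2" using that(3,6) by simp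
    ultimately have "n \<le> (s1 + s2) / 4 + a2"
      by (intro order.trans[OF that(1)] add_mono)
    moreover have "0 \<le> a2" using that(6) abs_ge_zero order.trans by blast
    ultimately show ?thesis using that(7-9) by argo
  qed
  show ?thesis
    using norm_pair_le[of ?e] 1 2 3 4 5 6 7 zero_le_power2[of b] by (rule *)
qed

lemma cutoff_field_deriv_bound: "norm (cutoff_field_deriv p h) \<le> norm h / 16"
proof -
  let ?e = "cutoff_field_deriv p h"
  have 1: "fst ?e = (clamp (fst p + snd p) * (fst h + snd h) - clamp (fst p - snd p) * (fst h - snd h)) / 2"
    and 2: "snd ?e = 2 * (clamp (fst p) * fst h)"
    by (simp_all add: cutoff_field_deriv_def)
  have *: "n \<le> m / 16"
    if "e1 = (r1 - r2) / 2" "e2 = 2 * r3" "\<bar>r1\<bar> \<le> \<bar>a + b\<bar> / 64" "\<bar>r2\<bar> \<le> \<bar>a - b\<bar> / 64" "\<bar>r3\<bar> \<le> \<bar>a\<bar> / 64"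
      "n \<le> \<bar>e1\<bar> + \<bar>e2\<bar>" "\<bar>a\<bar> \<le> m" "\<bar>b\<bar> \<le> m" for n m e1 e2 r1 r2 r3 a b :: real
  proof -
    have "\<bar>a + b\<bar> \<le> 2 * m" "\<bar>a - b\<bar> \<le> 2 * m"
      using that(7,8) by (auto simp: abs_le_iff)
    then have "\<bar>r1\<bar> \<le> m / 32" "\<bar>r2\<bar> \<le> m / 32" "\<bar>r3\<bar> \<le> m / 64"
      using that(3-5,7) by auto
    then have "\<bar>e1\<bar> \<le> m / 32" "\<bar>e2\<bar> \<le> m / 32"
      using that(1,2) by (auto simp: abs_le_iff)
    with that(6) show ?thesis by simp
  qed
  show ?thesis
    by (rule *[OF 1 2, of "fst h" "snd h"])
       (rule abs_clamp_mult_le norm_pair_le abs_fst_le abs_snd_le)+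
qed

lemma cutoff_field_deriv_diff:
  "cutoff_field_deriv p x - cutoff_field_deriv p y = cutoff_field_deriv p (x - y)"
  by (simp add: cutoff_field_deriv_def field_simps)

lemma cutoff_field_deriv_add:
  "cutoff_field_deriv p x + cutoff_field_deriv p y = cutoff_field_deriv p (x + y)"
  by (simp add: cutoff_field_deriv_def field_simps)

lemma cutoff_field_deriv_scaleR:
  "c *\<^sub>R cutoff_field_deriv p x = cutoff_field_deriv p (c *\<^sub>R x)"
  by (simp add: cutoff_field_deriv_def field_simps)

lemma cutoff_field_eq:
  assumes "\<bar>fst p + snd p\<bar> \<le> 1/64" "\<bar>fst p - snd p\<bar> \<le> 1/64" "\<bar>fst p\<bar> \<le> 1/64"
  shows "cutoff_field p = (fst p * snd p, (fst p)\<^sup>2)"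
  using assms by (simp add: cutoff_field_def huber_eq power2_eq_square algebra_simps)

lemma cutoff_zero: "cutoff_field 0 = 0" "cutoff_field_deriv 0 h = 0" "cutoff_field_deriv p 0 = 0"
  by (simp_all add: cutoff_field_def cutoff_field_deriv_def huber_def clamp_def zero_prod_def)

lemma continuous_on_clamp [continuous_intros]:
  "continuous_on S f \<Longrightarrow> continuous_on S (\<lambda>x. clamp (f x))"
  unfolding clamp_def by (intro continuous_intros)

lemma continuous_on_huber [continuous_intros]:
  "continuous_on S f \<Longrightarrow> continuous_on S (\<lambda>x. huber (f x))"
  unfolding huber_def by (intro continuous_intros)

lemma small_cutoff_field: "small_field (\<lambda>_. cutoff_field)"
proof -
  have "continuous_on ({0..} \<times> UNIV) (\<lambda>(t::real, x). cutoff_field x)"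
    unfolding cutoff_field_def case_prod_beta by (intro continuous_intros) auto
  then show ?thesis
    unfolding small_field_def using cutoff_field_lipschitz cutoff_zero by auto
qed

lemma small_cutoff_field_deriv:
  assumes "continuous_on {0..} x"
  shows "small_field (\<lambda>t. cutoff_field_deriv (x t))"
proof -
  have "continuous_on ({0..} \<times> UNIV) (\<lambda>q. x (fst q))"
    by (rule continuous_on_compose2[OF assms]) (auto intro: continuous_intros)
  then have "continuous_on ({0..} \<times> UNIV) (\<lambda>(t, h). cutoff_field_deriv (x t) h)"
    unfolding cutoff_field_deriv_def case_prod_beta by (intro continuous_intros) auto
  then show ?thesis
    unfolding small_field_def cutoff_field_deriv_diff
    using cutoff_field_deriv_bound cutoff_zero by auto
qed

text \<open>A remainder bound uniform in the base point also controls the variation of the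
  derivative. Expanding \<open>f (q + k)\<close> at \<open>p\<close> and at \<open>q\<close>, and
  \<open>f q\<close> at \<open>p\<close>, leaves \<open>D q k - D p k\<close> as a combination of
  three remainders; they add up to 4 + 1 + 1 = 6 units of \<open>C * s\<^sup>2\<close> when
  \<open>k\<close> has the length \<open>s\<close> of \<open>q - p\<close>.\<close>

lemma C1_of_quadratic_remainder:
  fixes f :: "'a::euclidean_space \<Rightarrow> 'b::real_normed_vector"
  assumes lin: "\<And>p. linear (D p)"
    and rem: "\<And>p q. norm (f q - f p - D p (q - p)) \<le> C * (norm (q - p))\<^sup>2"
  obtains D' :: "'a \<Rightarrow> 'a \<Rightarrow>\<^sub>L 'b" where "\<And>p. blinfun_apply (D' p) = D p"
    "\<And>p. (f has_derivative blinfun_apply (D' p)) (at p)" "continuous_on UNIV D'"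
proof -
  have C: "0 \<le> C"
  proof -
    obtain b :: 'a where "b \<in> Basis" by fastforce
    moreover have "0 \<le> C * (norm (b - 0))\<^sup>2"
      using rem[of b 0] norm_ge_zero order.trans by blast
    ultimately show ?thesis by simp
  qed
  have norm_diff3: "norm (x - y - z) \<le> a + b + c"
    if "norm x \<le> a" "norm y \<le> b" "norm z \<le> c" for x y z :: 'b and a b c
    using that norm_triangle_ineq4[of "x - y" z] norm_triangle_ineq4[of x y] by linarith
  have bl: "bounded_linear (D p)" for p using lin linear_conv_bounded_linear by blast
  define D' where "D' = (\<lambda>p. Blinfun (D p))"
  have D': "blinfun_apply (D' p) = D p" for p
    by (simp add: D'_def bounded_linear_Blinfun_apply[OF bl])
  have "(f has_derivative D p) (at p)" for p
    unfolding has_derivative_at_within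
  proof (intro conjI bl)
    have "((\<lambda>q. C * norm (q - p)) \<longlongrightarrow> C * norm (p - p)) (at p)"
      by (intro tendsto_intros)
    then have "((\<lambda>q. C * norm (q - p)) \<longlongrightarrow> 0) (at p)" by simp
    then show "((\<lambda>q. (f q - f p - D p (q - p)) /\<^sub>R norm (q - p)) \<longlongrightarrow> 0) (at p)"
    proof (rule Lim_null_comparison[rotated])
      show "\<forall>\<^sub>F q in at p. norm ((f q - f p - D p (q - p)) /\<^sub>R norm (q - p)) \<le> C * norm (q - p)"
        unfolding eventually_at_filter
        using rem[of _ p] by (intro always_eventually allI impI) (auto simp: divide_simps power2_eq_square mult.assoc[symmetric])
    qed
  qed
  moreover have "continuous_on UNIV D'"
  proof -
    have lip: "dist (D' q) (D' p) \<le> 6 * C * dist q p" for p q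
      unfolding dist_norm
    proof (cases "q = p")
      case False
      show "norm (D' q - D' p) \<le> 6 * C * norm (q - p)"
      proof (rule norm_blinfun_bound)
        fix h :: 'a
        define s where "s = norm (q - p)"
        have s: "0 < s" using False by (simp add: s_def)
        show "norm (blinfun_apply (D' q - D' p) h) \<le> 6 * C * norm (q - p) * norm h"
        proof (cases "h = 0")
          case False
          \<comment> \<open>Rescaling the direction to length \<open>s\<close> balances the three
            remainders; linearity undoes the rescaling and turns \<open>s\<^sup>2\<close> into
            \<open>s * norm h\<close>.\<close>
          define k where "k = (s / norm h) *\<^sub>R h"
          have k: "norm k = s" using False s by (simp add: k_def)
          have h: "h = (norm h / s) *\<^sub>R k" using False s by (simp add: k_def)
          have "norm (q + k - p) \<le> 2 * s"
            using norm_triangle_ineq[of "q - p" k] k by (simp add: s_def diff_add_eq)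
          then have "(norm (q + k - p))\<^sup>2 \<le> 4 * s\<^sup>2"
            using power_mono[of "norm (q + k - p)" "2 * s" 2] by simp
          then have 1: "norm (f (q + k) - f p - D p (q + k - p)) \<le> C * (4 * s\<^sup>2)"
            using rem[of "q + k" p] C mult_left_mono order.trans by blast
          have 2: "norm (f (q + k) - f q - D q k) \<le> C * s\<^sup>2" using rem[of "q + k" q] k by simp
          have 3: "norm (f q - f p - D p (q - p)) \<le> C * s\<^sup>2" using rem[of q p] by (simp add: s_def)
          have "D p (q + k - p) = D p (q - p) + D p k"
            using linear_add[OF lin, of p "q - p" k] by (simp add: diff_add_eq)
          then have eq: "D q k - D p k = (f (q + k) - f p - D p (q + k - p)) -
              (f (q + k) - f q - D q k) - (f q - f p - D p (q - p))" by simp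
          have "norm (D q k - D p k) \<le> C * (4 * s\<^sup>2) + C * s\<^sup>2 + C * s\<^sup>2"
            unfolding eq by (rule norm_diff3[OF 1 2 3])
          then have "norm (D q k - D p k) * (norm h / s) \<le> 6 * C * s\<^sup>2 * (norm h / s)"
            using s by (intro mult_right_mono) auto
          moreover have "blinfun_apply (D' q - D' p) h = (norm h / s) *\<^sub>R (D q k - D p k)"
            by (subst h) (simp add: blinfun.diff_left D' linear_scale[OF lin] scaleR_diff_right)
          ultimately show ?thesis
            using s by (simp add: s_def[symmetric] power2_eq_square mult.commute mult.left_commute)
        qed simp
      qed (use C in auto)
    qed simp
    then show ?thesis
      using C by (intro lipschitz_on_continuous_on[of "6 * C"] lipschitz_onI) auto
  qed
  ultimately show ?thesis using that[of D'] D' by simp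
qed

section \<open>The center manifold of the planar system\<close>

text \<open>Boundedness is meant relative to the weight \<open>exp (t/4)\<close>. The orbit is
  unique for nonnegative times only; at negative times the value is whatever the choice operator
  returns. The data \<open>p\<close> combine the initial first coordinate with the parameter
  \<mu>.\<close>

definition bounded_orbit :: "real \<times> real \<Rightarrow> real \<Rightarrow> real \<times> real" where
  "bounded_orbit p = (SOME x. lp_solution (\<lambda>_. cutoff_field) p x)"

definition orbit_derivative :: "real \<times> real \<Rightarrow> real \<times> real \<Rightarrow> real \<Rightarrow> real \<times> real" where
  "orbit_derivative p v = (SOME x. lp_solution (\<lambda>t. cutoff_field_deriv (bounded_orbit p t)) v x)"

definition center_height :: "real \<times> real \<Rightarrow> real" where
  "center_height p = snd (bounded_orbit p 0)"

lemma lp_bounded_orbit: "lp_solution (\<lambda>_. cutoff_field) p (bounded_orbit p)"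
  unfolding bounded_orbit_def using lp_solution_exists[OF small_cutoff_field] someI_ex by metis

lemma small_linearization: "small_field (\<lambda>t. cutoff_field_deriv (bounded_orbit p t))"
proof (rule small_cutoff_field_deriv)
  show "continuous_on {0..} (bounded_orbit p)"
    using lp_bounded_orbit[of p] hyperbolic_system_continuous_on unfolding lp_solution_def by blast
qed

lemma lp_orbit_derivative:
  "lp_solution (\<lambda>t. cutoff_field_deriv (bounded_orbit p t)) v (orbit_derivative p v)"
  unfolding orbit_derivative_def using lp_solution_exists[OF small_linearization] someI_ex by metis

text \<open>Superposition: sums and multiples of solutions of the linearised problem solve it for
  the corresponding data, and uniqueness identifies them with the chosen solutions.\<close>

lemma linear_orbit_derivative: "linear (\<lambda>v. snd (orbit_derivative p v 0))"
proof -
  let ?N = "\<lambda>t. cutoff_field_deriv (bounded_orbit p t)"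
  note l = lp_orbit_derivative[of p, unfolded lp_solution_def]
  have add: "lp_solution ?N (v + w) (\<lambda>t. orbit_derivative p v t + orbit_derivative p w t)" for v w
    unfolding lp_solution_def
  proof (intro conjI)
    have "hyperbolic_system (\<lambda>t. ?N t (orbit_derivative p v t) + (0, snd v) + (?N t (orbit_derivative p w t) + (0, snd w)))
       (\<lambda>t. orbit_derivative p v t + orbit_derivative p w t)"
      using l by (intro hyperbolic_system_add) auto
    moreover have "?N t (orbit_derivative p v t) + (0, snd v) + (?N t (orbit_derivative p w t) + (0, snd w))
      = ?N t (orbit_derivative p v t + orbit_derivative p w t) + (0, snd (v + w))" for t
      unfolding cutoff_field_deriv_add[symmetric] by (simp add: prod_eq_iff)
    ultimately show "hyperbolic_system (\<lambda>t. ?N t (orbit_derivative p v t + orbit_derivative p w t) + (0, snd (v + w)))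
       (\<lambda>t. orbit_derivative p v t + orbit_derivative p w t)" by simp
    show "\<exists>B. dominated (1/4) B (\<lambda>t. orbit_derivative p v t + orbit_derivative p w t)"
      using l dominated_add by blast
  qed (use l in simp)
  have scale: "lp_solution ?N (c *\<^sub>R v) (\<lambda>t. c *\<^sub>R orbit_derivative p v t)" for c v
    unfolding lp_solution_def
  proof (intro conjI)
    have "hyperbolic_system (\<lambda>t. c *\<^sub>R (?N t (orbit_derivative p v t) + (0, snd v))) (\<lambda>t. c *\<^sub>R orbit_derivative p v t)"
      using l by (intro hyperbolic_system_scaleR) auto
    moreover have "c *\<^sub>R (?N t (orbit_derivative p v t) + (0, snd v))
      = ?N t (c *\<^sub>R orbit_derivative p v t) + (0, snd (c *\<^sub>R v))" for t
      unfolding cutoff_field_deriv_scaleR[symmetric] by (simp add: prod_eq_iff algebra_simps)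
    ultimately show "hyperbolic_system (\<lambda>t. ?N t (c *\<^sub>R orbit_derivative p v t) + (0, snd (c *\<^sub>R v)))
       (\<lambda>t. c *\<^sub>R orbit_derivative p v t)" by simp
    obtain B where "dominated (1/4) B (orbit_derivative p v)" using l by blast
    then have "dominated (1/4) (\<bar>c\<bar> * B) (\<lambda>t. c *\<^sub>R orbit_derivative p v t)"
      unfolding dominated_def by (auto simp: mult.assoc intro!: mult_left_mono)
    then show "\<exists>B. dominated (1/4) B (\<lambda>t. c *\<^sub>R orbit_derivative p v t)" by blast
  qed (use l in simp)
  show ?thesis
  proof (rule linearI)
    show "snd (orbit_derivative p (v + w) 0) = snd (orbit_derivative p v 0) + snd (orbit_derivative p w 0)" for v w
      using lp_solution_unique[OF small_linearization lp_orbit_derivative add order_refl] by simp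
    show "snd (orbit_derivative p (c *\<^sub>R v) 0) = c *\<^sub>R snd (orbit_derivative p v 0)" for c v
      using lp_solution_unique[OF small_linearization lp_orbit_derivative scale order_refl] by simp
  qed
qed

text \<open>The remainder is estimated with the weight \<open>exp (t/2)\<close>, the square of the weight for the
  orbits themselves.\<close>

lemma center_height_remainder:
  "norm (center_height q - center_height p - snd (orbit_derivative p (q - p) 0)) \<le> 4704 * (norm (q - p))\<^sup>2"
proof -
  let ?N = "\<lambda>t. cutoff_field_deriv (bounded_orbit p t)"
  define X where "X = bounded_orbit q"
  define Y where "Y = bounded_orbit p"
  define Z where "Z = orbit_derivative p (q - p)"
  define R where "R = (\<lambda>t. X t - Y t - Z t)"
  define s where "s = norm (q - p)"
  have X: "lp_solution (\<lambda>_. cutoff_field) q X" and Y: "lp_solution (\<lambda>_. cutoff_field) p Y"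
    and Z: "lp_solution (\<lambda>t. cutoff_field_deriv (Y t)) (q - p) Z"
    unfolding X_def Y_def Z_def by (rule lp_bounded_orbit lp_orbit_derivative)+
  obtain A B C where dom: "dominated (1/4) A X" "dominated (1/4) B Y" "dominated (1/4) C Z"
    using X Y Z unfolding lp_solution_def by blast
  have XY: "norm (X t - Y t) \<le> 14 * s * exp (1/4 * t)" if "0 \<le> t" for t
    using lp_solution_lipschitz[OF small_cutoff_field X Y] that unfolding dominated_def s_def by blast
  \<comment> \<open>The forcing of the remainder \<open>R\<close>: a Taylor remainder at
    \<open>X - Y\<close>, which is quadratic, and the linearised field applied to \<open>R\<close>,
    which is small enough to be absorbed. The parameter terms cancel.\<close>
  define g where "g = (\<lambda>t. (cutoff_field (X t) - cutoff_field (Y t) - cutoff_field_deriv (Y t) (X t - Y t))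
      + cutoff_field_deriv (Y t) (R t))"
  have "hyperbolic_system (\<lambda>t. cutoff_field (X t) + (0, snd q) - (cutoff_field (Y t) + (0, snd p))
      - (cutoff_field_deriv (Y t) (Z t) + (0, snd (q - p)))) R"
    unfolding R_def using X Y Z by (intro hyperbolic_system_diff) (auto simp: lp_solution_def)
  moreover have "cutoff_field (X t) + (0, snd q) - (cutoff_field (Y t) + (0, snd p))
      - (cutoff_field_deriv (Y t) (Z t) + (0, snd (q - p))) = g t" for t
    unfolding g_def R_def cutoff_field_deriv_diff[symmetric] by (simp add: prod_eq_iff)
  ultimately have gR: "hyperbolic_system g R" by simp
  have "dominated (1/4) (A + B + C) R"
    unfolding R_def by (intro dominated_diff dom)
  then have domR: "dominated (1/2) (A + B + C) R"
    by (rule dominated_mono) auto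
  \<comment> \<open>Here 392 = 2 * 14 ^ 2 combines the remainder constant of the field with the
    Lipschitz constant of the orbits. As \<open>R\<close> starts with first coordinate 0, the final
    constant is 2 * 6 * 392 = 4704.\<close>
  have "dominated (1/2) (2 * (\<bar>fst (R 0)\<bar> + 6 * (392 * s\<^sup>2))) R"
  proof (rule hyperbolic_system_perturbed_estimate[OF _ gR domR])
    fix t :: real assume t: "0 \<le> t"
    have "(norm (X t - Y t))\<^sup>2 \<le> (14 * s * exp (1/4 * t))\<^sup>2"
      using XY[OF t] by (intro power_mono) auto
    also have "\<dots> = 196 * s\<^sup>2 * exp (1/2 * t)"
      by (simp add: power_mult_distrib exp_double[symmetric] flip: exp_of_nat_mult)
    finally have "norm (cutoff_field (X t) - cutoff_field (Y t) - cutoff_field_deriv (Y t) (X t - Y t))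
       \<le> 392 * s\<^sup>2 * exp (1/2 * t)"
      using cutoff_field_remainder[of "X t" "Y t"] by simp
    moreover have "norm (cutoff_field_deriv (Y t) (R t)) \<le> norm (R t) / 16"
      by (rule cutoff_field_deriv_bound)
    ultimately show "norm (g t) \<le> norm (R t) / 16 + 392 * s\<^sup>2 * exp (1/2 * t)"
      unfolding g_def by (intro norm_triangle_le) linarith
  qed auto
  moreover have "fst (R 0) = 0"
    using X Y Z by (simp add: R_def lp_solution_def)
  ultimately have "norm (R 0) \<le> 4704 * s\<^sup>2"
    unfolding dominated_def by force
  then have "\<bar>snd (R 0)\<bar> \<le> 4704 * s\<^sup>2"
    using abs_snd_le[of "R 0"] by linarith
  then show ?thesis
    by (simp add: R_def X_def Y_def Z_def s_def center_height_def)
qed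

text \<open>The problem is autonomous and the growth condition survives a time shift, at the cost of
  a factor \<open>exp (t/4)\<close> in the constant. By uniqueness the shifted orbit is the orbit
  selected over its own first coordinate.\<close>

lemma center_height_invariant:
  assumes "0 \<le> t"
  shows "center_height (fst (bounded_orbit p t), snd p) = snd (bounded_orbit p t)"
proof -
  define X where "X = bounded_orbit p"
  have X: "fst (X 0) = fst p" "hyperbolic_system (\<lambda>t. cutoff_field (X t) + (0, snd p)) X" "\<exists>B. dominated (1/4) B X"
    using lp_bounded_orbit[of p] unfolding X_def lp_solution_def by auto
  have "lp_solution (\<lambda>_. cutoff_field) (fst (X t), snd p) (\<lambda>s. X (s + t))"
    unfolding lp_solution_def
  proof (intro conjI)
    show "hyperbolic_system (\<lambda>s. cutoff_field (X (s + t)) + (0, snd (fst (X t), snd p))) (\<lambda>s. X (s + t))"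
      unfolding hyperbolic_system_def
    proof (intro allI impI)
      fix s :: real assume s: "0 \<le> s"
      let ?d = "(fst (cutoff_field (X (s + t)) + (0, snd p)), snd (X (s + t)) - snd (cutoff_field (X (s + t)) + (0, snd p)))"
      have "(X has_vector_derivative ?d) (at (s + t) within {0..})"
        using X(2) s assms by (auto simp: hyperbolic_system_def)
      then have "(X has_vector_derivative ?d) (at (s + t) within (\<lambda>s. s + t) ` {0..})"
        by (rule has_vector_derivative_within_subset) (use assms in auto)
      moreover have "((\<lambda>s. s + t) has_vector_derivative 1) (at s within {0..})"
        by (auto intro!: derivative_eq_intros)
      ultimately show "((\<lambda>s. X (s + t)) has_vector_derivative (fst (cutoff_field (X (s + t)) + (0, snd (fst (X t), snd p))),
            snd (X (s + t)) - snd (cutoff_field (X (s + t)) + (0, snd (fst (X t), snd p))))) (at s within {0..})"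
        using vector_diff_chain_within[of "\<lambda>s. s + t" 1 s "{0..}" X ?d] by (simp add: o_def)
    qed
    obtain B where B: "dominated (1/4) B X" using X(3) by blast
    have "dominated (1/4) (B * exp (t/4)) (\<lambda>s. X (s + t))"
      unfolding dominated_def
    proof (intro allI impI)
      fix s :: real assume "0 \<le> s"
      then have "norm (X (s + t)) \<le> B * exp (1/4 * (s + t))"
        using B assms by (auto simp: dominated_def)
      then show "norm (X (s + t)) \<le> B * exp (t/4) * exp (1/4 * s)"
        by (simp add: exp_add[symmetric] mult.assoc add.commute add_divide_distrib)
    qed
    then show "\<exists>B. dominated (1/4) B (\<lambda>s. X (s + t))" by blast
  qed simp
  from lp_solution_unique[OF small_cutoff_field lp_bounded_orbit this, of 0]
  show ?thesis by (simp add: center_height_def X_def)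
qed

text \<open>Along the zero orbit the linearised equation has neutral first coordinate and second
  coordinate \<open>y' = y - snd v\<close>; its slowly growing solution with data \<open>v\<close>
  is constant. Hence the derivative of \<open>center_height\<close> at the origin is
  \<open>snd\<close>.\<close>

lemma orbit_origin: "bounded_orbit 0 t = 0" "orbit_derivative 0 v t = v" if "0 \<le> t"
proof -
  have "lp_solution (\<lambda>_. cutoff_field) 0 (\<lambda>_. 0)"
    by (auto simp: lp_solution_def hyperbolic_system_def dominated_def cutoff_zero has_vector_derivative_const
        zero_prod_def[symmetric] intro!: exI[of _ 0])
  then have *: "bounded_orbit 0 t = 0" if "0 \<le> t" for t
    using lp_solution_unique[OF small_cutoff_field lp_bounded_orbit] that by blast
  then show "bounded_orbit 0 t = 0" using that by blast
  have "lp_solution (\<lambda>t. cutoff_field_deriv (bounded_orbit 0 t)) v (\<lambda>_. v)"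
    unfolding lp_solution_def
  proof (intro conjI)
    show "hyperbolic_system (\<lambda>t. cutoff_field_deriv (bounded_orbit 0 t) v + (0, snd v)) (\<lambda>_. v)"
      unfolding hyperbolic_system_def
      by (auto simp: * cutoff_zero has_vector_derivative_const zero_prod_def[symmetric])
    have "dominated (1/4) (norm v) (\<lambda>_. v)"
      by (auto simp: dominated_def mult_le_cancel_left1)
    then show "\<exists>B. dominated (1/4) B (\<lambda>_. v)" by blast
  qed simp
  then show "orbit_derivative 0 v t = v"
    using lp_solution_unique[OF small_linearization lp_orbit_derivative] that by blast
qed

text \<open>The equation is the invariance of the graph differentiated at time 0. The cut-off
  therefore has to be inactive only at the starting point of the orbit.\<close>

theorem center_manifold_function:
  obtains H :: "real \<times> real \<Rightarrow> real" and H' :: "real \<times> real \<Rightarrow> (real \<times> real) \<Rightarrow>\<^sub>L real" and \<epsilon> :: real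
  where "\<And>p. (H has_derivative blinfun_apply (H' p)) (at p)" "continuous_on UNIV H'"
    "H (0, 0) = 0" "\<And>v. blinfun_apply (H' (0, 0)) v = snd v" "0 < \<epsilon>"
    "\<And>d \<mu>. norm (d, \<mu>) < \<epsilon> \<Longrightarrow> H (d, \<mu>) = \<mu> + d\<^sup>2 + d * H (d, \<mu>) * blinfun_apply (H' (d, \<mu>)) (1, 0)"
proof -
  obtain H' where H': "\<And>p. blinfun_apply (H' p) = (\<lambda>v. snd (orbit_derivative p v 0))"
    "\<And>p. (center_height has_derivative blinfun_apply (H' p)) (at p)" "continuous_on UNIV H'"
    using C1_of_quadratic_remainder[OF linear_orbit_derivative center_height_remainder] by blast
  have H0: "center_height (0, 0) = 0"
    using orbit_origin(1)[of 0] by (simp add: center_height_def zero_prod_def[symmetric])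
  have "isCont center_height (0, 0)" using H'(2) has_derivative_continuous by blast
  then obtain r where r: "r > 0" "\<And>p. dist p (0, 0) < r \<Longrightarrow> dist (center_height p) (center_height (0, 0)) < 1/128"
    unfolding continuous_at_eps_delta by (metis zero_less_divide_1_iff zero_less_numeral)
  \<comment> \<open>With \<open>d\<close> and \<open>h\<close> both below 1/128, the arguments
    \<open>d + h\<close>, \<open>d - h\<close> and \<open>d\<close> of \<open>huber\<close> stay
    within 1/64, where it is the square.\<close>
  define \<epsilon> where "\<epsilon> = min r (1/128)"
  have "center_height (d, \<mu>) = \<mu> + d\<^sup>2 + d * center_height (d, \<mu>) * blinfun_apply (H' (d, \<mu>)) (1, 0)"
    if "norm (d, \<mu>) < \<epsilon>" for d \<mu>
  proof -
    define h where "h = center_height (d, \<mu>)"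
    define X where "X = bounded_orbit (d, \<mu>)"
    have X0: "X 0 = (d, h)"
      using lp_bounded_orbit[of "(d, \<mu>)"]
      by (simp add: h_def X_def center_height_def lp_solution_def prod_eq_iff)
    have "\<bar>h\<bar> < 1/128" using r(2)[of "(d, \<mu>)"] that H0 by (simp add: \<epsilon>_def h_def dist_norm)
    moreover have "\<bar>d\<bar> < 1/128" using abs_fst_le[of "(d, \<mu>)"] that by (simp add: \<epsilon>_def)
    ultimately have "\<bar>d + h\<bar> \<le> 1/64" "\<bar>d - h\<bar> \<le> 1/64" "\<bar>d\<bar> \<le> 1/64"
      by linarith+
    then have N: "cutoff_field (d, h) = (d * h, d\<^sup>2)"
      using cutoff_field_eq[of "(d, h)"] by simp
    have "(X has_vector_derivative (fst (cutoff_field (X 0) + (0, \<mu>)), snd (X 0) - snd (cutoff_field (X 0) + (0, \<mu>))))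
        (at 0 within {0..})"
      using lp_bounded_orbit[of "(d, \<mu>)"] unfolding lp_solution_def hyperbolic_system_def X_def by auto
    then have dX: "(X has_vector_derivative (d * h, h - d\<^sup>2 - \<mu>)) (at 0 within {0..})"
      by (simp add: X0 N diff_diff_eq)
    have d1: "((\<lambda>t. fst (X t)) has_vector_derivative d * h) (at 0 within {0..})"
      using bounded_linear.has_vector_derivative[OF bounded_linear_fst dX] by simp
    have d2: "((\<lambda>t. snd (X t)) has_vector_derivative h - d\<^sup>2 - \<mu>) (at 0 within {0..})"
      using bounded_linear.has_vector_derivative[OF bounded_linear_snd dX] by simp
    have "((\<lambda>t. (fst (X t), \<mu>)) has_vector_derivative (d * h, 0)) (at 0 within {0..})"
      by (intro has_vector_derivative_Pair d1 has_vector_derivative_const)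
    then have "((\<lambda>t. (fst (X t), \<mu>)) has_derivative (\<lambda>s. s *\<^sub>R (d * h, 0))) (at 0 within {0..})"
      by (simp add: has_vector_derivative_def)
    from diff_chain_within[OF this, of center_height "blinfun_apply (H' (d, \<mu>))"]
    have "((\<lambda>t. center_height (fst (X t), \<mu>)) has_vector_derivative blinfun_apply (H' (d, \<mu>)) (d * h, 0))
        (at 0 within {0..})"
      using H'(2)[of "(d, \<mu>)"] X0
      by (simp add: has_vector_derivative_def o_def has_derivative_at_withinI blinfun.scaleR_right
          del: scaleR_Pair)
    then have "((\<lambda>t. snd (X t)) has_vector_derivative blinfun_apply (H' (d, \<mu>)) (d * h, 0)) (at 0 within {0..})"
      by (rule has_vector_derivative_transform[rotated 2])
         (use center_height_invariant[of _ "(d, \<mu>)"] in \<open>auto simp: X_def\<close>)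
    \<comment> \<open>The second coordinate is differentiated in two ways: by the equation, and by
      the chain rule through \<open>center_height\<close>.\<close>
    then have "blinfun_apply (H' (d, \<mu>)) (d * h, 0) = h - d\<^sup>2 - \<mu>"
      using d2 by (intro vector_derivative_unique_within[where S = "{0..}" and x = 0])
        (auto simp: at_within_Ici_at_right)
    moreover have "blinfun_apply (H' (d, \<mu>)) (d * h, 0) = d * h * blinfun_apply (H' (d, \<mu>)) (1, 0)"
      using blinfun.scaleR_right[of "H' (d, \<mu>)" "d * h" "(1, 0)"] by simp
    ultimately show ?thesis by (simp add: h_def)
  qed
  moreover have "blinfun_apply (H' (0, 0)) v = snd v" for v
    using orbit_origin(2)[of 0 v] by (simp add: H'(1) zero_prod_def)
  ultimately show ?thesis
    using H0 H'(2,3) r(1) by (intro that[of center_height H' \<epsilon>]) (auto simp: \<epsilon>_def)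
qed

section \<open>The linearisation and its spectrum\<close>

lemma of_nat_eq_iff_mod_CHAR:
  "(of_nat a :: 'a::ring_1) = of_nat b \<longleftrightarrow> a mod CHAR('a) = b mod CHAR('a)"
proof -
  have *: "(of_nat a :: 'a) = of_nat b \<longleftrightarrow> a mod CHAR('a) = b mod CHAR('a)" if "b \<le> a" for a b
    using that of_nat_eq_0_iff_char_dvd[of "a - b", where 'a = 'a]
    by (simp add: of_nat_diff mod_eq_dvd_iff_nat)
  show ?thesis using *[of a b] *[of b a] by (metis nle_le)
qed

text \<open>The parity of an index is well defined only if the characteristic is even, whereas
  evenness is assumed of the number of indices.\<close>

lemma CHAR_eq_CARD:
  assumes "surj (of_nat :: nat \<Rightarrow> 'n::{finite,comm_ring_1})"
  shows "CHAR('n) = CARD('n)"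
proof -
  let ?c = "CHAR('n)"
  have pos: "?c > 0"
  proof (rule ccontr)
    assume "\<not> ?c > 0"
    then have "inj (of_nat :: nat \<Rightarrow> 'n)"
      by (auto intro!: injI simp: of_nat_eq_iff_mod_CHAR)
    then show False
      using finite_imageD[of "of_nat :: nat \<Rightarrow> 'n" UNIV] by auto
  qed
  have "inj_on (of_nat :: nat \<Rightarrow> 'n) {..<?c}"
    by (auto intro!: inj_onI simp: of_nat_eq_iff_mod_CHAR)
  moreover have "(of_nat :: nat \<Rightarrow> 'n) ` {..<?c} = UNIV"
  proof -
    have "j \<in> (of_nat :: nat \<Rightarrow> 'n) ` {..<?c}" for j :: 'n
    proof -
      obtain k where "j = of_nat k" using assms by (metis surjD)
      also have "of_nat k = (of_nat (k mod ?c) :: 'n)"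
        by (simp add: of_nat_eq_iff_mod_CHAR)
      finally show ?thesis using pos by auto
    qed
    then show ?thesis by auto
  qed
  ultimately show ?thesis by (metis card_image card_lessThan)
qed

text \<open>The Jacobian at the constant state -1/2. Differentiating the first factor of the product
  gives nothing, since the bracket vanishes at a constant state; the second factor contributes with
  weight -1/2.\<close>

definition lorenz96_lin :: "real ^ 'n::{finite,comm_ring_1} \<Rightarrow> real ^ 'n::{finite,comm_ring_1}" where
  "lorenz96_lin v = (\<chi> j. - (v $ (j + 1) - v $ (j - 2)) / 2 - v $ j)"

lemma linear_lin: "linear lorenz96_lin"
  by (rule linearI) (simp_all add: lorenz96_lin_def vec_eq_iff field_simps)

text \<open>The vector \<open>alt\<close> stands for \<open>(-1)\<^sup>j\<close>, which has no
  direct meaning for an index in an abstract ring. Its existence is the form in which evenness of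
  the dimension is used.\<close>

locale even_cycle =
  fixes alt :: "real ^ 'n::{finite,comm_ring_1}"
  assumes surj_of_nat: "surj (of_nat :: nat \<Rightarrow> 'n)"
    and alt_Suc: "alt $ (j + 1) = - alt $ j"
    and alt_0: "alt $ 0 = 1"

text \<open>The sign is read off from any natural number representing the index; all representatives
  have the same parity because the characteristic is even.\<close>

lemma even_cycle_exists:
  assumes "surj (of_nat :: nat \<Rightarrow> 'n::{finite,comm_ring_1})" "even CARD('n)"
  obtains alt :: "real ^ 'n::{finite,comm_ring_1}" where "even_cycle alt"
proof
  define rep where "rep = (inv of_nat :: 'n \<Rightarrow> nat)"
  have rep: "of_nat (rep j) = j" for j
    unfolding rep_def using assms(1) by (simp add: surj_f_inv_f)
  have "even CHAR('n)" using CHAR_eq_CARD assms by metis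
  then have par: "even a = even b" if "(of_nat a :: 'n) = of_nat b" for a b
    using that unfolding of_nat_eq_iff_mod_CHAR by (metis dvd_mod_iff)
  show "even_cycle (\<chi> j. if even (rep j) then (1::real) else - 1)"
  proof
    fix j :: 'n
    have "even (rep (j + 1)) = even (rep j + 1)"
      by (rule par) (simp add: rep)
    then show "(\<chi> j. if even (rep j) then (1::real) else - 1) $ (j + 1) = - (\<chi> j. if even (rep j) then 1 else - 1) $ j"
      by simp
    show "(\<chi> j. if even (rep j) then (1::real) else - 1) $ 0 = 1"
      using par[of "rep 0" 0] by (simp add: rep)
  qed (use assms in auto)
qed

context even_cycle
begin

lemma cyclic_induct [case_names 0 Suc]:
  assumes "P 0" "\<And>j. P j \<Longrightarrow> P (j + 1)"
  shows "P (j :: 'n)"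
proof -
  obtain k where "j = of_nat k" using surj_of_nat by (metis surjD)
  moreover have "P (of_nat k)"
    by (induction k) (use assms in \<open>simp_all add: add.commute[of 1]\<close>)
  ultimately show ?thesis by simp
qed

lemma alt_pred: "alt $ (j - 1) = - alt $ j"
  using alt_Suc[of "j - 1"] by simp

lemma alt_minus_2: "alt $ (j - 2) = alt $ j"
  using alt_pred[of "j - 1"] alt_pred[of j] by (simp add: diff_diff_eq)

lemma alt_sq: "alt $ j * alt $ j = 1"
  by (induction j rule: cyclic_induct) (auto simp: alt_0 alt_Suc)

section \<open>Quadratic form and kernels of the linearisation\<close>

lemma sum_shift: "(\<Sum>j\<in>UNIV. f (j + a)) = (\<Sum>j\<in>UNIV. f (j :: 'n))" for f :: "'n \<Rightarrow> 'b::comm_monoid_add"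
  by (rule sum.reindex_bij_witness[of _ "\<lambda>j. j - a" "\<lambda>j. j + a"]) auto

lemma sum_shift_minus: "(\<Sum>j\<in>UNIV. f (j - a)) = (\<Sum>j\<in>UNIV. f (j :: 'n))" for f :: "'n \<Rightarrow> 'b::comm_monoid_add"
  using sum_shift[of f "- a"] by simp

lemma sum_alt: "(\<Sum>j\<in>UNIV. alt $ j) = 0"
  using sum_shift[of "\<lambda>j. alt $ j" 1] by (simp add: alt_Suc sum_negf)

text \<open>By shift invariance each sum of squares expands into twice the sum of the
  \<open>(v $ j)\<^sup>2\<close> and a correlation at lag 1 or 2. The signs + and - inside the
  squares are those that reproduce the two correlations of the linearisation.\<close>

lemma inner_lin:
  fixes v :: "real ^ 'n::{finite,comm_ring_1}"
  shows "v \<bullet> lorenz96_lin v = - (\<Sum>j\<in>UNIV. (v $ (j + 1) + v $ j)\<^sup>2) / 4 - (\<Sum>j\<in>UNIV. (v $ (j - 2) - v $ j)\<^sup>2) / 4"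
proof -
  let ?S = "\<lambda>f. \<Sum>j\<in>(UNIV :: 'n set). f j :: real"
  have "?S (\<lambda>j. (v $ (j + 1) + v $ j)\<^sup>2) =
      ?S (\<lambda>j. (v $ (j + 1))\<^sup>2) + ?S (\<lambda>j. (v $ j)\<^sup>2) + 2 * ?S (\<lambda>j. v $ j * v $ (j + 1))"
    unfolding sum_distrib_left sum.distrib[symmetric]
    by (rule sum.cong) (auto simp: power2_eq_square algebra_simps)
  moreover have "?S (\<lambda>j. (v $ (j + 1))\<^sup>2) = ?S (\<lambda>j. (v $ j)\<^sup>2)"
    by (rule sum_shift)
  moreover have "?S (\<lambda>j. (v $ (j - 2) - v $ j)\<^sup>2) =
      ?S (\<lambda>j. (v $ (j - 2))\<^sup>2) + ?S (\<lambda>j. (v $ j)\<^sup>2) - 2 * ?S (\<lambda>j. v $ j * v $ (j - 2))"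
    unfolding sum_distrib_left sum.distrib[symmetric] sum_subtractf[symmetric]
    by (rule sum.cong) (auto simp: power2_eq_square algebra_simps)
  moreover have "?S (\<lambda>j. (v $ (j - 2))\<^sup>2) = ?S (\<lambda>j. (v $ j)\<^sup>2)"
    by (rule sum_shift_minus)
  moreover have "v \<bullet> lorenz96_lin v = ?S (\<lambda>j. v $ j * v $ (j - 2)) / 2 - ?S (\<lambda>j. v $ j * v $ (j + 1)) / 2 - ?S (\<lambda>j. (v $ j)\<^sup>2)"
    unfolding inner_vec_def lorenz96_lin_def sum_divide_distrib sum_subtractf[symmetric]
    by (rule sum.cong) (auto simp: power2_eq_square field_simps)
  ultimately show ?thesis by (simp add: field_simps)
qed

lemma inner_lin_le_0: "v \<bullet> lorenz96_lin v \<le> 0" for v :: "real ^ 'n::{finite,comm_ring_1}"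
proof -
  have *: "- a / 4 - b / 4 \<le> 0" if "0 \<le> a" "0 \<le> b" for a b :: real using that by simp
  show ?thesis unfolding inner_lin by (intro * sum_nonneg) auto
qed

lemma alternating_eq:
  assumes "\<And>j. v $ (j + 1) = - v $ j"
  shows "v = v $ 0 *\<^sub>R alt"
proof -
  have "v $ j = v $ 0 * alt $ j" for j
  proof (induction j rule: cyclic_induct)
    case (Suc j)
    then show ?case using assms[of j] alt_Suc[of j] by simp
  qed (simp add: alt_0)
  then show ?thesis unfolding vec_eq_iff vector_scaleR_component real_scaleR_def by blast
qed

lemma inner_lin_eq_0:
  assumes "v \<bullet> lorenz96_lin v = 0"
  shows "v = v $ 0 *\<^sub>R alt"
proof (rule alternating_eq)
  fix j
  have *: "a = 0" if "- a / 4 - b / 4 = 0" "0 \<le> a" "0 \<le> b" for a b :: real using that by simp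
  have "(\<Sum>j\<in>UNIV. (v $ (j + 1) + v $ j)\<^sup>2) = 0"
    using assms unfolding inner_lin by (rule *) (auto intro: sum_nonneg)
  then have "\<forall>j\<in>UNIV. (v $ (j + 1) + v $ j)\<^sup>2 = 0"
    using sum_nonneg_eq_0_iff[of UNIV "\<lambda>j. (v $ (j + 1) + v $ j)\<^sup>2"] by simp
  then have "v $ (j + 1) + v $ j = 0" by simp
  then show "v $ (j + 1) = - v $ j" by simp
qed

lemma lin_alt: "lorenz96_lin alt = 0"
  by (simp add: lorenz96_lin_def vec_eq_iff alt_Suc alt_minus_2)

text \<open>Being in the left kernel too, \<open>alt\<close> splits off: its orthogonal complement
  is invariant, and the zero eigenvalue can be algebraically simple.\<close>

lemma alt_inner_lin: "alt \<bullet> lorenz96_lin v = 0"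
proof -
  have "(\<Sum>j\<in>UNIV. alt $ j * v $ (j + 1)) = - (\<Sum>j\<in>UNIV. alt $ j * v $ j)"
    using sum_shift[of "\<lambda>j. - alt $ j * v $ j" 1] by (simp add: alt_Suc sum_negf)
  moreover have "(\<Sum>j\<in>UNIV. alt $ j * v $ (j - 2)) = (\<Sum>j\<in>UNIV. alt $ j * v $ j)"
    using sum_shift_minus[of "\<lambda>j. alt $ j * v $ j" 2] by (simp add: alt_minus_2)
  moreover have "alt \<bullet> lorenz96_lin v = (\<Sum>j\<in>UNIV. alt $ j * v $ (j - 2)) / 2
      - (\<Sum>j\<in>UNIV. alt $ j * v $ (j + 1)) / 2 - (\<Sum>j\<in>UNIV. alt $ j * v $ j)"
    unfolding inner_vec_def lorenz96_lin_def sum_divide_distrib sum_subtractf[symmetric]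
    by (rule sum.cong) (auto simp: field_simps)
  ultimately show ?thesis by simp
qed

lemma lin_kernel: "lorenz96_lin v = 0 \<Longrightarrow> v = v $ 0 *\<^sub>R alt"
  by (rule inner_lin_eq_0) simp

lemma alt_inner_alt: "alt \<bullet> alt = real CARD('n)"
  by (simp add: inner_vec_def alt_sq)

end

lemma lorenz96_has_derivative:
  "((\<lambda>x. lorenz96 x (- 1/2)) has_derivative lorenz96_lin) (at (vec (- 1/2)))"
proof -
  have nth: "((\<lambda>x. x $ k) has_derivative (\<lambda>h. h $ k)) (at a)" for k and a :: "real ^ 'n::{finite,comm_ring_1}"
    by (rule bounded_linear_imp_has_derivative) (rule bounded_linear_vec_nth)
  show ?thesis
    unfolding has_derivative_componentwise_within[of _ lorenz96_lin]
    by (auto simp: lorenz96_def Basis_vec_def inner_axis inner_axis'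
        intro!: derivative_eq_intros nth simp: fun_eq_iff lorenz96_lin_def field_simps)
qed

section \<open>Determinants and the characteristic polynomial\<close>

lemma poly_det:
  fixes M :: "'a::comm_ring_1 poly ^ 'n::finite ^ 'n::finite"
  shows "poly (det M) z = det (map_matrix (\<lambda>p. poly p z) M)"
  by (simp add: det_def poly_sum poly_prod map_matrix_def)

text \<open>Multilinearity in row \<open>k\<close>: every summand other than row \<open>k\<close>
  itself produces a matrix with two equal rows.\<close>

lemma det_row_combination:
  fixes M :: "'a::comm_ring_1 ^ 'n::finite ^ 'n::finite"
  shows "det (\<chi> i. if i = k then (\<Sum>j\<in>UNIV. c j *s M $ j) else M $ i) = c k * det M"
proof -
  have *: "det (\<chi> i. if i = k then M $ j else M $ i) = (if j = k then det M else 0)" for j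
  proof (cases "j = k")
    case True
    then have "(\<chi> i. if i = k then M $ j else M $ i) = M" by (simp add: vec_eq_iff)
    then show ?thesis using True by simp
  next
    case False
    then have "det (\<chi> i. if i = k then M $ j else M $ i) = 0"
      by (intro det_identical_rows[of j k]) (auto simp: row_def vec_eq_iff)
    then show ?thesis using False by simp
  qed
  show ?thesis
    unfolding det_linear_row_sum[OF finite] det_row_mul * by (simp add: if_distrib cong: if_cong)
qed

lemma singular_kernel:
  fixes M :: "'a::field ^ 'n::finite ^ 'n::finite"
  assumes "det M = 0"
  obtains v where "v \<noteq> 0" "M *v v = 0"
  using assms matrix_left_invertible_ker[of M] invertible_det_nz[of M] invertible_left_inverse[of M] by blast

abbreviation "jac \<equiv> jacobian (\<lambda>x. lorenz96 x (- 1/2)) (at (vec (- 1/2)))"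

lemma jac_mult: "jac *v v = lorenz96_lin v"
proof -
  have "((\<lambda>x. lorenz96 x (- 1/2)) has_derivative (\<lambda>h. jac *v h)) (at (vec (- 1/2)))"
    using lorenz96_has_derivative by (subst jacobian_works[symmetric]) (auto simp: differentiable_def)
  then have "(\<lambda>h. jac *v h) = lorenz96_lin"
    using lorenz96_has_derivative by (rule has_derivative_unique)
  then show ?thesis by metis
qed

lemma complex_jac_mult:
  fixes u :: "complex ^ 'n::{finite,comm_ring_1}"
  shows "(\<chi> j. Re ((map_matrix complex_of_real jac *v u) $ j)) = lorenz96_lin (\<chi> j. Re (u $ j))"
    "(\<chi> j. Im ((map_matrix complex_of_real jac *v u) $ j)) = lorenz96_lin (\<chi> j. Im (u $ j))"
  unfolding jac_mult[symmetric] by (simp_all add: matrix_vector_mult_def map_matrix_def vec_eq_iff)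

context even_cycle
begin

lemma lin_of_inner_eq_0: "v \<bullet> lorenz96_lin v = 0 \<Longrightarrow> lorenz96_lin v = 0" for v :: "real ^ 'n::{finite,comm_ring_1}"
  by (subst inner_lin_eq_0[of v]) (simp_all add: linear_scale[OF linear_lin] lin_alt)

lemma left_kernel: "(\<Sum>j\<in>UNIV. alt $ j * jac $ j $ l) = 0"
proof -
  have "jac $ j $ l = lorenz96_lin (axis l 1) $ j" for j :: 'n
    unfolding jac_mult[symmetric] by (simp add: matrix_vector_mult_def axis_def if_distrib cong: if_cong)
  then show ?thesis
    using alt_inner_lin[of "axis l 1"] by (simp add: inner_vec_def)
qed

text \<open>For an eigenvector \<open>a + \<i> b\<close> with eigenvalue \<open>\<i> w\<close>, the
  quadratic form takes opposite values at \<open>a\<close> and \<open>b\<close>. Being nonpositive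
  it vanishes at both, which puts \<open>a\<close> and \<open>b\<close> into the kernel and forces
  \<open>w = 0\<close>.\<close>

lemma charpoly_root_imaginary:
  fixes z :: complex
  assumes z: "poly (charpoly (map_matrix complex_of_real (jac :: real ^ 'n::{finite,comm_ring_1} ^ 'n::{finite,comm_ring_1}))) z = 0" "Re z = 0"
  shows "z = 0"
proof -
  let ?C = "map_matrix complex_of_real (jac :: real ^ 'n::{finite,comm_ring_1} ^ 'n::{finite,comm_ring_1})"
  have "map_matrix (\<lambda>p. poly p z) (mat [:0, 1:] - map_matrix (\<lambda>a. [:a:]) ?C) = mat z - ?C"
    by (simp add: vec_eq_iff map_matrix_def mat_def)
  then have "det (mat z - ?C) = 0"
    using z(1) by (simp add: charpoly_def poly_det)
  then obtain u where u: "u \<noteq> 0" "(mat z - ?C) *v u = 0" by (rule singular_kernel)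
  have "mat z *v u = z *s u"
    by (simp add: vec_eq_iff matrix_vector_mult_def mat_def if_distrib[of "\<lambda>a. a * _"] cong: if_cong)
  then have Cu: "?C *v u = z *s u"
    using u(2) by (simp add: matrix_vector_mult_diff_rdistrib)
  define a where "a = (\<chi> j. Re (u $ j))"
  define b where "b = (\<chi> j. Im (u $ j))"
  define w where "w = Im z"
  have z': "z = \<i> * w" using z(2) by (simp add: w_def complex_eq_iff)
  have la: "lorenz96_lin a = - w *\<^sub>R b"
    using complex_jac_mult(1)[of u] unfolding Cu by (simp add: a_def b_def z' vec_eq_iff)
  have lb: "lorenz96_lin b = w *\<^sub>R a"
    using complex_jac_mult(2)[of u] unfolding Cu by (simp add: a_def b_def z' vec_eq_iff)
  have "a \<bullet> lorenz96_lin a + b \<bullet> lorenz96_lin b = 0"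
    by (simp add: la lb inner_commute)
  then have "a \<bullet> lorenz96_lin a = 0" "b \<bullet> lorenz96_lin b = 0"
    using inner_lin_le_0[of a] inner_lin_le_0[of b] by simp_all
  then have "lorenz96_lin a = 0" "lorenz96_lin b = 0"
    by (simp_all add: lin_of_inner_eq_0)
  then have "w = 0 \<or> a = 0 \<and> b = 0" using la lb by auto
  moreover have "\<not> (a = 0 \<and> b = 0)"
    using u(1) by (auto simp: a_def b_def vec_eq_iff complex_eq_iff)
  ultimately show ?thesis using z' by simp
qed

text \<open>Replacing row 0 by the alternating combination of all rows leaves the determinant unchanged
  and turns row 0 into \<open>X\<close> times the alternating vector; the cofactor is nonzero at 0.\<close>

lemma charpoly_order: "order 0 (charpoly (map_matrix complex_of_real (jac :: real ^ 'n::{finite,comm_ring_1} ^ 'n::{finite,comm_ring_1}))) = 1"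
proof -
  let ?C = "map_matrix complex_of_real (jac :: real ^ 'n::{finite,comm_ring_1} ^ 'n::{finite,comm_ring_1})"
  define M where "M = mat [:0, 1:] - map_matrix (\<lambda>a. [:a:]) ?C"
  define Q where "Q = (\<chi> i. if i = 0 then (\<chi> l. [:complex_of_real (alt $ l):]) else M $ i)"
  have row: "(\<Sum>j\<in>UNIV. [:complex_of_real (alt $ j):] *s M $ j) = [:0, 1:] *s (\<chi> l. [:complex_of_real (alt $ l):])"
    (is "?L = ?R")
  proof (subst vec_eq_iff, intro allI)
    fix l
    have "?L $ l = (\<Sum>j\<in>UNIV. [:complex_of_real (alt $ j):] * (if j = l then [:0, 1:] else 0))
        - [:complex_of_real (\<Sum>j\<in>UNIV. alt $ j * jac $ j $ l):]"
      unfolding M_def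
      by (simp add: mat_def map_matrix_def algebra_simps sum_subtractf sum_to_poly)
    also have "\<dots> = ?R $ l"
      by (simp only: left_kernel) (simp add: if_distrib[of "\<lambda>a. _ * a"] cong: if_cong)
    finally show "?L $ l = ?R $ l" .
  qed
  have "[:complex_of_real (alt $ 0):] * det M = det (\<chi> i. if i = 0 then [:0, 1:] *s (\<chi> l. [:complex_of_real (alt $ l):]) else M $ i)"
    unfolding row[symmetric] det_row_combination ..
  also have "\<dots> = [:0, 1:] * det Q"
    unfolding Q_def by (rule det_row_mul)
  finally have M: "det M = [:0, 1:] * det Q" by (simp add: alt_0 one_pCons[symmetric])
  have "poly (det Q) 0 \<noteq> 0"
  proof
    assume "poly (det Q) 0 = 0"
    then have "det (map_matrix (\<lambda>p. poly p 0) Q) = 0" by (simp add: poly_det)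
    then obtain u where u: "u \<noteq> 0" "map_matrix (\<lambda>p. poly p 0) Q *v u = 0" by (rule singular_kernel)
    have rows: "(map_matrix (\<lambda>p. poly p 0) Q *v u) $ i =
        (if i = 0 then (\<Sum>l\<in>UNIV. complex_of_real (alt $ l) * u $ l) else - (?C *v u) $ i)" for i
      by (simp add: matrix_vector_mult_def Q_def M_def map_matrix_def mat_def sum_negf
          if_distrib[of "\<lambda>p. poly p 0"] cong: if_cong)
    have alt_u: "(\<Sum>l\<in>UNIV. complex_of_real (alt $ l) * u $ l) = 0"
      using rows[of 0] u(2) by simp
    have off: "(?C *v u) $ i = 0" if "i \<noteq> 0" for i
      using rows[of i] u(2) that by simp
    define a where "a = (\<chi> j. Re (u $ j))"
    define b where "b = (\<chi> j. Im (u $ j))"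
    \<comment> \<open>All rows of the linearisation but row 0 annihilate \<open>v\<close>. The left
      kernel relation, with \<open>alt $ 0 = 1\<close>, supplies row 0; so \<open>v\<close> is a
      multiple of \<open>alt\<close> orthogonal to \<open>alt\<close>.\<close>
    have ker: "v = 0" if "\<And>i. i \<noteq> 0 \<Longrightarrow> lorenz96_lin v $ i = 0" "alt \<bullet> v = 0" for v
    proof -
      have "alt \<bullet> lorenz96_lin v = (\<Sum>i\<in>{0}. alt $ i * lorenz96_lin v $ i)"
        unfolding inner_vec_def inner_real_def
        by (rule sum.mono_neutral_right) (use that(1) in auto)
      then have "lorenz96_lin v $ 0 = 0" using alt_inner_lin by (simp add: alt_0)
      then have "lorenz96_lin v $ i = 0 $ i" for i using that(1)[of i] by (cases "i = 0") simp_all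
      then have "lorenz96_lin v = 0" unfolding vec_eq_iff by (rule allI)
      then have v: "v = v $ 0 *\<^sub>R alt" by (rule lin_kernel)
      then have "alt \<bullet> v = alt \<bullet> (v $ 0 *\<^sub>R alt)"
        by (rule arg_cong)
      also have "\<dots> = v $ 0 * real CARD('n)"
        unfolding inner_scaleR_right alt_inner_alt ..
      finally have "alt \<bullet> v = v $ 0 * real CARD('n)" .
      then have "v $ 0 = 0" using that(2) by simp
      then show "v = 0" by (subst v) simp
    qed
    have "a = 0"
    proof (rule ker)
      show "lorenz96_lin a $ i = 0" if "i \<noteq> 0" for i
        using off[OF that] by (simp add: a_def complex_jac_mult(1)[of u, symmetric])
      show "alt \<bullet> a = 0"
        using arg_cong[OF alt_u, of Re] by (simp add: inner_vec_def a_def)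
    qed
    moreover have "b = 0"
    proof (rule ker)
      show "lorenz96_lin b $ i = 0" if "i \<noteq> 0" for i
        using off[OF that] by (simp add: b_def complex_jac_mult(2)[of u, symmetric])
      show "alt \<bullet> b = 0"
        using arg_cong[OF alt_u, of Im] by (simp add: inner_vec_def b_def)
    qed
    ultimately show False
      using u(1) by (auto simp: a_def b_def vec_eq_iff complex_eq_iff)
  qed
  then have "order 0 (det Q) = 0" "det Q \<noteq> 0" by (auto simp: order_root)
  moreover have "order 0 [:0, 1::complex:] = 1"
    using order_power_n_n[of "0::complex" 1] by simp
  ultimately have "order 0 (det M) = 1"
    unfolding M by (subst order_mult) auto
  then show ?thesis by (simp add: charpoly_def M_def)
qed

lemma simple_zero_eigenvalue:
  "simple_zero_eigenvalue_only_critical (jac :: real ^ 'n::{finite,comm_ring_1} ^ 'n::{finite,comm_ring_1})"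
  unfolding simple_zero_eigenvalue_only_critical_def Let_def
  using charpoly_order charpoly_root_imaginary by blast

end

section \<open>Invariant subspaces\<close>

definition extended_lin ::
  "(real ^ 'n::{finite,comm_ring_1}) \<times> real \<Rightarrow> (real ^ 'n::{finite,comm_ring_1}) \<times> real" where
  "extended_lin z = (lorenz96_lin (fst z) + vec (snd z), 0)"

lemma extended_field_has_derivative:
  "(extended_field lorenz96 has_derivative extended_lin)
    (at (vec (- 1/2) :: real ^ 'n::{finite,comm_ring_1}, - 1/2))"
proof -
  have eq: "extended_field lorenz96 =
      (\<lambda>z :: (real ^ 'n::{finite,comm_ring_1}) \<times> real. (lorenz96 (fst z) (- 1/2) + (snd z + 1/2) *\<^sub>R vec 1, 0))"
    by (simp add: extended_field_def fun_eq_iff lorenz96_def vec_eq_iff)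
  have "((\<lambda>z :: (real ^ 'n::{finite,comm_ring_1}) \<times> real. lorenz96 (fst z) (- 1/2)) has_derivative (\<lambda>z. lorenz96_lin (fst z))) (at (vec (- 1/2), - 1/2 :: real))"
    using has_derivative_compose[of fst fst "(vec (- 1/2), - 1/2 :: real)" UNIV "\<lambda>x. lorenz96 x (- 1/2)" lorenz96_lin]
      lorenz96_has_derivative by (simp add: bounded_linear_imp_has_derivative bounded_linear_fst)
  then have "((\<lambda>z :: (real ^ 'n::{finite,comm_ring_1}) \<times> real. (lorenz96 (fst z) (- 1/2) + (snd z + 1/2) *\<^sub>R vec 1, 0 :: real))
      has_derivative (\<lambda>z. (lorenz96_lin (fst z) + snd z *\<^sub>R vec 1, 0))) (at (vec (- 1/2), - 1/2))"
    by (auto intro!: derivative_eq_intros)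
  moreover have "(\<lambda>z :: (real ^ 'n::{finite,comm_ring_1}) \<times> real. (lorenz96_lin (fst z) + snd z *\<^sub>R vec 1, 0)) = extended_lin"
    by (simp add: extended_lin_def fun_eq_iff vec_eq_iff)
  ultimately show ?thesis unfolding eq by (simp only:)
qed

text \<open>Gronwall's inequality in both time directions, on an interval of any kind:
  \<open>exp (- 2 * B * t) * (u t \<bullet> u t)\<close> does not increase and
  \<open>exp (2 * B * t) * (u t \<bullet> u t)\<close> does not decrease. The bound is asked for on
  compact subintervals only, since \<open>B\<close> may depend on the size of a solution
  there.\<close>

lemma zero_of_linear_growth:
  fixes u :: "real \<Rightarrow> 'a::real_inner"
  assumes J: "is_interval J" "t\<^sub>0 \<in> J" "t \<in> J" and u0: "u t\<^sub>0 = 0"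
    and der: "\<And>t. t \<in> J \<Longrightarrow> (u has_vector_derivative u' t) (at t within J)"
    and bound: "\<And>a b. {a..b} \<subseteq> J \<Longrightarrow> \<exists>B. \<forall>t\<in>{a..b}. norm (u' t) \<le> B * norm (u t)"
  shows "u t = 0"
proof -
  have *: "- s * (exp (- s * 2 * B * a) * (u a \<bullet> u a)) \<le> - s * (exp (- s * 2 * B * b) * (u b \<bullet> u b))"
    if ab: "a \<le> b" "{a..b} \<subseteq> J" and B: "\<And>t. t \<in> {a..b} \<Longrightarrow> norm (u' t) \<le> B * norm (u t)"
      and s: "s = 1 \<or> s = - 1" for a b B s
  proof -
    define f where "f = (\<lambda>t. - s * (exp (- s * 2 * B * t) * (u t \<bullet> u t)))"
    have "f a \<le> f b"
    proof (rule mono_within_Icc[where f = f and f' =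
          "\<lambda>t. exp (- s * 2 * B * t) * (2 * B * (u t \<bullet> u t) - s * (2 * (u t \<bullet> u' t)))"])
      fix t assume t: "t \<in> {a..b}"
      have "(u has_vector_derivative u' t) (at t within {a..b})"
        by (rule has_vector_derivative_within_subset[OF der]) (use t ab(2) in blast)+
      then have "((\<lambda>t. u t \<bullet> u t) has_real_derivative 2 * (u t \<bullet> u' t)) (at t within {a..b})"
        unfolding has_vector_derivative_def has_field_derivative_def
        by (auto intro!: derivative_eq_intros simp: inner_commute algebra_simps)
      then have "(f has_real_derivative
          - s * (exp (- s * 2 * B * t) * (- s * 2 * B) * (u t \<bullet> u t) + 2 * (u t \<bullet> u' t) * exp (- s * 2 * B * t)))
          (at t within {a..b})"
        unfolding f_def by (auto intro!: derivative_eq_intros)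
      moreover have "- s * (E * (- s * 2 * B) * p + 2 * q * E) = E * (2 * B * p - s * (2 * q))" for E p q
        using s by (elim disjE) (simp_all add: algebra_simps)
      ultimately show "(f has_vector_derivative exp (- s * 2 * B * t) * (2 * B * (u t \<bullet> u t) - s * (2 * (u t \<bullet> u' t))))
          (at t within {a..b})"
        by (simp only: has_real_derivative_iff_has_vector_derivative)
      have "\<bar>u t \<bullet> u' t\<bar> \<le> norm (u t) * norm (u' t)" by (rule Cauchy_Schwarz_ineq2)
      also have "\<dots> \<le> norm (u t) * (B * norm (u t))" using B[OF t] by (intro mult_left_mono) auto
      also have "\<dots> = B * (u t \<bullet> u t)" by (simp add: dot_square_norm power2_eq_square)
      finally show "0 \<le> exp (- s * 2 * B * t) * (2 * B * (u t \<bullet> u t) - s * (2 * (u t \<bullet> u' t)))"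
        using s by (intro mult_nonneg_nonneg) auto
    qed (use ab in auto)
    then show ?thesis by (simp add: f_def)
  qed
  have sub: "{a..b} \<subseteq> J" if "a \<in> J" "b \<in> J" for a b
  proof
    fix c assume "c \<in> {a..b}"
    then show "c \<in> J" using mem_is_interval_1_I[OF J(1) that, of c] by simp
  qed
  show ?thesis
  proof (cases "t\<^sub>0 \<le> t")
    case True
    obtain B where "\<forall>s\<in>{t\<^sub>0..t}. norm (u' s) \<le> B * norm (u s)"
      using bound[OF sub[OF J(2,3)]] by blast
    then have "exp (- (2 * B * t)) * (u t \<bullet> u t) \<le> 0"
      using *[OF True sub[OF J(2,3)], of B 1] u0 by simp
    then have "u t \<bullet> u t \<le> 0" by (simp add: mult_le_0_iff)
    then have "u t \<bullet> u t = 0" using inner_ge_zero by (rule antisym)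
    then show ?thesis by (simp only: inner_eq_zero_iff)
  next
    case False
    then have le: "t \<le> t\<^sub>0" by simp
    obtain B where "\<forall>s\<in>{t..t\<^sub>0}. norm (u' s) \<le> B * norm (u s)"
      using bound[OF sub[OF J(3,2)]] by blast
    then have "exp (2 * B * t) * (u t \<bullet> u t) \<le> 0"
      using *[OF le sub[OF J(3,2)], of B "- 1"] u0 by simp
    then have "u t \<bullet> u t \<le> 0" by (simp add: mult_le_0_iff)
    then have "u t \<bullet> u t = 0" using inner_ge_zero by (rule antisym)
    then show ?thesis by (simp only: inner_eq_zero_iff)
  qed
qed

text \<open>The difference \<open>u\<close> between the state and its shift by 2 satisfies an
  equation linear in \<open>u\<close>, whose coefficients are bounded along the given solution on
  compact time intervals.\<close>

lemma lorenz96_period_2_invariant: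
  fixes x :: "real \<Rightarrow> real ^ 'n::{finite,comm_ring_1}"
  assumes J: "is_interval J" "t\<^sub>0 \<in> J" "t \<in> J"
    and sol: "solves (\<lambda>x. lorenz96 x F) J x"
    and x0: "\<And>j. x t\<^sub>0 $ (j + 2) = x t\<^sub>0 $ j"
  shows "x t $ (j + 2) = x t $ j"
proof -
  define S where "S = (\<lambda>v :: real ^ 'n::{finite,comm_ring_1}. \<chi> j. v $ (j + 2) - v $ j)"
  have S: "bounded_linear S"
    unfolding linear_conv_bounded_linear[symmetric] S_def
    by (rule linearI) (simp_all add: vec_eq_iff algebra_simps)
  have "S (x t) = 0"
  proof (rule zero_of_linear_growth[OF J, where u' = "\<lambda>t. S (lorenz96 (x t) F)"])
    show "S (x t\<^sub>0) = 0" using x0 by (simp add: S_def vec_eq_iff)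
    show "((\<lambda>t. S (x t)) has_vector_derivative S (lorenz96 (x t) F)) (at t within J)" if "t \<in> J" for t
      using sol that S by (auto simp: solves_def intro: bounded_linear.has_vector_derivative)
    fix a b assume ab: "{a..b} \<subseteq> J"
    have "continuous_on J x"
      using sol unfolding solves_def continuous_on_eq_continuous_within
      by (auto intro: has_vector_derivative_continuous)
    then have "compact (x ` {a..b})"
      using ab by (intro compact_continuous_image) (auto intro: continuous_on_subset)
    then obtain K where "\<forall>y\<in>x ` {a..b}. norm y \<le> K"
      using compact_imp_bounded[of "x ` {a..b}"] unfolding bounded_iff by auto
    then have K: "norm (x t) \<le> K" if "t \<in> {a..b}" for t using that by simp
    have "norm (S (lorenz96 (x t) F)) \<le> (real CARD('n) * (4 * K + 1)) * norm (S (x t))" if t: "t \<in> {a..b}" for t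
    proof -
      define y where "y = x t"
      define u where "u = S y"
      have y: "\<bar>y $ i\<bar> \<le> K" for i
        using component_le_norm_cart[of y i] K[OF t] by (simp add: y_def)
      have u: "\<bar>u $ i\<bar> \<le> norm u" for i by (rule component_le_norm_cart)
      \<comment> \<open>The difference of two products, split so that each term contains a factor
        from \<open>u\<close>.\<close>
      have comp: "S (lorenz96 y F) $ j = u $ (j - 1) * (y $ (j + 3) - y $ j) + y $ (j - 1) * (u $ (j + 1) - u $ (j - 2)) - u $ j" for j
      proof -
        have "j + 2 - 1 = j + 1" "j + 2 + 1 = j + 3" "j + 2 - 2 = j" "j - 1 + 2 = j + 1" "j + 1 + 2 = j + 3" "j - 2 + 2 = j"
          by (simp_all add: algebra_simps)
        then show ?thesis by (simp add: S_def lorenz96_def u_def) (simp add: algebra_simps)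
      qed
      have "\<bar>S (lorenz96 y F) $ j\<bar> \<le> (4 * K + 1) * norm u" for j
      proof -
        have "\<bar>u $ (j - 1) * (y $ (j + 3) - y $ j)\<bar> \<le> norm u * (K + K)"
          unfolding abs_mult by (intro mult_mono u order.trans[OF abs_triangle_ineq4] add_mono y) auto
        moreover have "\<bar>y $ (j - 1) * (u $ (j + 1) - u $ (j - 2))\<bar> \<le> K * (norm u + norm u)"
          unfolding abs_mult
          by (intro mult_mono u order.trans[OF abs_triangle_ineq4] add_mono y order.trans[OF abs_ge_zero y]) auto
        moreover have "(4 * K + 1) * norm u = norm u * (K + K) + K * (norm u + norm u) + norm u"
          by (simp add: algebra_simps)
        ultimately show ?thesis unfolding comp using u[of j] by linarith
      qed
      then have "(\<Sum>j\<in>UNIV. \<bar>S (lorenz96 y F) $ j\<bar>) \<le> (\<Sum>j\<in>(UNIV :: 'n set). (4 * K + 1) * norm u)"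
        by (intro sum_mono)
      then show ?thesis
        using norm_le_l1_cart[of "S (lorenz96 y F)"] by (simp add: y_def u_def mult.assoc)
    qed
    then show "\<exists>B. \<forall>t\<in>{a..b}. norm (S (lorenz96 (x t) F)) \<le> B * norm (S (x t))" by blast
  qed
  then have "S (x t) $ j = 0" by simp
  then show ?thesis unfolding S_def vec_lambda_beta by (simp only: right_minus_eq)
qed

context even_cycle
begin

lemma perp_alt: "v = c *\<^sub>R alt \<Longrightarrow> alt \<bullet> v = 0 \<Longrightarrow> v = 0"
proof -
  assume v: "v = c *\<^sub>R alt" and perp: "alt \<bullet> v = 0"
  have "c * real CARD('n) = 0"
    using perp unfolding v inner_scaleR_right alt_inner_alt .
  then have "c = 0" by simp
  then show "v = 0" unfolding v by simp
qed

lemma inner_alt_vec: "alt \<bullet> vec m = 0"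
  by (simp add: inner_vec_def sum_alt flip: sum_distrib_right)

lemma lin_vec: "lorenz96_lin (vec m) = - (vec m :: real ^ 'n::{finite,comm_ring_1})"
  by (simp add: lorenz96_lin_def vec_eq_iff)

text \<open>The quadratic form is nonpositive at \<open>u\<close> and at its image
  \<open>lorenz96_lin u\<close>, while the hypothesis makes the second value
  \<open>- \<omega>\<^sup>2\<close> times the first, so both sides vanish. For \<omega> = 0 this
  says only that the image is a multiple of \<open>alt\<close>; it is also orthogonal to
  \<open>alt\<close>, hence zero.\<close>

lemma lin_squared_injective:
  assumes "lorenz96_lin (lorenz96_lin u) + \<omega>\<^sup>2 *\<^sub>R u = 0" and perp: "alt \<bullet> u = 0"
  shows "u = 0"
proof -
  have l: "lorenz96_lin (lorenz96_lin u) = - (\<omega>\<^sup>2 *\<^sub>R u)" using assms(1) by (simp add: eq_neg_iff_add_eq_0)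
  have "lorenz96_lin u \<bullet> lorenz96_lin (lorenz96_lin u) = - (\<omega>\<^sup>2 * (u \<bullet> lorenz96_lin u))" by (simp add: l inner_commute)
  moreover have "\<omega>\<^sup>2 * (u \<bullet> lorenz96_lin u) \<le> 0" using inner_lin_le_0 by (simp add: mult_nonneg_nonpos)
  moreover have "lorenz96_lin u \<bullet> lorenz96_lin (lorenz96_lin u) \<le> 0" by (rule inner_lin_le_0)
  ultimately have 0: "lorenz96_lin u \<bullet> lorenz96_lin (lorenz96_lin u) = 0" "\<omega>\<^sup>2 * (u \<bullet> lorenz96_lin u) = 0" by linarith+
  have "u \<bullet> lorenz96_lin u = 0"
  proof (cases "\<omega> = 0")
    case True
    have "lorenz96_lin u = 0"
      using perp_alt[OF inner_lin_eq_0[OF 0(1)]] alt_inner_lin by simp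
    then show ?thesis by simp
  qed (use 0 in simp)
  then show ?thesis using perp_alt[OF inner_lin_eq_0] perp by blast
qed

definition coef :: "real ^ 'n::{finite,comm_ring_1} \<Rightarrow> real" where
  "coef x = (alt \<bullet> x) / (alt \<bullet> alt)"

end

section \<open>Change of time\<close>

text \<open>\<open>J\<close> may be open, half-open or unbounded. The integral over compact
  intervals is used locally: each \<open>t\<close> has a compact subinterval of \<open>J\<close>
  that is a neighbourhood of \<open>t\<close> relative to \<open>J\<close>.\<close>

lemma antiderivative_on_interval:
  fixes a :: "real \<Rightarrow> real"
  assumes J: "is_interval J" and cont: "continuous_on J a"
  obtains \<tau> where "\<And>t. t \<in> J \<Longrightarrow> (\<tau> has_vector_derivative a t) (at t within J)"
proof (cases "J = {}")
  case False
  then obtain t\<^sub>0 where t0: "t\<^sub>0 \<in> J" by blast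
  have sub: "{l..u} \<subseteq> J" if "l \<in> J" "u \<in> J" for l u
  proof
    fix c assume "c \<in> {l..u}"
    then show "c \<in> J" using mem_is_interval_1_I[OF J that, of c] by simp
  qed
  define \<tau> where "\<tau> = (\<lambda>t. if t\<^sub>0 \<le> t then integral {t\<^sub>0..t} a else - integral {t..t\<^sub>0} a)"
  have "(\<tau> has_vector_derivative a t) (at t within J)" if t: "t \<in> J" for t
  proof -
    \<comment> \<open>Either there is room to the left of \<open>t\<close>, or \<open>t\<close> is
      the left end of \<open>J\<close>; the choice of \<open>u\<close> is the mirror image.\<close>
    obtain l where l: "l \<in> J" "l \<le> t" "l \<le> t\<^sub>0" "l < t \<or> (\<forall>s\<in>J. t \<le> s)"
    proof (cases "\<exists>s\<in>J. s < t")
      case True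
      then obtain s where "s \<in> J" "s < t" by blast
      then show ?thesis using that[of "min s t\<^sub>0"] t0 by (auto simp: min_def)
    next
      case False
      then show ?thesis using that[of t] t t0 by force
    qed
    obtain u where u: "u \<in> J" "t \<le> u" "t\<^sub>0 \<le> u" "t < u \<or> (\<forall>s\<in>J. s \<le> t)"
    proof (cases "\<exists>s\<in>J. t < s")
      case True
      then obtain s where "s \<in> J" "t < s" by blast
      then show ?thesis using that[of "max s t\<^sub>0"] t0 by (auto simp: max_def)
    next
      case False
      then show ?thesis using that[of t] t t0 by force
    qed
    have lu: "{l..u} \<subseteq> J" by (rule sub) (use l u in auto)
    have contlu: "continuous_on {l..u} a" using cont lu by (rule continuous_on_subset)
    have int: "a integrable_on {p..q}" if "l \<le> p" "q \<le> u" for p q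
      by (rule integrable_continuous_interval) (use that in \<open>auto intro: continuous_on_subset[OF contlu]\<close>)
    have \<tau>: "\<tau> s = integral {l..s} a - integral {l..t\<^sub>0} a" if "s \<in> {l..u}" for s
    proof (cases "t\<^sub>0 \<le> s")
      case True
      have "integral {l..t\<^sub>0} a + integral {t\<^sub>0..s} a = integral {l..s} a"
        by (rule Henstock_Kurzweil_Integration.integral_combine) (use l that True int in auto)
      then show ?thesis using True by (simp add: \<tau>_def)
    next
      case False
      have "integral {l..s} a + integral {s..t\<^sub>0} a = integral {l..t\<^sub>0} a"
        by (rule Henstock_Kurzweil_Integration.integral_combine) (use u that False int in auto)
      then show ?thesis using False by (simp add: \<tau>_def)
    qed
    have "((\<lambda>s. integral {l..s} a - integral {l..t\<^sub>0} a) has_vector_derivative a t - 0) (at t within {l..u})"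
      by (intro has_vector_derivative_diff integral_has_vector_derivative contlu has_vector_derivative_const)
         (use l u in auto)
    then have "(\<tau> has_vector_derivative a t - 0) (at t within {l..u})"
      by (rule has_vector_derivative_transform[rotated 2]) (use \<tau> l u in auto)
    moreover have "at t within {l..u} = at t within J"
    proof (rule at_within_nhd)
      define S where "S = {(if l < t then l else t - 1)<..<(if t < u then u else t + 1)}"
      show "t \<in> S" "open S" using l(2) u(2) by (auto simp: S_def)
      have "s \<in> {l..u} \<longleftrightarrow> s \<in> J" if "s \<in> S" for s
      proof
        assume "s \<in> J"
        have "l \<le> s"
        proof (cases "l < t")
          case False
          then have "t \<le> s" using l(4) \<open>s \<in> J\<close> by blast
          then show ?thesis using l(2) by simp
        qed (use \<open>s \<in> S\<close> in \<open>simp add: S_def\<close>)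
        moreover have "s \<le> u"
        proof (cases "t < u")
          case False
          then have "s \<le> t" using u(4) \<open>s \<in> J\<close> by blast
          then show ?thesis using u(2) by simp
        qed (use \<open>s \<in> S\<close> in \<open>simp add: S_def\<close>)
        ultimately show "s \<in> {l..u}" by simp
      qed (use lu in blast)
      then show "{l..u} \<inter> S - {t} = J \<inter> S - {t}" by blast
    qed
    ultimately show ?thesis by simp
  qed
  then show ?thesis by (rule that)
qed (use that in auto)

text \<open>The new time is a primitive of the positive factor \<open>a\<close>. In it the curve is
  \<open>y\<close> composed with the inverse primitive, whose derivative is the reciprocal of
  \<open>a\<close>.\<close>

lemma time_change:
  fixes y :: "real \<Rightarrow> 'a::real_normed_vector"
  assumes J: "is_interval J" and cont: "continuous_on J a" and pos: "\<And>t. t \<in> J \<Longrightarrow> 0 < a t"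
    and y: "\<And>t. t \<in> J \<Longrightarrow> (y has_vector_derivative a t *\<^sub>R g (y t)) (at t within J)"
  shows "\<exists>\<tau> \<eta>. strict_mono_on J \<tau> \<and> continuous_on J \<tau> \<and> solves g (\<tau> ` J) \<eta> \<and> (\<forall>t\<in>J. \<eta> (\<tau> t) = y t)"
proof -
  obtain \<tau> where \<tau>: "\<And>t. t \<in> J \<Longrightarrow> (\<tau> has_vector_derivative a t) (at t within J)"
    using antiderivative_on_interval[OF J cont] by blast
  have mono: "strict_mono_on J \<tau>"
  proof (rule strict_mono_onI)
    fix r s assume rs: "r \<in> J" "s \<in> J" "r < s"
    have sub: "{r..s} \<subseteq> J"
    proof
      fix c assume "c \<in> {r..s}"
      then show "c \<in> J" using mem_is_interval_1_I[OF J rs(1,2), of c] by simp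
    qed
    have "\<exists>x\<in>{r<..<s}. \<tau> s - \<tau> r = (s - r) *\<^sub>R a x"
    proof (rule mvt_simple[OF rs(3)])
      fix x assume "r \<le> x" "x \<le> s"
      then show "(\<tau> has_derivative (\<lambda>h. h *\<^sub>R a x)) (at x within {r..s})"
        using has_vector_derivative_within_subset[OF \<tau> sub, of x] sub
        by (auto simp: has_vector_derivative_def)
    qed
    then obtain x where x: "x \<in> {r<..<s}" "\<tau> s - \<tau> r = (s - r) * a x" by auto
    have "0 < a x" by (rule pos) (use x sub in auto)
    then have "0 < (s - r) * a x" using rs(3) by simp
    then show "\<tau> r < \<tau> s" using x(2) by simp
  qed
  have cont_\<tau>: "continuous_on J \<tau>"
    unfolding continuous_on_eq_continuous_within using \<tau> has_vector_derivative_continuous by blast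
  obtain \<sigma> where \<sigma>: "homeomorphism J (\<tau> ` J) \<tau> \<sigma>"
    using homeomorphism_into_1d[of J \<tau> "\<tau> ` J"] cont_\<tau> mono J
    by (auto simp: is_interval_path_connected strict_mono_on_imp_inj_on)
  have \<sigma>\<tau>: "\<sigma> (\<tau> t) = t" if "t \<in> J" for t using \<sigma> that by (simp add: homeomorphism_def)
  have "solves g (\<tau> ` J) (y \<circ> \<sigma>)"
    unfolding solves_def
  proof
    fix s assume "s \<in> \<tau> ` J"
    then obtain t where t: "t \<in> J" "s = \<tau> t" by blast
    have "(\<sigma> has_derivative (\<lambda>h. h /\<^sub>R a t)) (at (\<tau> t) within \<tau> ` J)"
    proof (rule has_derivative_inverse_within)
      show "(\<tau> has_derivative (\<lambda>h. h *\<^sub>R a t)) (at t within J)"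
        using \<tau>[OF t(1)] by (simp add: has_vector_derivative_def)
      show "continuous (at (\<tau> t) within \<tau> ` J) \<sigma>"
        using \<sigma> t(1) by (auto simp: homeomorphism_def continuous_on_eq_continuous_within)
      show "linear (\<lambda>h. h /\<^sub>R a t)" by (rule linearI) (simp_all add: algebra_simps)
      show "(\<lambda>h. h /\<^sub>R a t) \<circ> (\<lambda>h. h *\<^sub>R a t) = id"
        using pos[OF t(1)] by (simp add: fun_eq_iff)
    qed (use t \<sigma>\<tau> in auto)
    then have "(\<sigma> has_vector_derivative inverse (a t)) (at s within \<tau> ` J)"
      by (simp add: has_vector_derivative_def t(2) mult.commute)
    moreover have "(y has_vector_derivative a t *\<^sub>R g (y t)) (at (\<sigma> s) within \<sigma> ` \<tau> ` J)"
      using y[OF t(1)] \<sigma> by (simp add: \<sigma>\<tau> t homeomorphism_def)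
    ultimately have "((y \<circ> \<sigma>) has_vector_derivative inverse (a t) *\<^sub>R a t *\<^sub>R g (y t)) (at s within \<tau> ` J)"
      by (rule vector_diff_chain_within)
    then show "((y \<circ> \<sigma>) has_vector_derivative g ((y \<circ> \<sigma>) s)) (at s within \<tau> ` J)"
      using pos[OF t(1)] by (simp add: t \<sigma>\<tau>)
  qed
  then show ?thesis
    using mono cont_\<tau> \<sigma>\<tau> by (intro exI[of _ \<tau>] exI[of _ "y \<circ> \<sigma>"]) auto
qed

section \<open>States of period two and the center subspace\<close>

context even_cycle
begin

definition pt :: "real \<Rightarrow> real \<Rightarrow> real ^ 'n::{finite,comm_ring_1}" where
  "pt m c = vec m + c *\<^sub>R alt"

text \<open>A linear functional that returns \<open>m\<close> on \<open>pt m c\<close>, because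
  \<open>alt $ 0 = 1\<close>. On other states it need not be the average of the entries.\<close>

definition mean :: "real ^ 'n::{finite,comm_ring_1} \<Rightarrow> real" where
  "mean x = x $ 0 - coef x"

lemma pt_nth: "pt m c $ j = m + c * alt $ j"
  by (simp add: pt_def)

lemma alt_inner_alt_nonzero: "alt \<bullet> alt \<noteq> 0"
  by (simp add: alt_inner_alt)

lemma coef_pt [simp]: "coef (pt m c) = c"
  using alt_inner_alt_nonzero by (simp add: coef_def pt_def inner_add_right inner_alt_vec)

lemma mean_pt [simp]: "mean (pt m c) = m"
  by (simp add: mean_def) (simp add: pt_nth alt_0)

lemma bounded_linear_coef: "bounded_linear coef"
  unfolding coef_def divide_inverse
  by (intro bounded_linear_mult_const bounded_linear_inner_right)

lemma bounded_linear_mean: "bounded_linear mean"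
  unfolding mean_def by (intro bounded_linear_sub bounded_linear_vec_nth bounded_linear_coef)

lemma coef_vec [simp]: "coef (vec m) = 0"
  by (simp add: coef_def inner_alt_vec)

lemma lorenz96_pt: "lorenz96 (pt m c) F = pt (2 * c\<^sup>2 - m + F) (- c * (2 * m + 1))"
proof -
  have "lorenz96 (pt m c) F $ j = pt (2 * c\<^sup>2 - m + F) (- c * (2 * m + 1)) $ j" for j
  proof -
    have s: "c * alt $ j * (c * alt $ j) = c\<^sup>2"
      using alt_sq[of j] by (simp add: power2_eq_square mult.assoc mult.left_commute[of "alt $ j"])
    show ?thesis
      by (simp add: lorenz96_def pt_nth alt_Suc alt_pred alt_minus_2 s[symmetric]) (simp add: algebra_simps)
  qed
  then show ?thesis unfolding vec_eq_iff by blast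
qed

lemma period_2_eq_pt:
  assumes "\<And>j. x $ (j + 2) = x $ j"
  shows "x = pt (mean x) (coef x)"
proof -
  define m where "m = (x $ 0 + x $ 1) / 2"
  define c where "c = (x $ 0 - x $ 1) / 2"
  have "x $ j = m + c * alt $ j \<and> x $ (j + 1) = m - c * alt $ j" for j
  proof (induction j rule: cyclic_induct)
    case 0
    show ?case by (simp add: m_def c_def alt_0 field_simps)
  next
    case (Suc j)
    have "x $ (j + 1 + 1) = x $ j" using assms[of j] by (simp add: add.assoc)
    then show ?case using Suc alt_Suc[of j] by simp
  qed
  then have x: "x = pt m c" by (simp add: vec_eq_iff pt_nth del: vec_nth_inject)
  show ?thesis unfolding x by simp
qed

text \<open>Besides \<open>(alt, 0)\<close>, the kernel contains the direction
  \<open>(vec 1, 1)\<close> of the line of trivial equilibria. Nothing else is central: the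
  injectivity on the complement of \<open>alt\<close> removes the factors of the power one at a
  time.\<close>

lemma center_subspace_extended_lin: "center_subspace extended_lin = {(pt m c, m) |m c. True}" (is "_ = ?T")
proof
  have sub: "subspace ?T"
  proof (rule subspaceI)
    show "0 \<in> ?T" by (auto simp: pt_def zero_prod_def vec_eq_iff intro!: exI[of _ 0])
    show "x + y \<in> ?T" if xy: "x \<in> ?T" "y \<in> ?T" for x y
    proof -
      from xy obtain m c m' c' where "x = (pt m c, m)" "y = (pt m' c', m')" by blast
      then have "x + y = (pt (m + m') (c + c'), m + m')"
        by (simp add: pt_def vec_eq_iff algebra_simps)
      then show ?thesis by blast
    qed
    show "r *\<^sub>R x \<in> ?T" if x: "x \<in> ?T" for x r
    proof -
      from x obtain m c where "x = (pt m c, m)" by blast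
      then have "r *\<^sub>R x = (pt (r * m) (r * c), r * m)"
        by (simp add: pt_def vec_eq_iff algebra_simps)
      then show ?thesis by blast
    qed
  qed
  define \<rho> where "\<rho> = (\<lambda>z. fst z - pt (snd z) (coef (fst z)))"
  have lin_rho: "\<rho> (extended_lin z) = lorenz96_lin (\<rho> z)" for z
  proof -
    have "coef (lorenz96_lin (fst z) + vec (snd z)) = 0"
      by (simp add: coef_def inner_add_right alt_inner_lin inner_alt_vec)
    moreover have "lorenz96_lin (\<rho> z) = lorenz96_lin (fst z) + vec (snd z)"
      unfolding \<rho>_def pt_def
      by (simp add: linear_diff[OF linear_lin] linear_add[OF linear_lin] linear_scale[OF linear_lin] lin_vec lin_alt)
    ultimately show ?thesis
      by (simp add: \<rho>_def extended_lin_def pt_def vec_eq_iff)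
  qed
  have add_rho: "\<rho> (z + w) = \<rho> z + \<rho> w" and scale_rho: "\<rho> (r *\<^sub>R z) = r *\<^sub>R \<rho> z" for z w r
    using linear_add[OF bounded_linear.linear[OF bounded_linear_coef]]
      linear_scale[OF bounded_linear.linear[OF bounded_linear_coef]]
    by (simp_all add: \<rho>_def pt_def vec_eq_iff algebra_simps)
  have perp: "alt \<bullet> \<rho> z = 0" for z
    using alt_inner_alt_nonzero
    by (simp add: \<rho>_def pt_def inner_diff_right inner_add_right inner_alt_vec coef_def)
  \<comment> \<open>\<open>\<rho>\<close> is the projection along the asserted center subspace; it intertwines the two linear maps.\<close>
  have rho_0: "\<rho> v = 0" if "((\<lambda>w. extended_lin (extended_lin w) + \<omega>\<^sup>2 *\<^sub>R w) ^^ k) v = 0" for \<omega> k v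
    using that
  proof (induction k arbitrary: v)
    case 0
    then show ?case by (simp add: \<rho>_def pt_def vec_eq_iff coef_def)
  next
    case (Suc k)
    have "\<rho> (extended_lin (extended_lin v) + \<omega>\<^sup>2 *\<^sub>R v) = 0"
      by (rule Suc.IH) (use Suc.prems in \<open>simp only: funpow_Suc_right o_apply\<close>)
    then have "lorenz96_lin (lorenz96_lin (\<rho> v)) + \<omega>\<^sup>2 *\<^sub>R \<rho> v = 0"
      by (simp add: add_rho scale_rho lin_rho)
    then show ?case using perp by (rule lin_squared_injective)
  qed
  have T_I: "z \<in> ?T" if "\<rho> z = 0" for z
    using that by (cases z) (auto simp: \<rho>_def)
  show "center_subspace extended_lin \<subseteq> ?T"
    unfolding center_subspace_def
    by (rule span_minimal[OF _ sub]) (use rho_0 T_I in blast)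
  show "?T \<subseteq> center_subspace extended_lin"
    unfolding center_subspace_def
  proof (rule subset_trans[OF _ span_superset], rule subsetI)
    fix z assume "z \<in> ?T"
    then obtain m c where z: "z = (pt m c, m)" by blast
    have "extended_lin z = 0"
      by (simp add: z extended_lin_def pt_def linear_add[OF linear_lin] linear_scale[OF linear_lin]
          lin_vec lin_alt zero_prod_def)
    moreover have "extended_lin (0 :: (real ^ 'n::{finite,comm_ring_1}) \<times> real) = 0"
      by (simp add: extended_lin_def linear_0[OF linear_lin] zero_prod_def vec_eq_iff)
    ultimately have "((\<lambda>w. extended_lin (extended_lin w) + 0\<^sup>2 *\<^sub>R w) ^^ 1) z = 0" by simp
    then show "z \<in> (\<Union>\<omega>::real. {v. \<exists>k. ((\<lambda>w. extended_lin (extended_lin w) + \<omega>\<^sup>2 *\<^sub>R w) ^^ k) v = 0})"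
      by blast
  qed
qed

end

section \<open>The parameter-dependent center manifold\<close>

lemma has_real_derivative_along_ray:
  fixes H :: "real \<times> real \<Rightarrow> real"
  assumes H: "(H has_derivative blinfun_apply (H' (y t, \<mu>))) (at (y t, \<mu>))"
    and y: "(y has_vector_derivative y') (at t within J)"
  shows "((\<lambda>t. H (y t, \<mu>)) has_vector_derivative y' * blinfun_apply (H' (y t, \<mu>)) (1, 0)) (at t within J)"
proof -
  have "((\<lambda>t. (y t, \<mu>)) has_vector_derivative (y', 0)) (at t within J)"
    by (intro has_vector_derivative_Pair y has_vector_derivative_const)
  then have "((\<lambda>t. (y t, \<mu>)) has_derivative (\<lambda>s. s *\<^sub>R (y', 0))) (at t within J)"
    by (simp only: has_vector_derivative_def)
  from diff_chain_within[OF this has_derivative_at_withinI[OF H]]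
  have "((\<lambda>t. H (y t, \<mu>)) has_derivative (\<lambda>s. blinfun_apply (H' (y t, \<mu>)) (s *\<^sub>R (y', 0)))) (at t within J)"
    by (simp only: o_def)
  moreover have "blinfun_apply (H' (y t, \<mu>)) (s *\<^sub>R (y', 0)) = s *\<^sub>R (y' * blinfun_apply (H' (y t, \<mu>)) (1, 0))" for s
    using blinfun.scaleR_right[of "H' (y t, \<mu>)" "s * y'" "(1, 0)"] by simp
  ultimately show ?thesis by (simp only: has_vector_derivative_def)
qed

text \<open>The bound \<open>slope\<close> keeps the factor
  \<open>1 - d \<partial>H/\<partial>d\<close> at least 1/2, so the change of time is legitimate
  throughout the neighbourhood.\<close>

locale lorenz96_center = even_cycle alt for alt :: "real ^ 'n::{finite,comm_ring_1}" +
  fixes H :: "real \<times> real \<Rightarrow> real" and H' :: "real \<times> real \<Rightarrow> (real \<times> real) \<Rightarrow>\<^sub>L real" and \<epsilon> :: real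
  assumes H_der: "(H has_derivative blinfun_apply (H' p)) (at p)"
    and H'_cont: "continuous_on UNIV H'"
    and H_0: "H (0, 0) = 0" and H'_0: "blinfun_apply (H' (0, 0)) v = snd v"
    and eps: "0 < \<epsilon>"
    and pde: "norm (d, \<mu>) < \<epsilon> \<Longrightarrow> H (d, \<mu>) = \<mu> + d\<^sup>2 + d * H (d, \<mu>) * blinfun_apply (H' (d, \<mu>)) (1, 0)"
    and slope: "norm (d, \<mu>) < \<epsilon> \<Longrightarrow> \<bar>d * blinfun_apply (H' (d, \<mu>)) (1, 0)\<bar> \<le> 1/2"
begin

text \<open>Relative to the bifurcation point: the projection onto the center subspace, and the
  coordinates \<open>(d, \<mu>)\<close>.\<close>

definition tangent :: "(real ^ 'n::{finite,comm_ring_1}) \<times> real \<Rightarrow> (real ^ 'n::{finite,comm_ring_1}) \<times> real" where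
  "tangent z = (pt (snd z) (coef (fst z)), snd z)"

definition param :: "(real ^ 'n::{finite,comm_ring_1}) \<times> real \<Rightarrow> real \<times> real" where
  "param z = (2 * coef (fst z), 2 * snd z)"

definition lift :: "real \<Rightarrow> real \<Rightarrow> real ^ 'n::{finite,comm_ring_1}" where
  "lift F \<xi> = pt ((H (\<xi>, 2 * F + 1) - 1) / 2) (\<xi> / 2)"

lemma bounded_linear_pt: "bounded_linear (\<lambda>z. pt (fst z) (snd z))"
  unfolding linear_conv_bounded_linear[symmetric]
  by (rule linearI) (simp_all add: pt_def vec_eq_iff algebra_simps)

lemmas bounded_linear_coef_fst = bounded_linear_compose[OF bounded_linear_coef bounded_linear_fst]

lemma bounded_linear_tangent: "bounded_linear tangent"
  unfolding tangent_def
  by (intro bounded_linear_Pair bounded_linear_snd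
      bounded_linear_compose[OF bounded_linear_pt, of "\<lambda>z. (snd z, coef (fst z))", simplified]
      bounded_linear_coef_fst)

lemma bounded_linear_param: "bounded_linear param"
  unfolding param_def
  by (intro bounded_linear_Pair bounded_linear_mult_right[THEN bounded_linear_compose]
      bounded_linear_coef_fst bounded_linear_snd)

lemma continuous_on_H: "continuous_on UNIV H"
  using H_der by (auto intro!: has_derivative_continuous_on)

lemma continuous_on_pt: "continuous_on S f \<Longrightarrow> continuous_on S g \<Longrightarrow> continuous_on S (\<lambda>x. pt (f x) (g x))"
  using bounded_linear.continuous_on[OF bounded_linear_pt, of S "\<lambda>x. (f x, g x)"]
  by (simp add: continuous_on_Pair)

lemma H_axis: "norm (0, \<mu>) < \<epsilon> \<Longrightarrow> H (0, \<mu>) = \<mu>"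
  using pde[of 0 \<mu>] by simp

definition radius :: real where
  "radius = (SOME r. 0 < r \<and> (\<forall>z. norm z < r \<longrightarrow> norm (param z) < \<epsilon>))"

lemma radius: "0 < radius" "norm z < radius \<Longrightarrow> norm (param z) < \<epsilon>"
proof -
  obtain K where K: "0 < K" "\<And>z. norm (param z) \<le> norm z * K"
    using bounded_linear.pos_bounded[OF bounded_linear_param] by blast
  have "norm (param z) < \<epsilon>" if "norm z < \<epsilon> / K" for z
  proof -
    have "norm z * K < \<epsilon>" using that K(1) by (simp add: pos_less_divide_eq)
    then show ?thesis using K(2)[of z] by linarith
  qed
  then have "0 < \<epsilon> / K \<and> (\<forall>z. norm z < \<epsilon> / K \<longrightarrow> norm (param z) < \<epsilon>)"
    using K(1) eps by simp
  then have "0 < radius \<and> (\<forall>z. norm z < radius \<longrightarrow> norm (param z) < \<epsilon>)"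
    unfolding radius_def by (rule someI)
  then show "0 < radius" "norm z < radius \<Longrightarrow> norm (param z) < \<epsilon>" by blast+
qed

text \<open>The pair under the norm is the base point in the center subspace, taken relative to the
  bifurcation point: mean \<open>F + 1/2\<close> and alternating part \<open>\<xi> / 2\<close>.
  Restricting it to a ball gives the graph the exact form that \<open>center_manifold\<close> asks
  for.\<close>

definition manifold :: "((real ^ 'n::{finite,comm_ring_1}) \<times> real) set" where
  "manifold = {(lift F \<xi>, F) |F \<xi>. norm (pt (F + 1/2) (\<xi> / 2), F + 1/2) < radius}"

lemma norm_param_small:
  assumes "norm (pt (F + 1/2) (\<xi> / 2), F + 1/2) < radius"
  shows "norm (\<xi>, 2 * F + 1) < \<epsilon>"
  using radius(2)[OF assms] by (simp add: param_def algebra_simps)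

lemma coef_lift [simp]: "coef (lift F \<xi>) = \<xi> / 2"
  by (simp add: lift_def)

text \<open>After reduction to period-two states with constant \<open>F\<close>, the defect
  \<open>e\<close> between \<open>2 * m + 1\<close> and \<open>H\<close> satisfies
  \<open>e' = (2 * c * h - 1) * e\<close>, with a factor bounded by \<open>slope\<close>. It
  vanishes at one time, hence always.\<close>

lemma solution_on_manifold:
  assumes J: "is_interval J" "t\<^sub>0 \<in> J" "t \<in> J"
    and sol: "solves (extended_field lorenz96) J \<gamma>"
    and W: "\<And>t. t \<in> J \<Longrightarrow> norm (tangent (\<gamma> t - (vec (- 1/2), - 1/2))) < radius"
    and t0: "\<gamma> t\<^sub>0 \<in> manifold"
  shows "\<gamma> t \<in> manifold"
proof -
  define x where "x = (\<lambda>t. fst (\<gamma> t))"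
  define F where "F = snd (\<gamma> t\<^sub>0)"
  have der: "(\<gamma> has_vector_derivative (lorenz96 (x t) (snd (\<gamma> t)), 0)) (at t within J)" if "t \<in> J" for t
    using sol that by (simp add: solves_def extended_field_def x_def case_prod_beta)
  have F: "snd (\<gamma> t) = F" if "t \<in> J" for t
  proof -
    have "snd (\<gamma> t) - F = 0"
    proof (rule zero_of_linear_growth[OF J(1,2) that, where u' = "\<lambda>_. 0"])
      show "((\<lambda>t. snd (\<gamma> t) - F) has_vector_derivative 0) (at t within J)" if "t \<in> J" for t
        using bounded_linear.has_vector_derivative[OF bounded_linear_snd der[OF that]]
        by (auto intro!: derivative_eq_intros)
      show "\<exists>B. \<forall>t\<in>{a..b}. norm (0::real) \<le> B * norm (snd (\<gamma> t) - F)" for a b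
        by (rule exI[of _ 0]) simp
    qed (simp add: F_def)
    then show ?thesis by simp
  qed
  have x: "(x has_vector_derivative lorenz96 (x t) F) (at t within J)" if "t \<in> J" for t
    using bounded_linear.has_vector_derivative[OF bounded_linear_fst der[OF that]] F[OF that]
    by (simp add: x_def)
  obtain \<xi>\<^sub>0 where \<xi>0: "x t\<^sub>0 = lift F \<xi>\<^sub>0"
    using t0 by (auto simp: manifold_def x_def F_def)
  have "x t $ (j + 2) = x t $ j" if "t \<in> J" for t j
  proof (rule lorenz96_period_2_invariant[OF J(1,2) that])
    show "solves (\<lambda>x. lorenz96 x F) J x" using x by (simp add: solves_def)
    show "x t\<^sub>0 $ (j + 2) = x t\<^sub>0 $ j" for j
      using alt_minus_2[of "j + 2"] by (simp add: \<xi>0 lift_def pt_nth)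
  qed
  then have xpt: "x t = pt (mean (x t)) (coef (x t))" if "t \<in> J" for t
    using that by (intro period_2_eq_pt)
  define m where "m = (\<lambda>t. mean (x t))"
  define c where "c = (\<lambda>t. coef (x t))"
  define \<mu> where "\<mu> = 2 * F + 1"
  have lor: "lorenz96 (x t) F = pt (2 * (c t)\<^sup>2 - m t + F) (- c t * (2 * m t + 1))" if "t \<in> J" for t
    using xpt[OF that] lorenz96_pt unfolding m_def c_def by metis
  have c: "(c has_vector_derivative - c t * (2 * m t + 1)) (at t within J)" if "t \<in> J" for t
    using bounded_linear.has_vector_derivative[OF bounded_linear_coef x[OF that]]
    by (simp add: lor[OF that] c_def)
  have m: "(m has_vector_derivative 2 * (c t)\<^sup>2 - m t + F) (at t within J)" if "t \<in> J" for t
    using bounded_linear.has_vector_derivative[OF bounded_linear_mean x[OF that]]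
    by (simp add: lor[OF that] m_def)
  have tan: "tangent (\<gamma> t - (vec (- 1/2), - 1/2)) = (pt (F + 1/2) (2 * c t / 2), F + 1/2)" if "t \<in> J" for t
    using F[OF that] linear_diff[OF bounded_linear.linear[OF bounded_linear_coef]]
    by (simp add: tangent_def c_def x_def)
  have small: "norm (2 * c t, \<mu>) < \<epsilon>" if "t \<in> J" for t
    using norm_param_small[of F "2 * c t"] W[OF that] unfolding tan[OF that] \<mu>_def by simp
  define h where "h = (\<lambda>t. blinfun_apply (H' (2 * c t, \<mu>)) (1, 0))"
  define e where "e = (\<lambda>t. 2 * m t + 1 - H (2 * c t, \<mu>))"
  have "e t = 0"
  proof (rule zero_of_linear_growth[OF J, where u' = "\<lambda>t. (2 * c t * h t - 1) * e t"])
    show "e t\<^sub>0 = 0"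
      by (simp add: e_def m_def c_def \<xi>0 \<mu>_def) (simp add: lift_def field_simps)
    fix t assume t: "t \<in> J"
    have "((\<lambda>t. 2 * c t) has_vector_derivative 2 * (- c t * (2 * m t + 1))) (at t within J)"
      using c[OF t] by (auto intro!: derivative_eq_intros simp: has_vector_derivative_def)
    from has_real_derivative_along_ray[where H = H and H' = H', OF H_der this, of \<mu>]
    have "((\<lambda>t. H (2 * c t, \<mu>)) has_vector_derivative 2 * (- c t * (2 * m t + 1)) * h t) (at t within J)"
      unfolding h_def .
    then have "(e has_vector_derivative 2 * (2 * (c t)\<^sup>2 - m t + F) - 2 * (- c t * (2 * m t + 1)) * h t) (at t within J)"
      using m[OF t] unfolding e_def has_real_derivative_iff_has_vector_derivative[symmetric]
      by (auto intro!: derivative_eq_intros)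
    moreover have "2 * (2 * (c t)\<^sup>2 - m t + F) - 2 * (- c t * (2 * m t + 1)) * h t = (2 * c t * h t - 1) * e t"
    proof -
      \<comment> \<open>The two sides differ exactly by the residual of the equation
        \<open>pde\<close>.\<close>
      have *: "2 * (2 * c\<^sup>2 - m + F) - 2 * (- c * (2 * m + 1)) * h = (2 * c * h - 1) * (2 * m + 1 - y)"
        if "y = 2 * F + 1 + (2 * c)\<^sup>2 + 2 * c * y * h" for c m h y :: real
      proof -
        have "2 * (2 * c\<^sup>2 - m + F) - 2 * (- c * (2 * m + 1)) * h - (2 * c * h - 1) * (2 * m + 1 - y)
          = 2 * F + 1 + (2 * c)\<^sup>2 + 2 * c * y * h - y"
          by (simp add: power2_eq_square algebra_simps)
        then show ?thesis using that by simp
      qed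
      have "H (2 * c t, \<mu>) = 2 * F + 1 + (2 * c t)\<^sup>2 + 2 * c t * H (2 * c t, \<mu>) * h t"
        using pde[OF small[OF t]] unfolding h_def by (simp only: \<mu>_def)
      then show ?thesis unfolding e_def by (rule *)
    qed
    ultimately show "(e has_vector_derivative (2 * c t * h t - 1) * e t) (at t within J)" by simp
  next
    fix a b assume ab: "{a..b} \<subseteq> J"
    have "norm ((2 * c t * h t - 1) * e t) \<le> 2 * norm (e t)" if "t \<in> {a..b}" for t
    proof -
      have "\<bar>2 * c t * h t\<bar> \<le> 1/2" unfolding h_def by (rule slope, rule small) (use ab that in auto)
      then have "\<bar>2 * c t * h t - 1\<bar> \<le> 2" by linarith
      then show ?thesis unfolding real_norm_def abs_mult by (intro mult_right_mono) auto
    qed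
    then show "\<exists>B. \<forall>t\<in>{a..b}. norm ((2 * c t * h t - 1) * e t) \<le> B * norm (e t)" by blast
  qed
  then have "(H (2 * c t, 2 * F + 1) - 1) / 2 = m t"
    by (simp add: e_def \<mu>_def)
  then have "lift F (2 * c t) = pt (m t) (c t)"
    unfolding lift_def by simp
  then have "x t = lift F (2 * c t)"
    using xpt[OF J(3)] unfolding m_def c_def by (simp only:)
  moreover have "norm (pt (F + 1/2) (2 * c t / 2), F + 1/2) < radius"
    using W[OF J(3)] tan[OF J(3)] by simp
  moreover have "\<gamma> t = (x t, F)" using F[OF J(3)] by (simp add: x_def prod_eq_iff)
  ultimately show ?thesis
    unfolding manifold_def by (intro CollectI exI[of _ F] exI[of _ "2 * c t"]) simp
qed

end

context lorenz96_center
begin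

text \<open>The manifold has mean \<open>H / 2\<close> relative to the bifurcation point, the base
  point has mean \<open>snd v\<close>; the graph map is the difference. Tangency holds because the
  derivative of \<open>H\<close> at the origin is \<open>snd\<close> and \<open>param\<close>
  doubles the second coordinate.\<close>

lemma graph_map:
  obtains \<phi> :: "(real ^ 'n::{finite,comm_ring_1}) \<times> real \<Rightarrow> (real ^ 'n::{finite,comm_ring_1}) \<times> real"
    and \<phi>' :: "(real ^ 'n::{finite,comm_ring_1}) \<times> real \<Rightarrow>
      ((real ^ 'n::{finite,comm_ring_1}) \<times> real) \<Rightarrow>\<^sub>L ((real ^ 'n::{finite,comm_ring_1}) \<times> real)"
  where "\<And>v. (\<phi> has_derivative blinfun_apply (\<phi>' v)) (at v)" "continuous_on UNIV \<phi>'" "\<phi>' 0 = 0"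
    "\<And>v. \<phi> v = ((H (param v) / 2 - snd v) *\<^sub>R vec 1, 0)"
proof -
  define Q where "Q = (\<lambda>s::real. (s *\<^sub>R (vec 1 :: real ^ 'n::{finite,comm_ring_1}), 0::real))"
  have Q: "bounded_linear Q"
    unfolding Q_def by (intro bounded_linear_Pair bounded_linear_scaleR_left bounded_linear_zero)
  define q where "q = Blinfun Q"
  define l where "l = Blinfun param"
  define p where "p = (Blinfun snd :: ((real ^ 'n::{finite,comm_ring_1}) \<times> real) \<Rightarrow>\<^sub>L real)"
  have q: "blinfun_apply q = Q" and l: "blinfun_apply l = param" and p: "blinfun_apply p = snd"
    unfolding q_def l_def p_def
    by (rule bounded_linear_Blinfun_apply, rule Q bounded_linear_param bounded_linear_snd)+
  define \<phi>' where "\<phi>' = (\<lambda>v. q o\<^sub>L ((1/2) *\<^sub>R (H' (param v) o\<^sub>L l) - p))"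
  define \<phi> where "\<phi> = (\<lambda>v. Q (H (param v) / 2 - snd v))"
  show ?thesis
  proof (rule that[of \<phi> \<phi>'])
    show "(\<phi> has_derivative blinfun_apply (\<phi>' v)) (at v)" for v
    proof -
      have "((\<lambda>v. H (param v)) has_derivative (\<lambda>h. blinfun_apply (H' (param v)) (param h))) (at v)"
        by (rule has_derivative_compose[OF bounded_linear_imp_has_derivative[OF bounded_linear_param] H_der])
      then have "((\<lambda>v. H (param v) / 2 - snd v) has_derivative
          (\<lambda>h. blinfun_apply (H' (param v)) (param h) / 2 - snd h)) (at v)"
        by (auto intro!: derivative_eq_intros)
      from bounded_linear.has_derivative[OF Q this]
      have "(\<phi> has_derivative (\<lambda>h. Q (blinfun_apply (H' (param v)) (param h) / 2 - snd h))) (at v)"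
        unfolding \<phi>_def .
      moreover have "blinfun_apply (\<phi>' v) = (\<lambda>h. Q (blinfun_apply (H' (param v)) (param h) / 2 - snd h))"
        by (simp add: fun_eq_iff \<phi>'_def q l p blinfun.diff_left blinfun.scaleR_left)
      ultimately show ?thesis by simp
    qed
    have "continuous_on UNIV (\<lambda>v. H' (param v))"
      by (rule continuous_on_compose2[OF H'_cont linear_continuous_on[OF bounded_linear_param]]) auto
    then show "continuous_on UNIV \<phi>'"
      unfolding \<phi>'_def
      by (intro bounded_bilinear.continuous_on[OF bounded_bilinear_blinfun_compose] continuous_intros)
    show "\<phi>' 0 = 0"
    proof (rule blinfun_eqI)
      fix v
      have "param 0 = (0, 0)" by (simp add: param_def coef_def)
      then show "blinfun_apply (\<phi>' 0) v = blinfun_apply 0 v"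
        by (simp add: \<phi>'_def q l p blinfun.diff_left blinfun.scaleR_left H'_0 param_def[of v] Q_def zero_prod_def)
    qed
    show "\<phi> v = ((H (param v) / 2 - snd v) *\<^sub>R vec 1, 0)" for v
      by (simp add: \<phi>_def Q_def)
  qed
qed

lemma center_manifold_manifold: "center_manifold (extended_field lorenz96) (vec (- 1/2), - 1/2) manifold"
proof -
  let ?z = "(vec (- 1/2) :: real ^ 'n::{finite,comm_ring_1}, - 1/2 :: real)"
  let ?G = "extended_field (lorenz96 :: real ^ 'n::{finite,comm_ring_1} \<Rightarrow> _)"
  define T where "T = {(pt m c, m) |m c. True}"
  have fd: "center_subspace (frechet_derivative ?G (at ?z)) = T"
    unfolding T_def center_subspace_extended_lin[symmetric]
      frechet_derivative_at[OF extended_field_has_derivative, symmetric] ..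
  obtain \<phi> :: "(real ^ 'n::{finite,comm_ring_1}) \<times> real \<Rightarrow> (real ^ 'n::{finite,comm_ring_1}) \<times> real"
    and \<phi>' where \<phi>: "\<And>v. (\<phi> has_derivative blinfun_apply (\<phi>' v)) (at v)" "continuous_on UNIV \<phi>'" "\<phi>' 0 = 0"
      "\<And>v. \<phi> v = ((H (param v) / 2 - snd v) *\<^sub>R vec 1, 0)"
    by (rule graph_map) (rule that)
  \<comment> \<open>The kernel of the projection \<open>tangent\<close>; it contains the direction
    \<open>(vec 1, 0)\<close> of the graph map.\<close>
  define N where "N = {(w :: real ^ 'n::{finite,comm_ring_1}, 0 :: real) |w. alt \<bullet> w = 0}"
  have N_iff: "z \<in> N \<longleftrightarrow> alt \<bullet> fst z = 0 \<and> snd z = 0" for z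
    by (cases z) (auto simp: N_def)
  have 1: "?G ?z = 0"
    by (simp add: extended_field_def lorenz96_def vec_eq_iff zero_prod_def)
  have 2: "?G differentiable (at ?z)"
    using extended_field_has_derivative unfolding differentiable_def by blast
  have subspace: "subspace N"
    by (rule subspaceI) (auto simp: N_iff inner_add_right)
  have inter: "T \<inter> N = {0}"
  proof
    show "T \<inter> N \<subseteq> {0}"
    proof
      fix z assume z: "z \<in> T \<inter> N"
      then obtain m c where mc: "z = (pt m c, m)" by (auto simp: T_def)
      then have "m = 0" "alt \<bullet> pt m c = 0" using z by (auto simp: N_iff)
      then have "c = 0" using coef_pt[of m c] by (simp add: coef_def)
      then show "z \<in> {0}" using mc \<open>m = 0\<close> by (simp add: pt_def zero_prod_def vec_eq_iff)
    qed
    have "(0 :: (real ^ 'n::{finite,comm_ring_1}) \<times> real) = (pt 0 0, 0)"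
      by (simp add: pt_def zero_prod_def vec_eq_iff)
    then show "{0} \<subseteq> T \<inter> N" unfolding T_def by (auto simp: N_iff)
  qed
  have decomp: "\<exists>v\<in>T. \<exists>w\<in>N. z = v + w" for z
  proof (intro bexI)
    show "z = tangent z + (z - tangent z)" by simp
    show "tangent z \<in> T" unfolding T_def tangent_def by blast
    have "alt \<bullet> pt m c = c * (alt \<bullet> alt)" for m c
      by (simp add: pt_def inner_add_right inner_alt_vec)
    then show "z - tangent z \<in> N"
      using alt_inner_alt_nonzero by (simp add: N_iff tangent_def inner_diff_right coef_def)
  qed
  have param0: "param 0 = (0, 0)" by (simp add: param_def coef_def)
  have phi0: "\<phi> 0 = 0" by (simp only: \<phi>(4) param0 H_0) (simp add: zero_prod_def)
  have phiN: "\<phi> v \<in> N" for v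
    using inner_alt_vec[of 1] by (simp add: \<phi>(4) N_iff)
  have image: "manifold = (\<lambda>v. ?z + v + \<phi> v) ` (T \<inter> ball 0 radius)"
  proof -
    have eq: "?z + (pt (F + 1/2) (\<xi> / 2), F + 1/2) + \<phi> (pt (F + 1/2) (\<xi> / 2), F + 1/2) = (lift F \<xi>, F)" for F \<xi>
    proof -
      have "param (pt (F + 1/2) (\<xi> / 2), F + 1/2) = (\<xi>, 2 * F + 1)"
        by (simp add: param_def algebra_simps)
      then show ?thesis
        unfolding \<phi>(4) by (simp add: lift_def pt_def vec_eq_iff field_simps)
    qed
    show ?thesis
    proof (intro set_eqI iffI)
      fix z assume "z \<in> manifold"
      then obtain F \<xi> where z: "z = (lift F \<xi>, F)" "norm (pt (F + 1/2) (\<xi> / 2), F + 1/2) < radius"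
        by (auto simp: manifold_def)
      then have "(pt (F + 1/2) (\<xi> / 2), F + 1/2) \<in> T \<inter> ball 0 radius" by (auto simp: T_def)
      then show "z \<in> (\<lambda>v. ?z + v + \<phi> v) ` (T \<inter> ball 0 radius)"
        unfolding z(1) eq[symmetric] by (rule imageI)
    next
      fix z assume "z \<in> (\<lambda>v. ?z + v + \<phi> v) ` (T \<inter> ball 0 radius)"
      then obtain m c where mc: "z = ?z + (pt m c, m) + \<phi> (pt m c, m)" "norm (pt m c, m) < radius"
        unfolding T_def by auto
      have "z = (lift (m - 1/2) (2 * c), m - 1/2)"
        using mc(1) eq[of "m - 1/2" "2 * c"] by simp
      moreover have "norm (pt (m - 1/2 + 1/2) (2 * c / 2), m - 1/2 + 1/2) < radius" using mc(2) by simp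
      ultimately show "z \<in> manifold" unfolding manifold_def by blast
    qed
  qed
  \<comment> \<open>The whole tube over the ball: inside it the base point stays in the domain of
    the graph, so only the defect could take a solution off the manifold.\<close>
  define W where "W = {z. norm (tangent (z - ?z)) < radius}"
  have W: "open W"
  proof -
    have "continuous_on UNIV (\<lambda>z. norm (tangent (z - ?z)))"
      by (intro continuous_intros bounded_linear.continuous_on[OF bounded_linear_tangent])
    then have "open {z. norm (tangent (z - ?z)) < radius}"
      by (rule open_Collect_less) (rule continuous_on_const)
    then show ?thesis unfolding W_def .
  qed
  have zW: "?z \<in> W"
    using radius(1) linear_0[OF bounded_linear.linear[OF bounded_linear_tangent]] by (simp add: W_def)
  have inv: "\<gamma> ` J \<subseteq> manifold"
    if sol: "is_interval J" "solves ?G J \<gamma>" "\<gamma> ` J \<subseteq> W" "\<gamma> ` J \<inter> manifold \<noteq> {}" for J \<gamma>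
  proof -
    obtain t0 where t0: "t0 \<in> J" "\<gamma> t0 \<in> manifold" using sol(4) by blast
    show ?thesis
    proof (rule image_subsetI)
      fix t assume t: "t \<in> J"
      show "\<gamma> t \<in> manifold"
        by (rule solution_on_manifold[OF sol(1) t0(1) t sol(2) _ t0(2)])
           (use sol(3) in \<open>auto simp: W_def\<close>)
    qed
  qed
  show ?thesis
    unfolding center_manifold_def Let_def fd
  proof (intro conjI 1 2)
    show "\<exists>N r \<phi> (\<phi>' :: _ \<Rightarrow> _ \<Rightarrow>\<^sub>L _). subspace N \<and> T \<inter> N = {0} \<and> (\<forall>z. \<exists>v\<in>T. \<exists>w\<in>N. z = v + w) \<and>
          r > 0 \<and> (\<forall>v\<in>ball 0 r. (\<phi> has_derivative blinfun_apply (\<phi>' v)) (at v)) \<and>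
          continuous_on (ball 0 r) \<phi>' \<and> \<phi> 0 = 0 \<and> \<phi>' 0 = 0 \<and>
          (\<forall>v\<in>T \<inter> ball 0 r. \<phi> v \<in> N) \<and> manifold = (\<lambda>v. ?z + v + \<phi> v) ` (T \<inter> ball 0 r)"
      using subspace inter decomp radius(1) \<phi>(1) continuous_on_subset[OF \<phi>(2) subset_UNIV] phi0 \<phi>(3) phiN image
      by (intro exI[of _ N] exI[of _ radius] exI[of _ \<phi>] exI[of _ \<phi>'] conjI allI ballI)
    show "\<exists>W. open W \<and> ?z \<in> W \<and> (\<forall>J \<gamma>. is_interval J \<and> solves ?G J \<gamma> \<and> \<gamma> ` J \<subseteq> W \<and> \<gamma> ` J \<inter> manifold \<noteq> {}
        \<longrightarrow> \<gamma> ` J \<subseteq> manifold)"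
      using W zW inv by (intro exI[of _ W] conjI allI impI) blast+
  qed
qed

lemma pt_scaleR: "pt (k * a) (k * b) = k *\<^sub>R pt a b"
  by (simp add: pt_def vec_eq_iff algebra_simps)

lemma slice_manifold:
  "slice manifold F = lift F ` {\<xi>. norm (pt (F + 1/2) (\<xi> / 2), F + 1/2) < radius}"
  unfolding slice_def manifold_def by auto

section \<open>Equivalence with the normal form\<close>

text \<open>On the manifold the reduced equation is the normal form divided by \<open>1 - d \<partial>H/\<partial>d > 0\<close>, so
  the coordinate itself is the equivalence and only time has to be changed.\<close>

lemma reduced_field:
  fixes \<xi> F :: real
  assumes "norm (\<xi>, 2 * F + 1) < \<epsilon>"
  defines "\<kappa> \<equiv> 1 - \<xi> * blinfun_apply (H' (\<xi>, 2 * F + 1)) (1, 0)"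
  shows "0 < \<kappa>" "pitchfork_normal_form (- 1) (- (2 * F + 1)) \<xi> = \<kappa> * (- \<xi> * H (\<xi>, 2 * F + 1))"
    "lorenz96 (lift F \<xi>) F =
      pt (- \<xi> * H (\<xi>, 2 * F + 1) * blinfun_apply (H' (\<xi>, 2 * F + 1)) (1, 0) / 2) (- \<xi> * H (\<xi>, 2 * F + 1) / 2)"
proof -
  define h where "h = blinfun_apply (H' (\<xi>, 2 * F + 1)) (1, 0)"
  define y where "y = H (\<xi>, 2 * F + 1)"
  have p: "y = 2 * F + 1 + \<xi>\<^sup>2 + \<xi> * y * h"
    using pde[OF assms(1)] unfolding h_def y_def .
  show "0 < \<kappa>" using slope[OF assms(1)] unfolding \<kappa>_def by linarith
  have "- (2 * F + 1) * \<xi> + - 1 * \<xi> ^ 3 = - \<xi> * (2 * F + 1 + \<xi>\<^sup>2)"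
    by (simp add: algebra_simps power2_eq_square power3_eq_cube)
  also have "2 * F + 1 + \<xi>\<^sup>2 = y - \<xi> * y * h" using p by linarith
  also have "- \<xi> * (y - \<xi> * y * h) = (1 - \<xi> * h) * (- \<xi> * y)" by (simp add: algebra_simps)
  finally show "pitchfork_normal_form (- 1) (- (2 * F + 1)) \<xi> = \<kappa> * (- \<xi> * H (\<xi>, 2 * F + 1))"
    unfolding pitchfork_normal_form_def \<kappa>_def h_def[symmetric] y_def[symmetric] .
  have "2 * (\<xi> / 2)\<^sup>2 - (y - 1) / 2 + F = - \<xi> * y * h / 2"
    using p by (simp add: power2_eq_square field_simps)
  moreover have "- (\<xi> / 2) * (2 * ((y - 1) / 2) + 1) = - \<xi> * y / 2"
    by (simp add: field_simps)
  ultimately show "lorenz96 (lift F \<xi>) F =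
      pt (- \<xi> * H (\<xi>, 2 * F + 1) * blinfun_apply (H' (\<xi>, 2 * F + 1)) (1, 0) / 2) (- \<xi> * H (\<xi>, 2 * F + 1) / 2)"
    unfolding lift_def lorenz96_pt h_def[symmetric] y_def[symmetric] by (simp only:)
qed

text \<open>In the coordinate \<xi> the reduced field is \<open>- \<xi> * H\<close> and the normal
  form is a positive multiple \<kappa> of it. The two inclusions of orbits are changes of time by
  \<open>inverse \<kappa>\<close> and by \<kappa>.\<close>

lemma orbit_equivalence_slice:
  fixes F :: real
  defines "B \<equiv> {\<xi>. norm (pt (F + 1/2) (\<xi> / 2), F + 1/2) < radius}"
  shows "orbit_equivalence (\<lambda>x. lorenz96 x F) (slice manifold F)
    (pitchfork_normal_form (- 1) (- (2 * F + 1))) B (\<lambda>x. 2 * coef x) (lift F)"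
proof -
  let ?g = "pitchfork_normal_form (- 1) (- (2 * F + 1))"
  define \<mu> where "\<mu> = 2 * F + 1"
  define h where "h = (\<lambda>\<xi>. blinfun_apply (H' (\<xi>, \<mu>)) (1, 0))"
  have slice: "slice manifold F = lift F ` B" unfolding B_def by (rule slice_manifold)
  have small: "norm (\<xi>, 2 * F + 1) < \<epsilon>" if "\<xi> \<in> B" for \<xi>
    using that norm_param_small unfolding B_def by blast
  have red: "0 < 1 - \<xi> * h \<xi>" "?g \<xi> = (1 - \<xi> * h \<xi>) * (- \<xi> * H (\<xi>, \<mu>))"
    "lorenz96 (lift F \<xi>) F = pt (- \<xi> * H (\<xi>, \<mu>) * h \<xi> / 2) (- \<xi> * H (\<xi>, \<mu>) / 2)" if "\<xi> \<in> B" for \<xi>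
    using reduced_field[OF small[OF that]] unfolding h_def \<mu>_def by blast+
  have cont_h: "continuous_on UNIV h"
    unfolding h_def
    by (intro continuous_intros continuous_on_compose2[OF H'_cont]) auto
  have cont_lift: "continuous_on UNIV (lift F)"
    unfolding lift_def
    by (intro continuous_on_pt continuous_intros continuous_on_compose2[OF continuous_on_H]) auto
  have hom: "homeomorphism (slice manifold F) B (\<lambda>x. 2 * coef x) (lift F)"
    unfolding slice
    by (rule homeomorphismI)
       (auto intro!: continuous_intros bounded_linear.continuous_on[OF bounded_linear_coef]
         continuous_on_subset[OF cont_lift])
  have fwd: "maps_orbits (\<lambda>x. lorenz96 x F) (slice manifold F) ?g (\<lambda>x. 2 * coef x)"
    unfolding maps_orbits_def
  proof (intro allI impI, elim conjE)
    fix J and \<gamma> :: "real \<Rightarrow> real ^ 'n::{finite,comm_ring_1}"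
    assume J: "is_interval J" and sol: "solves (\<lambda>x. lorenz96 x F) J \<gamma>" and sub: "\<gamma> ` J \<subseteq> slice manifold F"
    define \<xi> where "\<xi> = (\<lambda>t. 2 * coef (\<gamma> t))"
    have \<xi>: "\<gamma> t = lift F (\<xi> t)" "\<xi> t \<in> B" if "t \<in> J" for t
      using sub that unfolding slice by (auto simp: \<xi>_def image_subset_iff)
    have der: "(\<xi> has_vector_derivative - \<xi> t * H (\<xi> t, \<mu>)) (at t within J)" if t: "t \<in> J" for t
    proof -
      have "(\<gamma> has_vector_derivative lorenz96 (\<gamma> t) F) (at t within J)"
        using sol t by (simp add: solves_def)
      from bounded_linear.has_vector_derivative[OF bounded_linear_coef this]
      have "((\<lambda>t. coef (\<gamma> t)) has_vector_derivative - \<xi> t * H (\<xi> t, \<mu>) / 2) (at t within J)"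
        unfolding \<xi>(1)[OF t] red(3)[OF \<xi>(2)[OF t]] coef_pt by (simp add: \<xi>_def)
      then show ?thesis
        unfolding \<xi>_def by (auto intro!: derivative_eq_intros simp: has_vector_derivative_def)
    qed
    have cont: "continuous_on J \<xi>"
      using der unfolding continuous_on_eq_continuous_within by (blast intro: has_vector_derivative_continuous)
    show "\<exists>\<tau> \<eta>. strict_mono_on J \<tau> \<and> continuous_on J \<tau> \<and> solves ?g (\<tau> ` J) \<eta> \<and> (\<forall>t\<in>J. \<eta> (\<tau> t) = 2 * coef (\<gamma> t))"
      unfolding \<xi>_def[symmetric, THEN fun_cong]
    proof (rule time_change[OF J, where a = "\<lambda>t. inverse (1 - \<xi> t * h (\<xi> t))"])
      show "continuous_on J (\<lambda>t. inverse (1 - \<xi> t * h (\<xi> t)))"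
        using red(1)[OF \<xi>(2)]
        by (intro continuous_intros cont continuous_on_compose2[OF cont_h]) (auto simp: less_le)
      show "0 < inverse (1 - \<xi> t * h (\<xi> t))" if "t \<in> J" for t
        using red(1)[OF \<xi>(2)[OF that]] by simp
      show "(\<xi> has_vector_derivative inverse (1 - \<xi> t * h (\<xi> t)) *\<^sub>R ?g (\<xi> t)) (at t within J)" if "t \<in> J" for t
      proof -
        have "inverse k *\<^sub>R (k * v) = v" if "0 < k" for k v :: real using that by simp
        from this[OF red(1)[OF \<xi>(2)[OF that]]] show ?thesis
          using der[OF that] unfolding red(2)[OF \<xi>(2)[OF that]] by (simp only:)
      qed
    qed
  qed
  have bwd: "maps_orbits ?g B (\<lambda>x. lorenz96 x F) (lift F)"
    unfolding maps_orbits_def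
  proof (intro allI impI, elim conjE)
    fix J and \<gamma> :: "real \<Rightarrow> real"
    assume J: "is_interval J" and sol: "solves ?g J \<gamma>" and sub: "\<gamma> ` J \<subseteq> B"
    have \<gamma>B: "\<gamma> t \<in> B" if "t \<in> J" for t using sub that by blast
    have der: "(\<gamma> has_vector_derivative (1 - \<gamma> t * h (\<gamma> t)) * (- \<gamma> t * H (\<gamma> t, \<mu>))) (at t within J)"
      if "t \<in> J" for t
      using sol that unfolding solves_def red(2)[OF \<gamma>B[OF that], symmetric] by blast
    have cont: "continuous_on J \<gamma>"
      using der unfolding continuous_on_eq_continuous_within by (blast intro: has_vector_derivative_continuous)
    show "\<exists>\<tau> \<eta>. strict_mono_on J \<tau> \<and> continuous_on J \<tau> \<and> solves (\<lambda>x. lorenz96 x F) (\<tau> ` J) \<eta> \<and>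
        (\<forall>t\<in>J. \<eta> (\<tau> t) = lift F (\<gamma> t))"
    proof (rule time_change[OF J, where a = "\<lambda>t. 1 - \<gamma> t * h (\<gamma> t)"])
      show "continuous_on J (\<lambda>t. 1 - \<gamma> t * h (\<gamma> t))"
        by (intro continuous_intros cont continuous_on_compose2[OF cont_h]) auto
      show "0 < 1 - \<gamma> t * h (\<gamma> t)" if "t \<in> J" for t
        by (rule red(1)[OF \<gamma>B[OF that]])
      fix t assume t: "t \<in> J"
      let ?k = "1 - \<gamma> t * h (\<gamma> t)" and ?v = "- \<gamma> t * H (\<gamma> t, \<mu>)"
      have "((\<lambda>t. H (\<gamma> t, \<mu>)) has_vector_derivative ?k * ?v * h (\<gamma> t)) (at t within J)"
        using has_real_derivative_along_ray[where H = H and H' = H' and y = \<gamma> and \<mu> = \<mu>, OF H_der der[OF t]]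
        by (simp only: h_def)
      then have 1: "((\<lambda>t. (H (\<gamma> t, \<mu>) - 1) / 2) has_vector_derivative ?k * ?v * h (\<gamma> t) / 2) (at t within J)"
        by (auto intro!: derivative_eq_intros simp flip: has_real_derivative_iff_has_vector_derivative)
      have 2: "((\<lambda>t. \<gamma> t / 2) has_vector_derivative ?k * ?v / 2) (at t within J)"
        using der[OF t] by (auto intro!: derivative_eq_intros simp flip: has_real_derivative_iff_has_vector_derivative)
      have "((\<lambda>t. lift F (\<gamma> t)) has_vector_derivative pt (?k * ?v * h (\<gamma> t) / 2) (?k * ?v / 2)) (at t within J)"
        using bounded_linear.has_vector_derivative[OF bounded_linear_pt has_vector_derivative_Pair[OF 1 2]]
        by (simp add: lift_def \<mu>_def)
      moreover have "pt (?k * ?v * h (\<gamma> t) / 2) (?k * ?v / 2) = ?k *\<^sub>R lorenz96 (lift F (\<gamma> t)) F"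
        unfolding red(3)[OF \<gamma>B[OF t]] pt_scaleR[symmetric]
        by (simp only: times_divide_eq_right mult.assoc)
      ultimately show "((\<lambda>t. lift F (\<gamma> t)) has_vector_derivative ?k *\<^sub>R lorenz96 (lift F (\<gamma> t)) F) (at t within J)"
        by simp
    qed
  qed
  show ?thesis unfolding orbit_equivalence_def using hom fwd bwd by blast
qed

lemma pitchfork: "supercritical_pitchfork_bifurcation lorenz96 (\<lambda>F. vec F :: real ^ 'n::{finite,comm_ring_1}) (- 1/2)"
proof -
  let ?f = "lorenz96 :: real ^ 'n::{finite,comm_ring_1} \<Rightarrow> _"
  define B where "B = (\<lambda>F. {\<xi>. norm (pt (F + 1/2) (\<xi> / 2), F + 1/2) < radius})"
  \<comment> \<open>The linear rate on the manifold is \<open>- H (0, \<mu>) = - \<mu>\<close>, so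
    the orientation of the parameter is reversed.\<close>
  define \<beta> where "\<beta> = (\<lambda>F::real. - (2 * F + 1))"
  define \<beta>' where "\<beta>' = (\<lambda>b::real. - (b + 1) / 2)"
  have norm_cont: "continuous_on UNIV (\<lambda>p. norm (pt (fst p + 1/2) (snd p / 2), fst p + 1/2))"
    by (auto intro!: continuous_intros continuous_on_pt)
  have "open {p. norm (pt (fst p + 1/2) (snd p / 2), fst p + 1/2) < radius}"
    by (rule open_Collect_less[OF norm_cont]) (rule continuous_on_const)
  moreover have "(- 1/2, 0) \<in> {p. norm (pt (fst p + 1/2) (snd p / 2), fst p + 1/2) < radius}"
    using radius(1) by (simp add: pt_def zero_prod_def[symmetric])
  \<comment> \<open>A box inside the open set of admissible pairs \<open>(F, \<xi>)\<close> provides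
    a neighbourhood \<open>V\<close> that serves all \<open>F\<close> in \<open>I\<close>.\<close>
  ultimately obtain I V where IV: "open I" "open V" "(- 1/2, 0) \<in> I \<times> V"
      "I \<times> V \<subseteq> {p. norm (pt (fst p + 1/2) (snd p / 2), fst p + 1/2) < radius}"
    by (rule open_prod_elim) blast
  have VB: "V \<subseteq> B F" if "F \<in> I" for F
    using IV(4) that by (auto simp: B_def)
  have hom: "homeomorphism I (\<beta> ` I) \<beta> \<beta>'"
    by (rule homeomorphismI) (auto simp: \<beta>_def \<beta>'_def intro!: continuous_intros)
  have open_P: "open (\<beta> ` I)"
  proof -
    have "\<beta> ` I = \<beta>' -` I"
      by (auto simp: \<beta>_def \<beta>'_def image_iff field_simps intro!: bexI[of _ "- (_ + 1) / 2"])
    moreover have "open (\<beta>' -` I)"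
      by (rule open_vimage[OF IV(1)]) (auto simp: \<beta>'_def intro!: continuous_intros)
    ultimately show ?thesis by simp
  qed
  have open_B: "open (B F)" for F
    unfolding B_def
    by (auto intro!: open_Collect_less continuous_intros continuous_on_pt)
  have x0: "vec F \<in> slice manifold F" if "F \<in> I" for F
  proof -
    have "0 \<in> B F" using VB[OF that] IV(3) by blast
    have "lift F 0 = vec F"
      using H_axis[of "2 * F + 1"] norm_param_small[of F 0] \<open>0 \<in> B F\<close>
      by (simp add: B_def lift_def pt_def)
    then show ?thesis
      using \<open>0 \<in> B F\<close> unfolding slice_manifold B_def by (metis (lifting) imageI)
  qed
  have eq: "?f (vec F) F = 0" for F
    by (simp add: lorenz96_def vec_eq_iff)
  have diff: "(\<lambda>x. ?f x (- 1/2)) differentiable (at (vec (- 1/2)))"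
    using lorenz96_has_derivative unfolding differentiable_def by blast
  have beta0: "\<beta> (- 1/2) = 0" by (simp add: \<beta>_def)
  show ?thesis
    unfolding supercritical_pitchfork_bifurcation_def pitchfork_bifurcation_sign_def
  proof (intro conjI diff simple_zero_eigenvalue)
    show "\<exists>M I P \<beta> \<beta>' U V A B h k.
        center_manifold (extended_field ?f) (vec (- 1/2), - 1/2) M \<and>
        open I \<and> - 1/2 \<in> I \<and> open P \<and> homeomorphism I P \<beta> \<beta>' \<and> \<beta> (- 1/2) = 0 \<and>
        open U \<and> vec (- 1/2) \<in> U \<and> open V \<and> 0 \<in> V \<and>
        (\<forall>F\<in>I. ?f (vec F) F = 0 \<and>
           openin (top_of_set (slice M F)) (A F) \<and> slice M F \<inter> U \<subseteq> A F \<and>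
           open (B F) \<and> V \<subseteq> B F \<and> vec F \<in> A F \<and> h F (vec F) = 0 \<and>
           orbit_equivalence (\<lambda>x. ?f x F) (A F) (pitchfork_normal_form (- 1) (\<beta> F)) (B F) (h F) (k F))"
    proof (rule exI[of _ manifold], rule exI[of _ I], rule exI[of _ "\<beta> ` I"], rule exI[of _ \<beta>],
        rule exI[of _ \<beta>'], rule exI[of _ UNIV], rule exI[of _ V], rule exI[of _ "slice manifold"],
        rule exI[of _ B], rule exI[of _ "\<lambda>_ x. 2 * coef x"], rule exI[of _ lift], intro conjI ballI)
      show "center_manifold (extended_field ?f) (vec (- 1/2), - 1/2) manifold"
        by (rule center_manifold_manifold)
      show "open I" "- 1/2 \<in> I" "open V" "0 \<in> V" using IV by auto
      show "open (\<beta> ` I)" "homeomorphism I (\<beta> ` I) \<beta> \<beta>'" "\<beta> (- 1/2) = 0"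
        by (fact open_P hom beta0)+
      show "open (UNIV :: (real ^ 'n::{finite,comm_ring_1}) set)"
        "vec (- 1/2) \<in> (UNIV :: (real ^ 'n::{finite,comm_ring_1}) set)" by auto
      fix F assume F: "F \<in> I"
      show "?f (vec F) F = 0" by (rule eq)
      show "openin (top_of_set (slice manifold F)) (slice manifold F)" by simp
      show "slice manifold F \<inter> UNIV \<subseteq> slice manifold F" by simp
      show "open (B F)" "V \<subseteq> B F" "vec F \<in> slice manifold F" by (fact open_B VB[OF F] x0[OF F])+
      show "2 * coef (vec F) = 0" by simp
      show "orbit_equivalence (\<lambda>x. ?f x F) (slice manifold F) (pitchfork_normal_form (- 1) (\<beta> F)) (B F)
          (\<lambda>x. 2 * coef x) (lift F)"
        unfolding \<beta>_def B_def by (rule orbit_equivalence_slice)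
    qed
  qed
qed

end

theorem theorem4:
  assumes "surj (of_nat :: nat \<Rightarrow> 'n::{finite,comm_ring_1})"
    and "even CARD('n::{finite,comm_ring_1})"
  shows "supercritical_pitchfork_bifurcation
           (lorenz96 :: (real, 'n::{finite,comm_ring_1}) vec \<Rightarrow> _) (\<lambda>F. vec F) (- 1/2)"
proof -
  obtain alt :: "real ^ 'n::{finite,comm_ring_1}" where "even_cycle alt"
    using assms by (rule even_cycle_exists)
  obtain H :: "real \<times> real \<Rightarrow> real" and H' and \<epsilon> :: real where H: "\<And>p. (H has_derivative blinfun_apply (H' p)) (at p)"
    "continuous_on UNIV H'" "H (0, 0) = 0" "\<And>v. blinfun_apply (H' (0, 0)) v = snd v" "0 < \<epsilon>"
    "\<And>d \<mu>. norm (d, \<mu>) < \<epsilon> \<Longrightarrow> H (d, \<mu>) = \<mu> + d\<^sup>2 + d * H (d, \<mu>) * blinfun_apply (H' (d, \<mu>)) (1, 0)"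
    by (rule center_manifold_function) (rule that)
  \<comment> \<open>This function is continuous and vanishes at the origin because of the factor
    \<open>d\<close>; shrinking the neighbourhood to radius \<open>r\<close> yields
    \<open>slope\<close>.\<close>
  define s where "s = (\<lambda>p :: real \<times> real. fst p * blinfun_apply (H' p) (1, 0))"
  have "continuous_on UNIV s"
    unfolding s_def by (intro continuous_intros H(2))
  then have "isCont s (0, 0)" by (simp add: continuous_on_eq_continuous_at)
  then obtain r where r: "0 < r" "\<And>p. dist p (0, 0) < r \<Longrightarrow> dist (s p) (s (0, 0)) < 1/2"
    unfolding continuous_at_eps_delta by (metis half_gt_zero_iff zero_less_one)
  have "lorenz96_center alt H H' (min \<epsilon> r)"
    unfolding lorenz96_center_def lorenz96_center_axioms_def
  proof (intro conjI allI impI \<open>even_cycle alt\<close> H(1-4))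
    show "0 < min \<epsilon> r" using H(5) r(1) by simp
    fix d \<mu> :: real assume small: "norm (d, \<mu>) < min \<epsilon> r"
    then show "H (d, \<mu>) = \<mu> + d\<^sup>2 + d * H (d, \<mu>) * blinfun_apply (H' (d, \<mu>)) (1, 0)"
      by (intro H(6)) simp
    have "dist (s (d, \<mu>)) (s (0, 0)) < 1/2" by (rule r(2)) (use small in \<open>simp add: dist_norm\<close>)
    then show "\<bar>d * blinfun_apply (H' (d, \<mu>)) (1, 0)\<bar> \<le> 1/2" by (simp add: s_def dist_real_def)
  qed
  then interpret lorenz96_center alt H H' "min \<epsilon> r" .
  show ?thesis by (rule pitchfork)
qed

end
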